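(* Let $p\in\mathbb{R}$, $q\ge 0$, and let $\tilde\nabla$ be the Levi-Civita connection of the $(p,q)$-metric $h_{p,q}$ on $T^\perp L$. Then for all vector fields $X,Y$ on $L$, all sections $\xi,\eta$ of $T^\perp L$ and every $\theta\in T^\perp L$, $$(\tilde\nabla_{X^h}Y^h)_\theta=(\nabla_XY)^h_\theta-\tfrac12\big(R^\perp(X,Y)\theta\big)^v_\theta,$$ $$(\tilde\nabla_{X^h}\eta^v)_\theta=\tfrac12\omega_\theta^p\big(\hat R(\theta,\eta)X\big)^h_\theta+(\nabla^\perp_X\eta)^v_\theta,$$ $$(\tilde\nabla_{\eta^v}Y^h)_\theta=\tfrac12\omega_\theta^p\big(\hat R(\theta,\eta)Y\big)^h_\theta,$$ $$(\tilde\nabla_{\xi^v}\eta^v)_\theta=-p\,\omega_\theta\big(\langle\xi,\theta\rangle^\perp\eta^v+\langle\eta,\theta\rangle^\perp\xi^v\big)_\theta+\big(\nu_\theta\langle\xi,\theta\rangle^\perp\langle\eta,\theta\rangle^\perp+\mu_\theta\langle\xi,\eta\rangle^\perp\big)\Theta_\theta,$$ where $$\nu_\theta=\frac{pq\,\omega_\theta}{1+q\langle\theta,\theta\rangle^\perp},\qquad \mu_\theta=\frac{q+p\,\omega_\theta}{1+q\langle\theta,\theta\rangle^\perp}.$$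
   Context: All objects are smooth. $(M,g)$ is a Riemannian manifold of dimension $\ge 2$ and $L\subset M$ a submanifold with $1\le\dim L<\dim M$. $\langle\cdot,\cdot\rangle$ is the metric induced by $g$ on $L$, $\nabla$ its Levi-Civita connection. $\pi:T^\perp L\to L$ is the normal bundle with fibre metric $\langle\cdot,\cdot\rangle^\perp$ induced by $g$, $\nabla^\perp$ is the normal connection and $R^\perp(X,Y)=\nabla^\perp_X\nabla^\perp_Y-\nabla^\perp_Y\nabla^\perp_X-\nabla^\perp_{[X,Y]}$ its curvature. The adjoint $\hat R$ of $R^\perp$ is defined by $\langle\hat R(\xi,\eta)X,Y\rangle=\langle R^\perp(X,Y)\xi,\eta\rangle^\perp$. The connection map $K:T(T^\perp L)\to T^\perp L$ is the unique bundle morphism such that $K:T_\theta(T^\perp_xL)\to T^\perp_xL$ is the canonical isomorphism for $\theta\in T_x^\perp L$, and $K(\xi_*X)=\nabla^\perp_X\xi$ for every section $\xi$ of $T^\perp L$ and vector field $X$ on $L$. The vertical bundle is $\ker\pi_*$ and the horizontal bundle is $\ker K$. $X^h$ is the horizontal lift of $X$ ($KX^h=0$, $\pi_*X^h=X$), $\xi^v$ is the vertical lift of $\xi$ ($\pi_*\xi^v=0$, $K\xi^v=\xi$), and $\Theta$ is the vertical vector field on $T^\perp L$ with $K(\Theta_\theta)=\theta$. For a section $\xi$ and $\theta\in T^\perp_xL$, expressions such as $\langle\xi,\theta\rangle^\perp$ and $\hat R(\theta,\xi)$ use the value $\xi_x$. $\omega_\theta=\frac{1}{1+\langle\theta,\theta\rangle^\perp}$.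 The $(p,q)$-metric is $$h_{p,q}(A,B)=\langle\pi_*A,\pi_*B\rangle+\omega_\theta^p\big(\langle KA,KB\rangle^\perp+q\langle KA,\theta\rangle^\perp\langle KB,\theta\rangle^\perp\big),\quad A,B\in T_\theta(T^\perp L).$$ *)

theory Defs
  imports "HOL-Analysis.Analysis"
begin

section \<open>Smoothness in Euclidean spaces\<close>

text \<open>Intended for open sets \<open>S\<close>.\<close>

primrec Ck_on :: "nat \<Rightarrow> 'a::euclidean_space set \<Rightarrow> ('a \<Rightarrow> 'b::real_normed_vector) \<Rightarrow> bool" where
  "Ck_on 0 S f \<longleftrightarrow> continuous_on S f"
| "Ck_on (Suc n) S f \<longleftrightarrow>
     (\<forall>x\<in>S. f differentiable (at x)) \<and> (\<forall>v. Ck_on n S (\<lambda>x. frechet_derivative f (at x) v))"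

definition smooth_on :: "'a::euclidean_space set \<Rightarrow> ('a \<Rightarrow> 'b::real_normed_vector) \<Rightarrow> bool" where
  "smooth_on S f \<longleftrightarrow> (\<forall>n. Ck_on n S f)"


section \<open>Smooth manifolds\<close>

text \<open>A chart is a domain together with a coordinate map. A manifold is given by an atlas, its set
  of points being the union of the chart domains; functions on points are only relevant there.\<close>

type_synonym ('m, 'e) chart = "'m set \<times> ('m \<Rightarrow> 'e)"
type_synonym ('m, 'e) atlas = "('m, 'e) chart set"

definition points :: "('m, 'e) atlas \<Rightarrow> 'm set" where
  "points A = (\<Union>c\<in>A. fst c)"

definition chart_inv :: "('m, 'e) chart \<Rightarrow> 'e \<Rightarrow> 'm" where
  "chart_inv c = inv_into (fst c) (snd c)"

definition atlas_topology :: "('m, 'e::topological_space) atlas \<Rightarrow> 'm topology" where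
  "atlas_topology A = topology_generated_by {fst c \<inter> snd c -` T | c T. c \<in> A \<and> open T}"

definition smooth_manifold :: "('m, 'e::euclidean_space) atlas \<Rightarrow> bool" where
  "smooth_manifold A \<longleftrightarrow>
     (\<forall>c\<in>A. inj_on (snd c) (fst c) \<and> open (snd c ` fst c)) \<and>
     (\<forall>c\<in>A. \<forall>d\<in>A. open (snd c ` (fst c \<inter> fst d)) \<and>
        smooth_on (snd c ` (fst c \<inter> fst d)) (snd d \<circ> chart_inv c)) \<and>
     Hausdorff_space (atlas_topology A) \<and> second_countable (atlas_topology A)"

definition smooth_fun :: "('m, 'e::euclidean_space) atlas \<Rightarrow> ('m \<Rightarrow> real) \<Rightarrow> bool" where
  "smooth_fun A f \<longleftrightarrow> (\<forall>c\<in>A. smooth_on (snd c ` fst c) (f \<circ> chart_inv c))"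

definition smooth_map ::
  "('m, 'e::euclidean_space) atlas \<Rightarrow> ('n, 'f::euclidean_space) atlas \<Rightarrow> ('m \<Rightarrow> 'n) \<Rightarrow> bool" where
  "smooth_map A B f \<longleftrightarrow> f ` points A \<subseteq> points B \<and>
     (\<forall>c\<in>A. \<forall>d\<in>B. open (snd c ` (fst c \<inter> f -` fst d)) \<and>
        smooth_on (snd c ` (fst c \<inter> f -` fst d)) (snd d \<circ> f \<circ> chart_inv c))"


subsection \<open>Tangent vectors\<close>

text \<open>We fix a preferred chart around every point. The tangent space at \<open>x\<close> is the model space
  \<^typ>\<open>'e\<close>: a tangent vector is represented by its components in the preferred chart at \<open>x\<close>,
  and its components in any other chart are obtained by differentiating the coordinate change.\<close>

definition chart_at :: "('m, 'e) atlas \<Rightarrow> 'm \<Rightarrow> ('m, 'e) chart" where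
  "chart_at A x = (SOME c. c \<in> A \<and> x \<in> fst c)"

definition coord_change ::
  "('m, 'e::euclidean_space) chart \<Rightarrow> ('m, 'e) chart \<Rightarrow> 'm \<Rightarrow> 'e \<Rightarrow> 'e" where
  "coord_change c d x = frechet_derivative (snd d \<circ> chart_inv c) (at (snd c x))"

definition differential ::
  "('m, 'e::euclidean_space) atlas \<Rightarrow> ('n, 'f::euclidean_space) atlas \<Rightarrow> ('m \<Rightarrow> 'n) \<Rightarrow> 'm \<Rightarrow> 'e \<Rightarrow> 'f"
  where
  "differential A B f x =
     frechet_derivative (snd (chart_at B (f x)) \<circ> f \<circ> chart_inv (chart_at A x))
       (at (snd (chart_at A x) x))"

text \<open>The derivative of the function \<open>f\<close> at \<open>x\<close> in the direction of the tangent vector \<open>v\<close>.\<close>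

definition dir_deriv ::
  "('m, 'e::euclidean_space) atlas \<Rightarrow> ('m \<Rightarrow> real) \<Rightarrow> 'm \<Rightarrow> 'e \<Rightarrow> real" where
  "dir_deriv A f x =
     frechet_derivative (f \<circ> chart_inv (chart_at A x)) (at (snd (chart_at A x) x))"

text \<open>Smooth sections of the pullback of the tangent bundle of \<open>B\<close> to \<open>A\<close>, for \<open>points A\<close> contained
  in \<open>points B\<close> with smooth inclusion. For \<open>A = B\<close> these are the vector fields on \<open>A\<close>.\<close>

definition smooth_along ::
  "('m, 'e::euclidean_space) atlas \<Rightarrow> ('m, 'f::euclidean_space) atlas \<Rightarrow> ('m \<Rightarrow> 'f) \<Rightarrow> bool" where
  "smooth_along A B \<xi> \<longleftrightarrow>
     (\<forall>c\<in>A. \<forall>d\<in>B. smooth_on (snd c ` (fst c \<inter> fst d))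
        (\<lambda>u. coord_change (chart_at B (chart_inv c u)) d (chart_inv c u) (\<xi> (chart_inv c u))))"

definition vector_field :: "('m, 'e::euclidean_space) atlas \<Rightarrow> ('m \<Rightarrow> 'e) \<Rightarrow> bool" where
  "vector_field A X \<longleftrightarrow> smooth_along A A X"

definition lie_bracket ::
  "('m, 'e::euclidean_space) atlas \<Rightarrow> ('m \<Rightarrow> 'e) \<Rightarrow> ('m \<Rightarrow> 'e) \<Rightarrow> 'm \<Rightarrow> 'e" where
  "lie_bracket A X Y x = (THE w. \<forall>f. smooth_fun A f \<longrightarrow>
     dir_deriv A f x w =
       dir_deriv A (\<lambda>y. dir_deriv A f y (Y y)) x (X x) -
       dir_deriv A (\<lambda>y. dir_deriv A f y (X y)) x (Y x))"


section \<open>Riemannian metrics and connections\<close>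

definition riemannian_metric ::
  "('m, 'e::euclidean_space) atlas \<Rightarrow> ('m \<Rightarrow> 'e \<Rightarrow> 'e \<Rightarrow> real) \<Rightarrow> bool" where
  "riemannian_metric A g \<longleftrightarrow>
     (\<forall>x\<in>points A. bilinear (g x) \<and> (\<forall>v w. g x v w = g x w v) \<and> (\<forall>v. v \<noteq> 0 \<longrightarrow> g x v v > 0)) \<and>
     (\<forall>c\<in>A. \<forall>a b. smooth_on (snd c ` fst c)
        (\<lambda>u. let y = chart_inv c u in
           g y (coord_change c (chart_at A y) y a) (coord_change c (chart_at A y) y b)))"

text \<open>Connections on the pullback of the tangent bundle of \<open>B\<close> to \<open>A\<close>; for \<open>A = B\<close> these are the
  affine connections on \<open>A\<close>.\<close>

definition connection_along ::
  "('m, 'e::euclidean_space) atlas \<Rightarrow> ('m, 'f::euclidean_space) atlas \<Rightarrow>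
     (('m \<Rightarrow> 'e) \<Rightarrow> ('m \<Rightarrow> 'f) \<Rightarrow> 'm \<Rightarrow> 'f) \<Rightarrow> bool" where
  "connection_along A B D \<longleftrightarrow>
     (\<forall>X \<xi>. vector_field A X \<longrightarrow> smooth_along A B \<xi> \<longrightarrow> smooth_along A B (D X \<xi>)) \<and>
     (\<forall>X Y \<xi>. vector_field A X \<longrightarrow> vector_field A Y \<longrightarrow> smooth_along A B \<xi> \<longrightarrow>
        (\<forall>x\<in>points A. D (\<lambda>y. X y + Y y) \<xi> x = D X \<xi> x + D Y \<xi> x)) \<and>
     (\<forall>f X \<xi>. smooth_fun A f \<longrightarrow> vector_field A X \<longrightarrow> smooth_along A B \<xi> \<longrightarrow>
        (\<forall>x\<in>points A. D (\<lambda>y. f y *\<^sub>R X y) \<xi> x = f x *\<^sub>R D X \<xi> x)) \<and>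
     (\<forall>X \<xi> \<eta>. vector_field A X \<longrightarrow> smooth_along A B \<xi> \<longrightarrow> smooth_along A B \<eta> \<longrightarrow>
        (\<forall>x\<in>points A. D X (\<lambda>y. \<xi> y + \<eta> y) x = D X \<xi> x + D X \<eta> x)) \<and>
     (\<forall>f X \<xi>. smooth_fun A f \<longrightarrow> vector_field A X \<longrightarrow> smooth_along A B \<xi> \<longrightarrow>
        (\<forall>x\<in>points A.
           D X (\<lambda>y. f y *\<^sub>R \<xi> y) x = dir_deriv A f x (X x) *\<^sub>R \<xi> x + f x *\<^sub>R D X \<xi> x))"

definition levi_civita ::
  "('m, 'e::euclidean_space) atlas \<Rightarrow> ('m \<Rightarrow> 'e \<Rightarrow> 'e \<Rightarrow> real) \<Rightarrow>
     (('m \<Rightarrow> 'e) \<Rightarrow> ('m \<Rightarrow> 'e) \<Rightarrow> 'm \<Rightarrow> 'e) \<Rightarrow> bool" where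
  "levi_civita A g D \<longleftrightarrow>
     connection_along A A D \<and>
     (\<forall>X Y. vector_field A X \<longrightarrow> vector_field A Y \<longrightarrow>
        (\<forall>x\<in>points A. D X Y x - D Y X x = lie_bracket A X Y x)) \<and>
     (\<forall>X Y Z. vector_field A X \<longrightarrow> vector_field A Y \<longrightarrow> vector_field A Z \<longrightarrow>
        (\<forall>x\<in>points A. dir_deriv A (\<lambda>y. g y (Y y) (Z y)) x (X x) =
           g x (D X Y x) (Z x) + g x (Y x) (D X Z x)))"


section \<open>Submanifolds and the normal bundle\<close>

text \<open>\<open>L\<close> is a submanifold of \<open>M\<close> if its points lie in \<open>M\<close> and the inclusion is an immersion.
  Embedded submanifolds are those for which \<open>atlas_topology L\<close> is the subspace topology.\<close>

abbreviation incl_deriv ::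
  "('m, 'l::euclidean_space) atlas \<Rightarrow> ('m, 'e::euclidean_space) atlas \<Rightarrow> 'm \<Rightarrow> 'l \<Rightarrow> 'e" where
  "incl_deriv L M \<equiv> differential L M (\<lambda>x. x)"

definition submanifold ::
  "('m, 'l::euclidean_space) atlas \<Rightarrow> ('m, 'e::euclidean_space) atlas \<Rightarrow> bool" where
  "submanifold L M \<longleftrightarrow>
     smooth_manifold L \<and> smooth_map L M (\<lambda>x. x) \<and> (\<forall>x\<in>points L. inj (incl_deriv L M x))"

definition induced_metric ::
  "('m, 'e::euclidean_space) atlas \<Rightarrow> ('m \<Rightarrow> 'e \<Rightarrow> 'e \<Rightarrow> real) \<Rightarrow> ('m, 'l::euclidean_space) atlas \<Rightarrow>
     'm \<Rightarrow> 'l \<Rightarrow> 'l \<Rightarrow> real" where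
  "induced_metric M g L x u w = g x (incl_deriv L M x u) (incl_deriv L M x w)"

definition normal_space ::
  "('m, 'e::euclidean_space) atlas \<Rightarrow> ('m \<Rightarrow> 'e \<Rightarrow> 'e \<Rightarrow> real) \<Rightarrow> ('m, 'l::euclidean_space) atlas \<Rightarrow>
     'm \<Rightarrow> 'e set" where
  "normal_space M g L x = {v. \<forall>u. g x v (incl_deriv L M x u) = 0}"

definition normal_part ::
  "('m, 'e::euclidean_space) atlas \<Rightarrow> ('m \<Rightarrow> 'e \<Rightarrow> 'e \<Rightarrow> real) \<Rightarrow> ('m, 'l::euclidean_space) atlas \<Rightarrow>
     'm \<Rightarrow> 'e \<Rightarrow> 'e" where
  "normal_part M g L x v =
     (THE w. w \<in> normal_space M g L x \<and> v - w \<in> range (incl_deriv L M x))"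

definition normal_section ::
  "('m, 'e::euclidean_space) atlas \<Rightarrow> ('m \<Rightarrow> 'e \<Rightarrow> 'e \<Rightarrow> real) \<Rightarrow> ('m, 'l::euclidean_space) atlas \<Rightarrow>
     ('m \<Rightarrow> 'e) \<Rightarrow> bool" where
  "normal_section M g L \<xi> \<longleftrightarrow>
     smooth_along L M \<xi> \<and> (\<forall>x\<in>points L. \<xi> x \<in> normal_space M g L x)"

text \<open>The points of the normal bundle are the pairs of a point \<open>x\<close> of \<open>L\<close> and a normal vector at
  \<open>x\<close>. A chart of the base over \<open>W\<close> and a smooth local frame \<open>e\<close> of normal vectors over \<open>W\<close> (a
  smooth family of isomorphisms of \<^typ>\<open>'k\<close> onto the normal spaces) give a bundle chart.\<close>

definition normal_bundle ::
  "('m, 'e::euclidean_space) atlas \<Rightarrow> ('m \<Rightarrow> 'e \<Rightarrow> 'e \<Rightarrow> real) \<Rightarrow> ('m, 'l::euclidean_space) atlas \<Rightarrow>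
     ('m \<times> 'e, 'l \<times> 'k::euclidean_space) atlas" where
  "normal_bundle M g L =
     {(Sigma W (normal_space M g L), \<lambda>(x, v). (\<phi> x, inv (e x) v)) | U \<phi> W (e :: 'm \<Rightarrow> 'k \<Rightarrow> 'e).
        (U, \<phi>) \<in> L \<and> W \<subseteq> U \<and> open (\<phi> ` W) \<and>
        (\<forall>x\<in>W. linear (e x) \<and> bij_betw (e x) UNIV (normal_space M g L x)) \<and>
        (\<forall>t. smooth_along {(W, \<phi>)} M (\<lambda>x. e x t))}"


subsection \<open>Normal connection and its curvature\<close>

text \<open>The pullback to \<open>L\<close> of a connection \<open>D\<close> on \<open>M\<close>, i.e. the covariant derivative of vector fields
  of \<open>M\<close> defined along \<open>L\<close> in directions tangent to \<open>L\<close>.\<close>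

definition pullback_connection ::
  "('m, 'e::euclidean_space) atlas \<Rightarrow> ('m, 'l::euclidean_space) atlas \<Rightarrow>
     (('m \<Rightarrow> 'e) \<Rightarrow> ('m \<Rightarrow> 'e) \<Rightarrow> 'm \<Rightarrow> 'e) \<Rightarrow> (('m \<Rightarrow> 'l) \<Rightarrow> ('m \<Rightarrow> 'e) \<Rightarrow> 'm \<Rightarrow> 'e) \<Rightarrow> bool" where
  "pullback_connection M L D D' \<longleftrightarrow>
     connection_along L M D' \<and>
     (\<forall>X W Z. vector_field L X \<longrightarrow> vector_field M W \<longrightarrow> vector_field M Z \<longrightarrow>
        (\<forall>x\<in>points L. W x = incl_deriv L M x (X x) \<longrightarrow> D' X Z x = D W Z x))"

definition normal_connection ::
  "('m, 'e::euclidean_space) atlas \<Rightarrow> ('m \<Rightarrow> 'e \<Rightarrow> 'e \<Rightarrow> real) \<Rightarrow> ('m, 'l::euclidean_space) atlas \<Rightarrow>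
     (('m \<Rightarrow> 'l) \<Rightarrow> ('m \<Rightarrow> 'e) \<Rightarrow> 'm \<Rightarrow> 'e) \<Rightarrow> bool" where
  "normal_connection M g L Dn \<longleftrightarrow>
     (\<exists>D D'. levi_civita M g D \<and> pullback_connection M L D D' \<and>
        (\<forall>X \<xi>. vector_field L X \<longrightarrow> normal_section M g L \<xi> \<longrightarrow>
           (\<forall>x\<in>points L. Dn X \<xi> x = normal_part M g L x (D' X \<xi> x))))"

definition curvature ::
  "('m, 'l::euclidean_space) atlas \<Rightarrow> (('m \<Rightarrow> 'l) \<Rightarrow> ('m \<Rightarrow> 'e) \<Rightarrow> 'm \<Rightarrow> 'e::euclidean_space) \<Rightarrow>
     ('m \<Rightarrow> 'l) \<Rightarrow> ('m \<Rightarrow> 'l) \<Rightarrow> ('m \<Rightarrow> 'e) \<Rightarrow> 'm \<Rightarrow> 'e" where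
  "curvature L Dn X Y \<xi> x = Dn X (Dn Y \<xi>) x - Dn Y (Dn X \<xi>) x - Dn (lie_bracket L X Y) \<xi> x"

text \<open>The curvature as a tensor on tangent vectors \<open>u\<close>, \<open>w\<close> of \<open>L\<close> and a normal vector \<open>a\<close> at \<open>x\<close>.\<close>

definition normal_curvature ::
  "('m, 'e::euclidean_space) atlas \<Rightarrow> ('m \<Rightarrow> 'e \<Rightarrow> 'e \<Rightarrow> real) \<Rightarrow> ('m, 'l::euclidean_space) atlas \<Rightarrow>
     (('m \<Rightarrow> 'l) \<Rightarrow> ('m \<Rightarrow> 'e) \<Rightarrow> 'm \<Rightarrow> 'e) \<Rightarrow> 'm \<Rightarrow> 'l \<Rightarrow> 'l \<Rightarrow> 'e \<Rightarrow> 'e" where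
  "normal_curvature M g L Dn x u w a =
     (THE b. \<forall>X Y \<xi>. vector_field L X \<and> vector_field L Y \<and> normal_section M g L \<xi> \<and>
        X x = u \<and> Y x = w \<and> \<xi> x = a \<longrightarrow> b = curvature L Dn X Y \<xi> x)"

definition adjoint_curvature ::
  "('m, 'e::euclidean_space) atlas \<Rightarrow> ('m \<Rightarrow> 'e \<Rightarrow> 'e \<Rightarrow> real) \<Rightarrow> ('m, 'l::euclidean_space) atlas \<Rightarrow>
     (('m \<Rightarrow> 'l) \<Rightarrow> ('m \<Rightarrow> 'e) \<Rightarrow> 'm \<Rightarrow> 'e) \<Rightarrow> 'm \<Rightarrow> 'e \<Rightarrow> 'e \<Rightarrow> 'l \<Rightarrow> 'l" where
  "adjoint_curvature M g L Dn x a b u =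
     (THE w. \<forall>z. induced_metric M g L x w z = g x (normal_curvature M g L Dn x u z a) b)"


subsection \<open>Connection map, lifts and the \<open>(p,q)\<close>-metric\<close>

text \<open>The conditions determine \<open>K\<close> uniquely (and force it to be smooth). The velocity at \<open>0\<close> of the
  fibre curve \<open>t \<mapsto> (x, v + t w)\<close> is the element of the tangent space of the fibre which
  corresponds canonically to \<open>w\<close>.\<close>

definition connection_map ::
  "('m, 'e::euclidean_space) atlas \<Rightarrow> ('m \<Rightarrow> 'e \<Rightarrow> 'e \<Rightarrow> real) \<Rightarrow> ('m, 'l::euclidean_space) atlas \<Rightarrow>
     ('m \<times> 'e, 'l \<times> 'k::euclidean_space) atlas \<Rightarrow> (('m \<Rightarrow> 'l) \<Rightarrow> ('m \<Rightarrow> 'e) \<Rightarrow> 'm \<Rightarrow> 'e) \<Rightarrow>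
     ('m \<times> 'e \<Rightarrow> 'l \<times> 'k \<Rightarrow> 'e) \<Rightarrow> bool" where
  "connection_map M g L N Dn K \<longleftrightarrow>
     (\<forall>\<theta>\<in>points N. linear (K \<theta>) \<and> range (K \<theta>) \<subseteq> normal_space M g L (fst \<theta>)) \<and>
     (\<forall>(x, v)\<in>points N. \<forall>w\<in>normal_space M g L x.
        K (x, v) (vector_derivative (\<lambda>t. snd (chart_at N (x, v)) (x, v + t *\<^sub>R w)) (at 0)) = w) \<and>
     (\<forall>X \<xi>. vector_field L X \<longrightarrow> normal_section M g L \<xi> \<longrightarrow>
        (\<forall>x\<in>points L. K (x, \<xi> x) (differential L N (\<lambda>y. (y, \<xi> y)) x (X x)) = Dn X \<xi> x))"

definition hlift ::
  "('m, 'l::euclidean_space) atlas \<Rightarrow> ('m \<times> 'e, 'l \<times> 'k::euclidean_space) atlas \<Rightarrow>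
     ('m \<times> 'e \<Rightarrow> 'l \<times> 'k \<Rightarrow> 'e::euclidean_space) \<Rightarrow> 'm \<times> 'e \<Rightarrow> 'l \<Rightarrow> 'l \<times> 'k" where
  "hlift L N K \<theta> u = (THE A. differential N L fst \<theta> A = u \<and> K \<theta> A = 0)"

definition vlift ::
  "('m, 'l::euclidean_space) atlas \<Rightarrow> ('m \<times> 'e, 'l \<times> 'k::euclidean_space) atlas \<Rightarrow>
     ('m \<times> 'e \<Rightarrow> 'l \<times> 'k \<Rightarrow> 'e::euclidean_space) \<Rightarrow> 'm \<times> 'e \<Rightarrow> 'e \<Rightarrow> 'l \<times> 'k" where
  "vlift L N K \<theta> w = (THE A. differential N L fst \<theta> A = 0 \<and> K \<theta> A = w)"

definition omega :: "('m \<Rightarrow> 'e \<Rightarrow> 'e \<Rightarrow> real) \<Rightarrow> 'm \<times> 'e \<Rightarrow> real" where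
  "omega g \<theta> = 1 / (1 + g (fst \<theta>) (snd \<theta>) (snd \<theta>))"

definition pq_metric ::
  "('m, 'e::euclidean_space) atlas \<Rightarrow> ('m \<Rightarrow> 'e \<Rightarrow> 'e \<Rightarrow> real) \<Rightarrow> ('m, 'l::euclidean_space) atlas \<Rightarrow>
     ('m \<times> 'e, 'l \<times> 'k::euclidean_space) atlas \<Rightarrow> ('m \<times> 'e \<Rightarrow> 'l \<times> 'k \<Rightarrow> 'e) \<Rightarrow> real \<Rightarrow> real \<Rightarrow>
     'm \<times> 'e \<Rightarrow> 'l \<times> 'k \<Rightarrow> 'l \<times> 'k \<Rightarrow> real" where
  "pq_metric M g L N K p q \<theta> A B =
     induced_metric M g L (fst \<theta>) (differential N L fst \<theta> A) (differential N L fst \<theta> B) +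
     omega g \<theta> powr p *
       (g (fst \<theta>) (K \<theta> A) (K \<theta> B) +
        q * g (fst \<theta>) (K \<theta> A) (snd \<theta>) * g (fst \<theta>) (K \<theta> B) (snd \<theta>))"

end

theory Submission
  imports Defs
begin

text \<open>A tangent vector of the normal bundle is determined by its values on two kinds of functions: the
  pullbacks of functions on \<open>L\<close>, and the fibrewise linear functions \<open>\<theta> \<mapsto> \<langle>\<theta>, \<zeta>\<rangle>\<close> for normal sections
  \<open>\<zeta>\<close>. Horizontal lifts differentiate the latter by \<open>\<nabla>\<^sub>X\<close> on \<open>\<zeta>\<close>, and vertical lifts by pairing with \<open>\<zeta>\<close>.
  All Lie brackets of lifts follow algebraically from these two rules; curvature enters in
  \<open>[X\<^sup>h, Y\<^sup>h]\<close> through its skew symmetry, a consequence of metric compatibility. The four formulas are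
  then the Koszul formula, tested against lifts, using that \<open>\<omega>\<close> is constant along horizontal lifts.\<close>

section \<open>Calculus\<close>

text \<open>Connections, brackets and curvature act on global fields, and brackets, curvature and
  lifts are definite descriptions, whereas the four formulas concern values at one point. Much of
  the work is the passage between the two: cutoffs on L extend vectors to global fields,
  tensoriality makes the choice of extension irrelevant, and coordinate computations show that the
  descriptions denote. On the normal bundle, K is prescribed only on velocities of sections and of
  fibre lines. Every tangent vector is a sum of two such velocities, so derivatives on the bundle
  become derivatives on L and one-variable derivatives along a fibre. The curvature terms of the
  result come from the vertical part of [X^h, Y^h], and their factor 1/2 from the 2 in the Koszul
  formula. The vertical form <.,.> + q<.,\<theta>><.,\<theta>> has \<theta> as an eigenvector with
  eigenvalue 1 + q<\<theta>,\<theta>>. Solving for the coefficient of \<Theta> divides by it, which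
  explains the denominator of \<mu> and \<nu>.\<close>

lemma has_derivative_cong_open:
  assumes "open S" "x \<in> S" "\<And>y. y \<in> S \<Longrightarrow> f y = g y"
  shows "(f has_derivative f') (at x) \<longleftrightarrow> (g has_derivative f') (at x)"
  using assms has_derivative_transform_within_open[of f f' x UNIV S g]
    has_derivative_transform_within_open[of g f' x UNIV S f] by auto

text \<open>\<open>frechet_derivative\<close> is a choice among the derivatives of a function, and
  both functions have the same ones; so equality also holds where neither is differentiable.\<close>

lemma frechet_derivative_cong_open:
  assumes "open S" "x \<in> S" "\<And>y. y \<in> S \<Longrightarrow> f y = g y"
  shows "frechet_derivative f (at x) = frechet_derivative g (at x)"
  unfolding frechet_derivative_def using has_derivative_cong_open[OF assms] by simp

lemma Ck_on_cong:
  assumes "open S" "\<And>x. x \<in> S \<Longrightarrow> f x = g x"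
  shows "Ck_on n S f \<longleftrightarrow> Ck_on n S g"
  using assms(2)
proof (induction n arbitrary: f g)
  case 0
  then show ?case by (simp cong: continuous_on_cong)
next
  case (Suc n)
  have "f differentiable (at x) \<longleftrightarrow> g differentiable (at x)" if "x \<in> S" for x
    unfolding differentiable_def using has_derivative_cong_open[OF assms(1) that, of f g] Suc.prems by blast
  moreover have "Ck_on n S (\<lambda>x. frechet_derivative f (at x) v) \<longleftrightarrow>
      Ck_on n S (\<lambda>x. frechet_derivative g (at x) v)" for v
    by (rule Suc.IH) (metis frechet_derivative_cong_open[OF assms(1)] Suc.prems)
  ultimately show ?case by auto
qed

lemma Ck_on_subset: "Ck_on n S f \<Longrightarrow> T \<subseteq> S \<Longrightarrow> Ck_on n T f"
  by (induction n arbitrary: f) (auto intro: continuous_on_subset)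

lemma Ck_on_SucD: "Ck_on (Suc n) S f \<Longrightarrow> Ck_on n S f"
proof (induction n arbitrary: f)
  case 0
  then show ?case
    by (auto intro!: continuous_at_imp_continuous_on differentiable_imp_continuous_within)
next
  case (Suc n)
  then show ?case by (metis Ck_on.simps(2))
qed

text \<open>Derivatives are taken without reference to the domain, so each level of the recursion
  can be checked on small neighbourhoods.\<close>

lemma Ck_on_local:
  "(\<And>x. x \<in> S \<Longrightarrow> \<exists>T. open T \<and> x \<in> T \<and> Ck_on n T f) \<Longrightarrow> Ck_on n S f"
proof (induction n arbitrary: f)
  case 0
  show ?case unfolding Ck_on.simps
  proof (rule continuous_at_imp_continuous_on, rule ballI)
    fix x assume "x \<in> S"
    from 0[OF this] show "isCont f x" by (auto simp: continuous_on_eq_continuous_at)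
  qed
next
  case (Suc n)
  have "f differentiable (at x)" if "x \<in> S" for x using Suc.prems[OF that] by auto
  moreover have "Ck_on n S (\<lambda>x. frechet_derivative f (at x) v)" for v
  proof (rule Suc.IH)
    fix x assume "x \<in> S"
    from Suc.prems[OF this] show "\<exists>T. open T \<and> x \<in> T \<and> Ck_on n T (\<lambda>x. frechet_derivative f (at x) v)"
      by auto
  qed
  ultimately show ?case by auto
qed

lemma has_derivative_frechet:
  "f differentiable (at x) \<Longrightarrow> (f has_derivative frechet_derivative f (at x)) (at x)"
  by (simp add: frechet_derivative_works)

text \<open>Any explicit derivative may stand in for \<open>frechet_derivative\<close>: by
  uniqueness they agree on S, and openness of S carries the agreement into the higher
  derivatives.\<close>

lemma Ck_on_SucI:
  assumes "open S" "\<And>x. x \<in> S \<Longrightarrow> (f has_derivative f' x) (at x)" "\<And>v. Ck_on n S (\<lambda>x. f' x v)"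
  shows "Ck_on (Suc n) S f"
proof -
  have "Ck_on n S (\<lambda>x. frechet_derivative f (at x) v)" for v
    using Ck_on_cong[OF assms(1), of "\<lambda>x. frechet_derivative f (at x) v" "\<lambda>x. f' x v" n]
      frechet_derivative_at[OF assms(2)] assms(3) by auto
  then show ?thesis using assms(2) by (auto simp: differentiable_def)
qed

section \<open>Stability of finite differentiability under algebra and composition\<close>

lemma Ck_on_const: "open S \<Longrightarrow> Ck_on n S (\<lambda>x. c)"
proof (induction n arbitrary: c)
  case (Suc n)
  show ?case by (rule Ck_on_SucI[where f' = "\<lambda>x v. 0"]) (use Suc in auto)
qed simp

lemma Ck_on_bounded_linear:
  assumes "open S" "bounded_linear l"
  shows "Ck_on n S f \<Longrightarrow> Ck_on n S (\<lambda>x. l (f x))"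
proof (induction n arbitrary: f)
  case 0
  then show ?case by (auto intro: bounded_linear.continuous_on[OF assms(2)])
next
  case (Suc n)
  show ?case
    by (rule Ck_on_SucI[OF assms(1), where f' = "\<lambda>x v. l (frechet_derivative f (at x) v)"])
      (use Suc in \<open>auto intro!: bounded_linear.has_derivative[OF assms(2)] has_derivative_frechet\<close>)
qed

lemma Ck_on_id: "open S \<Longrightarrow> Ck_on n S (\<lambda>x. x)"
proof (induction n)
  case (Suc n)
  show ?case by (rule Ck_on_SucI[where f' = "\<lambda>x v. v"]) (use Suc Ck_on_const in auto)
qed simp

lemma Ck_on_add:
  assumes "open S"
  shows "Ck_on n S f \<Longrightarrow> Ck_on n S g \<Longrightarrow> Ck_on n S (\<lambda>x. f x + g x)"
proof (induction n arbitrary: f g)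
  case 0
  then show ?case by (auto intro: continuous_intros)
next
  case (Suc n)
  show ?case
    by (rule Ck_on_SucI[OF assms(1), where
          f' = "\<lambda>x v. frechet_derivative f (at x) v + frechet_derivative g (at x) v"])
      (use Suc in \<open>auto intro!: has_derivative_add has_derivative_frechet\<close>)
qed

lemma Ck_on_sum:
  assumes "open S" "\<And>i. i \<in> I \<Longrightarrow> Ck_on n S (f i)"
  shows "Ck_on n S (\<lambda>x. \<Sum>i\<in>I. f i x)"
  using assms(2) by (induction I rule: infinite_finite_induct) (auto intro: Ck_on_const Ck_on_add assms(1))

lemma Ck_on_scaleR:
  fixes f :: "'a::euclidean_space \<Rightarrow> real"
  assumes "open S"
  shows "Ck_on n S f \<Longrightarrow> Ck_on n S g \<Longrightarrow> Ck_on n S (\<lambda>x. f x *\<^sub>R g x)"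
proof (induction n arbitrary: f g)
  case 0
  then show ?case by (auto intro: continuous_intros)
next
  case (Suc n)
  show ?case
  proof (rule Ck_on_SucI[OF assms(1), where
          f' = "\<lambda>x v. f x *\<^sub>R frechet_derivative g (at x) v + frechet_derivative f (at x) v *\<^sub>R g x"])
    fix x assume "x \<in> S"
    then show "((\<lambda>x. f x *\<^sub>R g x) has_derivative
        (\<lambda>v. f x *\<^sub>R frechet_derivative g (at x) v + frechet_derivative f (at x) v *\<^sub>R g x)) (at x)"
      using Suc.prems by (intro has_derivative_scaleR has_derivative_frechet) auto
  next
    fix v
    show "Ck_on n S (\<lambda>x. f x *\<^sub>R frechet_derivative g (at x) v + frechet_derivative f (at x) v *\<^sub>R g x)"
      using Suc Ck_on_SucD[OF Suc.prems(1)] Ck_on_SucD[OF Suc.prems(2)]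
      by (intro Ck_on_add assms Suc.IH) auto
  qed
qed

text \<open>The derivative of 1/f is built from f' and 1/f itself, so the induction hypothesis
  covers the new factor.\<close>

lemma Ck_on_inverse:
  fixes f :: "'a::euclidean_space \<Rightarrow> real"
  assumes "open S" "\<And>x. x \<in> S \<Longrightarrow> f x \<noteq> 0"
  shows "Ck_on n S f \<Longrightarrow> Ck_on n S (\<lambda>x. inverse (f x))"
proof (induction n)
  case 0
  then show ?case using assms by (auto intro: continuous_intros)
next
  case (Suc n)
  show ?case
  proof (rule Ck_on_SucI[OF assms(1), where
          f' = "\<lambda>x v. (- frechet_derivative f (at x) v) *\<^sub>R (inverse (f x) *\<^sub>R inverse (f x))"])
    fix x assume x: "x \<in> S"
    have *: "(f has_derivative frechet_derivative f (at x)) (at x)"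
      using Suc.prems x by (auto intro: has_derivative_frechet)
    show "((\<lambda>x. inverse (f x)) has_derivative
        (\<lambda>v. (- frechet_derivative f (at x) v) *\<^sub>R (inverse (f x) *\<^sub>R inverse (f x)))) (at x)"
      by (rule has_derivative_eq_rhs, rule Deriv.has_derivative_inverse[OF assms(2)[OF x] *])
        (simp add: fun_eq_iff algebra_simps)
  next
    fix v
    have "Ck_on n S (\<lambda>x. inverse (f x))" using Suc.IH Ck_on_SucD[OF Suc.prems] by blast
    then show "Ck_on n S (\<lambda>x. (- frechet_derivative f (at x) v) *\<^sub>R (inverse (f x) *\<^sub>R inverse (f x)))"
      using Suc.prems Ck_on_bounded_linear[OF assms(1) bounded_linear_minus[OF bounded_linear_ident]]
      by (intro Ck_on_scaleR assms(1)) auto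
  qed
qed

lemma linear_sum_Basis:
  fixes f :: "'a::euclidean_space \<Rightarrow> 'b::real_vector"
  assumes "linear f" shows "f t = (\<Sum>b\<in>Basis. (t \<bullet> b) *\<^sub>R f b)"
proof -
  have "f (\<Sum>b\<in>Basis. (t \<bullet> b) *\<^sub>R b) = (\<Sum>b\<in>Basis. (t \<bullet> b) *\<^sub>R f b)"
    using assms by (simp add: linear_sum linear_scale)
  then show ?thesis by (simp add: euclidean_representation)
qed

lemma frechet_derivative_sum_Basis:
  assumes "f differentiable (at x)"
  shows "frechet_derivative f (at x) v = (\<Sum>b\<in>Basis. (v \<bullet> b) *\<^sub>R frechet_derivative f (at x) b)"
  by (rule linear_sum_Basis[OF linear_frechet_derivative[OF assms]])

text \<open>The regularity of f is known for derivatives in fixed directions, while the chain rule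
  differentiates f in a moving direction; expansion in \<open>Basis\<close> separates the
  two.\<close>

lemma Ck_on_compose:
  fixes f :: "'b::euclidean_space \<Rightarrow> 'c::real_normed_vector" and g :: "'a::euclidean_space \<Rightarrow> 'b"
  assumes "open S" "open T" "\<And>x. x \<in> S \<Longrightarrow> g x \<in> T"
  shows "Ck_on n T f \<Longrightarrow> Ck_on n S g \<Longrightarrow> Ck_on n S (\<lambda>x. f (g x))"
proof (induction n arbitrary: f)
  case 0
  then show ?case using assms by (auto intro: continuous_on_compose2)
next
  case (Suc n)
  show ?case
  proof (rule Ck_on_SucI[OF assms(1), where f' = "\<lambda>x v. \<Sum>b\<in>Basis.
        (frechet_derivative g (at x) v \<bullet> b) *\<^sub>R frechet_derivative f (at (g x)) b"])
    fix x assume x: "x \<in> S"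
    then have *: "f differentiable (at (g x))" "g differentiable (at x)"
      using Suc.prems assms by auto
    from diff_chain_at[OF has_derivative_frechet[OF *(2)] has_derivative_frechet[OF *(1)]]
    show "((\<lambda>x. f (g x)) has_derivative (\<lambda>v. \<Sum>b\<in>Basis.
        (frechet_derivative g (at x) v \<bullet> b) *\<^sub>R frechet_derivative f (at (g x)) b)) (at x)"
      by (simp add: o_def frechet_derivative_sum_Basis[OF *(1), symmetric])
  next
    fix v
    have "Ck_on n S (\<lambda>x. frechet_derivative f (at (g x)) b)" for b
      using Suc.prems by (intro Suc.IH Ck_on_SucD[OF Suc.prems(2)]) auto
    then show "Ck_on n S (\<lambda>x. \<Sum>b\<in>Basis.
        (frechet_derivative g (at x) v \<bullet> b) *\<^sub>R frechet_derivative f (at (g x)) b)"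
      using Suc.prems by (intro Ck_on_sum Ck_on_scaleR assms(1)
          Ck_on_bounded_linear[OF _ bounded_linear_inner_left]) auto
  qed
qed

section \<open>Closure rules for smooth functions\<close>

named_theorems smooth_intros

lemma smooth_on_const [smooth_intros]: "open S \<Longrightarrow> smooth_on S (\<lambda>x. c)"
  by (simp add: smooth_on_def Ck_on_const)

lemma smooth_on_id [smooth_intros]: "open S \<Longrightarrow> smooth_on S (\<lambda>x. x)"
  by (simp add: smooth_on_def Ck_on_id)

lemma smooth_on_add [smooth_intros]:
  "open S \<Longrightarrow> smooth_on S f \<Longrightarrow> smooth_on S g \<Longrightarrow> smooth_on S (\<lambda>x. f x + g x)"
  by (simp add: smooth_on_def Ck_on_add)

lemma smooth_on_sum [smooth_intros]:
  "open S \<Longrightarrow> (\<And>i. i \<in> I \<Longrightarrow> smooth_on S (f i)) \<Longrightarrow> smooth_on S (\<lambda>x. \<Sum>i\<in>I. f i x)"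
  by (simp add: smooth_on_def Ck_on_sum)

lemma smooth_on_scaleR [smooth_intros]:
  "open S \<Longrightarrow> smooth_on S f \<Longrightarrow> smooth_on S g \<Longrightarrow> smooth_on S (\<lambda>x. f x *\<^sub>R g x)"
  by (simp add: smooth_on_def Ck_on_scaleR)

lemma smooth_on_mult [smooth_intros]:
  fixes f g :: "'a::euclidean_space \<Rightarrow> real"
  shows "open S \<Longrightarrow> smooth_on S f \<Longrightarrow> smooth_on S g \<Longrightarrow> smooth_on S (\<lambda>x. f x * g x)"
  using smooth_on_scaleR[of S f g] by simp

lemma smooth_on_inverse:
  fixes f :: "'a::euclidean_space \<Rightarrow> real"
  shows "open S \<Longrightarrow> (\<And>x. x \<in> S \<Longrightarrow> f x \<noteq> 0) \<Longrightarrow> smooth_on S f \<Longrightarrow> smooth_on S (\<lambda>x. inverse (f x))"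
  by (simp add: smooth_on_def Ck_on_inverse)

lemma smooth_on_bounded_linear:
  "open S \<Longrightarrow> bounded_linear l \<Longrightarrow> smooth_on S f \<Longrightarrow> smooth_on S (\<lambda>x. l (f x))"
  by (simp add: smooth_on_def Ck_on_bounded_linear)

lemma smooth_on_inner_left [smooth_intros]:
  "open S \<Longrightarrow> smooth_on S f \<Longrightarrow> smooth_on S (\<lambda>x. f x \<bullet> b)"
  by (rule smooth_on_bounded_linear[OF _ bounded_linear_inner_left])

lemma smooth_on_fst [smooth_intros]: "open S \<Longrightarrow> smooth_on S f \<Longrightarrow> smooth_on S (\<lambda>x. fst (f x))"
  by (rule smooth_on_bounded_linear[OF _ bounded_linear_fst])

lemma smooth_on_snd [smooth_intros]: "open S \<Longrightarrow> smooth_on S f \<Longrightarrow> smooth_on S (\<lambda>x. snd (f x))"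
  by (rule smooth_on_bounded_linear[OF _ bounded_linear_snd])

lemma smooth_on_minus [smooth_intros]: "open S \<Longrightarrow> smooth_on S f \<Longrightarrow> smooth_on S (\<lambda>x. - f x)"
  by (rule smooth_on_bounded_linear[OF _ bounded_linear_minus[OF bounded_linear_ident]])

lemma smooth_on_diff [smooth_intros]:
  "open S \<Longrightarrow> smooth_on S f \<Longrightarrow> smooth_on S g \<Longrightarrow> smooth_on S (\<lambda>x. f x - g x)"
  using smooth_on_add[of S f "\<lambda>x. - g x"] smooth_on_minus[of S g] by simp

lemma smooth_on_Pair [smooth_intros]:
  assumes "open S" "smooth_on S f" "smooth_on S g"
  shows "smooth_on S (\<lambda>x. (f x, g x))"
proof -
  have "bounded_linear (\<lambda>y::'b. (y, 0::'c))" "bounded_linear (\<lambda>y::'c. (0::'b, y))"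
    by (auto intro: bounded_linear_Pair bounded_linear_ident bounded_linear_zero)
  from smooth_on_add[OF assms(1) smooth_on_bounded_linear[OF assms(1) this(1) assms(2)]
      smooth_on_bounded_linear[OF assms(1) this(2) assms(3)]]
  show ?thesis by simp
qed

lemma smooth_on_cong: "open S \<Longrightarrow> (\<And>x. x \<in> S \<Longrightarrow> f x = g x) \<Longrightarrow> smooth_on S f \<longleftrightarrow> smooth_on S g"
  by (simp add: smooth_on_def Ck_on_cong[of S f g])

lemma smooth_on_subset: "smooth_on S f \<Longrightarrow> T \<subseteq> S \<Longrightarrow> smooth_on T f"
  by (auto simp: smooth_on_def intro: Ck_on_subset)

lemma smooth_on_local:
  "(\<And>x. x \<in> S \<Longrightarrow> \<exists>T. open T \<and> x \<in> T \<and> smooth_on T f) \<Longrightarrow> smooth_on S f"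
  unfolding smooth_on_def by (meson Ck_on_local)

lemma smooth_on_compose:
  "open S \<Longrightarrow> open T \<Longrightarrow> smooth_on T f \<Longrightarrow> smooth_on S g \<Longrightarrow> (\<And>x. x \<in> S \<Longrightarrow> g x \<in> T) \<Longrightarrow>
    smooth_on S (\<lambda>x. f (g x))"
  by (simp add: smooth_on_def Ck_on_compose)

lemma smooth_on_differentiable: "smooth_on S f \<Longrightarrow> x \<in> S \<Longrightarrow> f differentiable (at x)"
  unfolding smooth_on_def by (metis Ck_on.simps(2))

lemma smooth_on_continuous: "smooth_on S f \<Longrightarrow> continuous_on S f"
  unfolding smooth_on_def by (metis Ck_on.simps(1))

lemma smooth_on_frechet: "smooth_on S f \<Longrightarrow> smooth_on S (\<lambda>x. frechet_derivative f (at x) v)"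
  unfolding smooth_on_def by (metis Ck_on.simps(2))

lemma smooth_on_componentwise:
  fixes f :: "'a::euclidean_space \<Rightarrow> 'b::euclidean_space"
  assumes "open S" "\<And>b. b \<in> Basis \<Longrightarrow> smooth_on S (\<lambda>x. f x \<bullet> b)"
  shows "smooth_on S f"
proof -
  have "smooth_on S (\<lambda>x. \<Sum>b\<in>Basis. (f x \<bullet> b) *\<^sub>R b)"
    by (intro smooth_on_sum smooth_on_scaleR smooth_on_const assms)
  then show ?thesis by (simp add: euclidean_representation)
qed

subsection \<open>Symmetry of second derivatives\<close>

text \<open>The second difference of f over the parallelogram with sides tv and tw becomes a mixed
  second derivative at an interior point. The left-hand side is symmetric in v and w, so exchanging
  them reaches the other order of differentiation at a nearby point.\<close>

lemma second_difference_mvt: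
  fixes f :: "'a::euclidean_space \<Rightarrow> real"
  assumes S: "open S" "Ck_on 2 S f" and t: "0 < t"
    and box: "\<And>a b. 0 \<le> a \<Longrightarrow> a \<le> t \<Longrightarrow> 0 \<le> b \<Longrightarrow> b \<le> t \<Longrightarrow> x + a *\<^sub>R v + b *\<^sub>R w \<in> S"
  obtains a b where "0 < a" "a < t" "0 < b" "b < t"
    "f (x + t *\<^sub>R v + t *\<^sub>R w) - f (x + t *\<^sub>R v) - f (x + t *\<^sub>R w) + f x =
      t * t * frechet_derivative (\<lambda>y. frechet_derivative f (at y) v) (at (x + a *\<^sub>R v + b *\<^sub>R w)) w"
proof -
  let ?F = "\<lambda>y. frechet_derivative f (at y)" and ?G = "\<lambda>y. frechet_derivative (\<lambda>y. frechet_derivative f (at y) v) (at y)"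
  have df: "(f has_derivative ?F y) (at y)" if "y \<in> S" for y
    using S that by (intro has_derivative_frechet) (auto simp: numeral_2_eq_2)
  have dF: "((\<lambda>y. ?F y v) has_derivative ?G y) (at y)" if "y \<in> S" for y
    using S that by (intro has_derivative_frechet) (auto simp: numeral_2_eq_2)
  \<comment> \<open>The difference in direction w as a function of the position along v; the first
    mean value is taken along v.\<close>
  let ?h = "\<lambda>a. f (x + a *\<^sub>R v + t *\<^sub>R w) - f (x + a *\<^sub>R v)"
  have hd: "DERIV ?h a :> ?F (x + a *\<^sub>R v + t *\<^sub>R w) v - ?F (x + a *\<^sub>R v) v" if "0 \<le> a" "a \<le> t" for a
  proof -
    have m: "x + a *\<^sub>R v + t *\<^sub>R w \<in> S" "x + a *\<^sub>R v \<in> S"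
      using box[of a t] box[of a 0] that t by auto
    have lin: "linear (?F (x + a *\<^sub>R v + t *\<^sub>R w))" "linear (?F (x + a *\<^sub>R v))"
      using df[OF m(1)] df[OF m(2)] by (auto intro: has_derivative_linear)
    have 1: "((\<lambda>a. f (x + a *\<^sub>R v + t *\<^sub>R w)) has_derivative (\<lambda>s. ?F (x + a *\<^sub>R v + t *\<^sub>R w) (s *\<^sub>R v))) (at a)"
      by (rule has_derivative_compose[where g = f and f = "\<lambda>a. x + a *\<^sub>R v + t *\<^sub>R w", OF _ df[OF m(1)]])
        (auto intro!: derivative_eq_intros)
    have 2: "((\<lambda>a. f (x + a *\<^sub>R v)) has_derivative (\<lambda>s. ?F (x + a *\<^sub>R v) (s *\<^sub>R v))) (at a)"
      by (rule has_derivative_compose[where g = f and f = "\<lambda>a. x + a *\<^sub>R v", OF _ df[OF m(2)]])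
        (auto intro!: derivative_eq_intros)
    show ?thesis
      unfolding has_field_derivative_def
      by (rule has_derivative_eq_rhs, rule has_derivative_diff[OF 1 2])
        (simp add: fun_eq_iff linear_scale[OF lin(1)] linear_scale[OF lin(2)] right_diff_distrib mult.commute)
  qed
  obtain a where a: "0 < a" "a < t" "?h t - ?h 0 = (t - 0) * (?F (x + a *\<^sub>R v + t *\<^sub>R w) v - ?F (x + a *\<^sub>R v) v)"
    using MVT2[OF t, of ?h "\<lambda>a. ?F (x + a *\<^sub>R v + t *\<^sub>R w) v - ?F (x + a *\<^sub>R v) v"] hd by blast
  \<comment> \<open>The first derivative along v, now varied in direction w for the second mean
    value.\<close>
  let ?k = "\<lambda>b. ?F (x + a *\<^sub>R v + b *\<^sub>R w) v"
  have kd: "DERIV ?k b :> ?G (x + a *\<^sub>R v + b *\<^sub>R w) w" if "0 \<le> b" "b \<le> t" for b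
  proof -
    have m: "x + a *\<^sub>R v + b *\<^sub>R w \<in> S" using box[of a b] that a by auto
    have lin: "linear (?G (x + a *\<^sub>R v + b *\<^sub>R w))"
      using dF[OF m(1)] by (auto intro: has_derivative_linear)
    have 1: "(?k has_derivative (\<lambda>s. ?G (x + a *\<^sub>R v + b *\<^sub>R w) (s *\<^sub>R w))) (at b)"
      by (rule has_derivative_compose[where g = "\<lambda>y. ?F y v" and f = "\<lambda>b. x + a *\<^sub>R v + b *\<^sub>R w", OF _ dF[OF m(1)]])
        (auto intro!: derivative_eq_intros)
    show ?thesis
      unfolding has_field_derivative_def
      by (rule has_derivative_eq_rhs, rule 1)
        (simp add: fun_eq_iff linear_scale[OF lin(1)] mult.commute)
  qed
  obtain b where b: "0 < b" "b < t" "?k t - ?k 0 = (t - 0) * ?G (x + a *\<^sub>R v + b *\<^sub>R w) w"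
    using MVT2[OF t, of ?k "\<lambda>b. ?G (x + a *\<^sub>R v + b *\<^sub>R w) w"] kd by blast
  show ?thesis
    by (rule that[OF a(1,2) b(1,2)]) (use a(3) b(3) in \<open>simp add: algebra_simps\<close>)
qed

text \<open>Schwarz's theorem. If the two values differed, then on a small parallelogram continuity
  would keep the two mixed derivatives apart, while both equal the same second difference divided by
  t^2.\<close>

lemma frechet_derivative_symmetric:
  fixes f :: "'a::euclidean_space \<Rightarrow> real"
  assumes S: "open S" "smooth_on S f" "x \<in> S"
  shows "frechet_derivative (\<lambda>y. frechet_derivative f (at y) v) (at x) w =
    frechet_derivative (\<lambda>y. frechet_derivative f (at y) w) (at x) v"
    (is "?A v w x = ?A w v x")
proof (rule ccontr)
  assume ne: "?A v w x \<noteq> ?A w v x"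
  \<comment> \<open>Half the gap: numbers within e of the two values cannot coincide.\<close>
  define e where "e = \<bar>?A v w x - ?A w v x\<bar> / 2"
  have e: "e > 0" using ne by (simp add: e_def)
  have C2: "Ck_on 2 S f" using S by (auto simp: smooth_on_def)
  have cont: "isCont (?A v w) x" for v w
    using smooth_on_continuous[OF smooth_on_frechet[OF smooth_on_frechet[OF S(2)]]] S
    by (simp add: continuous_on_eq_continuous_at)
  obtain d1 where d1: "d1 > 0" "\<And>y. dist y x < d1 \<Longrightarrow> dist (?A v w y) (?A v w x) < e"
    using cont[of v w] e unfolding continuous_at_eps_delta dist_norm by metis
  obtain d2 where d2: "d2 > 0" "\<And>y. dist y x < d2 \<Longrightarrow> dist (?A w v y) (?A w v x) < e"
    using cont[of w v] e unfolding continuous_at_eps_delta dist_norm by metis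
  obtain d3 where d3: "d3 > 0" "ball x d3 \<subseteq> S" using S open_contains_ball by blast
  define d where "d = min d1 (min d2 d3)"
  \<comment> \<open>Displacements of length at most t(|v| + |w|) stay below d; the summand 1 covers
    v = w = 0.\<close>
  define t where "t = d / (2 * (norm v + norm w + 1))"
  have d: "d > 0" using d1 d2 d3 by (auto simp: d_def)
  then have t: "t > 0" by (auto simp: t_def intro!: divide_pos_pos add_nonneg_pos)
  have near: "dist (x + a *\<^sub>R v + b *\<^sub>R w) x < d" "dist (x + a *\<^sub>R w + b *\<^sub>R v) x < d"
    if "0 \<le> a" "a \<le> t" "0 \<le> b" "b \<le> t" for a b
  proof -
    have *: "norm (a *\<^sub>R p + b *\<^sub>R q) < d" if "norm p + norm q = norm v + norm w" for p q :: 'a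
    proof -
      have "norm (a *\<^sub>R p + b *\<^sub>R q) \<le> a * norm p + b * norm q"
        using \<open>0 \<le> a\<close> \<open>0 \<le> b\<close> norm_triangle_ineq[of "a *\<^sub>R p" "b *\<^sub>R q"] by simp
      also have "\<dots> \<le> t * norm p + t * norm q"
        using \<open>a \<le> t\<close> \<open>b \<le> t\<close> by (intro add_mono mult_right_mono) auto
      also have "\<dots> = t * (norm v + norm w)" using that by (metis distrib_left)
      also have "\<dots> < t * (2 * (norm v + norm w + 1))"
        using t by (intro mult_strict_left_mono) (auto intro: add_nonneg_pos simp: algebra_simps, smt (verit) norm_ge_zero)
      also have "\<dots> = d" 
      proof -
        have "2 * (norm v + norm w + 1) \<noteq> 0"
          by (metis add_nonneg_pos add_nonneg_nonneg mult_eq_0_iff norm_ge_zero order_less_irrefl zero_less_one zero_neq_numeral)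
        then show ?thesis unfolding t_def by (rule nonzero_eq_divide_eq[THEN iffD1]) simp
      qed
      finally show ?thesis .
    qed
    show "dist (x + a *\<^sub>R v + b *\<^sub>R w) x < d" "dist (x + a *\<^sub>R w + b *\<^sub>R v) x < d"
      using *[of v w] *[of w v] by (simp_all add: dist_norm add.commute add.assoc)
  qed
  have inS: "x + a *\<^sub>R v + b *\<^sub>R w \<in> S" "x + a *\<^sub>R w + b *\<^sub>R v \<in> S"
    if "0 \<le> a" "a \<le> t" "0 \<le> b" "b \<le> t" for a b
    using near[OF that] d3(2) by (auto simp: d_def dist_commute subset_iff)
  obtain a b where ab: "0 < a" "a < t" "0 < b" "b < t"
    "f (x + t *\<^sub>R v + t *\<^sub>R w) - f (x + t *\<^sub>R v) - f (x + t *\<^sub>R w) + f x = t * t * ?A v w (x + a *\<^sub>R v + b *\<^sub>R w)"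
    using second_difference_mvt[OF S(1) C2 t inS(1)] by blast
  obtain a' b' where ab': "0 < a'" "a' < t" "0 < b'" "b' < t"
    "f (x + t *\<^sub>R w + t *\<^sub>R v) - f (x + t *\<^sub>R w) - f (x + t *\<^sub>R v) + f x = t * t * ?A w v (x + a' *\<^sub>R w + b' *\<^sub>R v)"
    using second_difference_mvt[OF S(1) C2 t inS(2)] by blast
  have "x + t *\<^sub>R w + t *\<^sub>R v = x + t *\<^sub>R v + t *\<^sub>R w" by simp
  from ab(5) ab'(5)[unfolded this]
  have "t * t * ?A v w (x + a *\<^sub>R v + b *\<^sub>R w) = t * t * ?A w v (x + a' *\<^sub>R w + b' *\<^sub>R v)"
    by linarith
  then have eq: "?A v w (x + a *\<^sub>R v + b *\<^sub>R w) = ?A w v (x + a' *\<^sub>R w + b' *\<^sub>R v)" using t by simp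
  have "dist (?A v w (x + a *\<^sub>R v + b *\<^sub>R w)) (?A v w x) < e"
    using near(1)[of a b] ab by (intro d1(2)) (auto simp: d_def)
  moreover have "dist (?A w v (x + a' *\<^sub>R w + b' *\<^sub>R v)) (?A w v x) < e"
    using near(2)[of a' b'] ab' by (intro d2(2)) (auto simp: d_def)
  ultimately have "dist (?A v w x) (?A w v x) < e + e"
    using dist_triangle_less_add[of "?A v w x" "?A v w (x + a *\<^sub>R v + b *\<^sub>R w)"] eq
    by (metis dist_commute)
  then show False by (simp add: e_def dist_real_def)
qed

subsection \<open>Bump functions\<close>

text \<open>The powers of 1/x are what differentiation of exp(-1/x) produces; carried as an index,
  they make the family closed under differentiation up to linear combinations.\<close>

definition flat :: "nat \<Rightarrow> real \<Rightarrow> real" where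
  "flat k x = (if x > 0 then (1 / x) ^ k * exp (- 1 / x) else 0)"

lemma flat_tendsto_0: "(flat k \<longlongrightarrow> 0) (at_right 0)"
proof -
  have "((\<lambda>x. inverse x ^ k / exp (inverse x)) \<longlongrightarrow> (0::real)) (at_right 0)"
    by (rule filterlim_compose[OF tendsto_power_div_exp_0 filterlim_inverse_at_top_right])
  moreover have "\<forall>\<^sub>F x in at_right 0. inverse x ^ k / exp (inverse x) = flat k x"
    unfolding eventually_at_filter
    by (rule always_eventually) (simp add: flat_def exp_minus divide_inverse)
  ultimately show ?thesis using tendsto_cong by fast
qed

lemma flat_has_derivative: "DERIV (flat k) x :> flat (k + 2) x - real k * flat (k + 1) x"
proof -
  consider "x > 0" | "x < 0" | "x = 0" by linarith
  then show ?thesis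
  proof cases
    case 1
    have "DERIV (\<lambda>x. (1 / x) ^ k * exp (- 1 / x)) x :> flat (k + 2) x - real k * flat (k + 1) x"
      using 1 by (auto intro!: derivative_eq_intros simp: flat_def field_simps power2_eq_square)
        (cases k; simp add: field_simps)
    then show ?thesis
      by (rule has_field_derivative_transform_within_open[of _ _ _ "{0<..}"]) (use 1 in \<open>auto simp: flat_def\<close>)
  next
    case 2
    have "DERIV (\<lambda>x. 0) x :> flat (k + 2) x - real k * flat (k + 1) x"
      using 2 by (auto simp: flat_def)
    then show ?thesis
      by (rule has_field_derivative_transform_within_open[of _ _ _ "{..<0}"]) (use 2 in \<open>auto simp: flat_def\<close>)
  next
    case 3
    have "((\<lambda>h. (flat k (0 + h) - flat k 0) / h) \<longlongrightarrow> 0) (at_left 0)"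
      unfolding eventually_at_filter
      by (rule tendsto_eventually) (simp add: eventually_at_filter flat_def)
    \<comment> \<open>From the right, the difference quotient of \<open>flat k\<close> at 0 is
      \<open>flat (Suc k)\<close>, whose limit is known.\<close>
    moreover have "((\<lambda>h. (flat k (0 + h) - flat k 0) / h) \<longlongrightarrow> 0) (at_right 0)"
    proof -
      have "\<forall>\<^sub>F x in at_right 0. flat (Suc k) x = (flat k (0 + x) - flat k 0) / x"
        unfolding eventually_at_filter by (rule always_eventually) (simp add: flat_def)
      then show ?thesis using flat_tendsto_0[of "Suc k"] tendsto_cong by fast
    qed
    ultimately show ?thesis
      unfolding 3 DERIV_def by (simp add: filterlim_at_split flat_def)
  qed
qed

lemma smooth_flat: "smooth_on UNIV (flat k)"
proof -
  have "Ck_on n UNIV (flat k)" for n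
  proof (induction n arbitrary: k)
    case 0
    show ?case using flat_has_derivative
      by (auto intro!: continuous_at_imp_continuous_on DERIV_isCont)
  next
    case (Suc n)
    have "Ck_on n UNIV (\<lambda>x. (flat (k + 2) x + (- real k) *\<^sub>R flat (k + 1) x))"
      by (intro Ck_on_add Ck_on_scaleR Ck_on_const Suc open_UNIV)
    then have "Ck_on n UNIV (\<lambda>x. (flat (k + 2) x + (- real k) *\<^sub>R flat (k + 1) x) *\<^sub>R v)" for v :: real
      by (intro Ck_on_scaleR Ck_on_const open_UNIV)
    then show ?case
      by (intro Ck_on_SucI[OF open_UNIV, where
            f' = "\<lambda>x v. (flat (k + 2) x + (- real k) *\<^sub>R flat (k + 1) x) *\<^sub>R v"])
        (use flat_has_derivative in \<open>auto simp: has_field_derivative_def\<close>)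
  qed
  then show ?thesis by (simp add: smooth_on_def)
qed

text \<open>The quotient u/(u + w), where u is positive exactly inside radius 2r and w exactly
  outside radius r. At every point at least one of them is positive, so the quotient is smooth; it
  is 1 where w vanishes and 0 where u vanishes.\<close>

lemma smooth_bump:
  fixes x0 :: "'a::euclidean_space"
  assumes "r > 0"
  obtains \<psi> :: "'a \<Rightarrow> real" where "smooth_on UNIV \<psi>" "\<And>x. dist x0 x \<le> r \<Longrightarrow> \<psi> x = 1"
    "\<And>x. dist x0 x \<ge> 2 * r \<Longrightarrow> \<psi> x = 0"
proof -
  \<comment> \<open>The squared distance as a sum over coordinates, a form that the closure rules
    for smooth functions accept.\<close>
  let ?q = "\<lambda>x::'a. \<Sum>b\<in>Basis. ((x - x0) \<bullet> b) * ((x - x0) \<bullet> b)"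
  let ?u = "\<lambda>x. flat 0 (4 * r\<^sup>2 - ?q x)" and ?w = "\<lambda>x. flat 0 (?q x - r\<^sup>2)"
  have q: "?q x = (dist x0 x)\<^sup>2" for x
    by (metis (no_types) dist_commute dist_norm euclidean_inner power2_norm_eq_inner)
  have flat_pos: "flat 0 y > 0 \<longleftrightarrow> y > 0" "flat 0 y \<ge> 0" for y by (auto simp: flat_def)
  have pos: "?u x + ?w x > 0" for x
  proof -
    have "r\<^sup>2 > 0" using assms by simp
    then have "4 * r\<^sup>2 - ?q x > 0 \<or> ?q x - r\<^sup>2 > 0" by linarith
    then show ?thesis using flat_pos add_pos_nonneg add_nonneg_pos by metis
  qed
  have s: "smooth_on UNIV ?q" by (intro smooth_intros open_UNIV)
  have "smooth_on UNIV ?u" "smooth_on UNIV ?w"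
    by (auto intro!: smooth_on_compose[OF open_UNIV open_UNIV smooth_flat] smooth_on_diff smooth_on_const s)
  then have "smooth_on UNIV (\<lambda>x. ?u x * inverse (?u x + ?w x))"
    using pos by (intro smooth_on_mult smooth_on_inverse smooth_on_add open_UNIV) (auto simp: less_le)
  moreover have "?u x * inverse (?u x + ?w x) = 1" if "dist x0 x \<le> r" for x
  proof -
    have "?q x \<le> r\<^sup>2" unfolding q using that by (intro power_mono) auto
    then have "?w x = 0" by (simp add: flat_def)
    then show ?thesis using pos[of x] by simp
  qed
  moreover have "?u x * inverse (?u x + ?w x) = 0" if "dist x0 x \<ge> 2 * r" for x
  proof -
    have "?q x \<ge> (2 * r)\<^sup>2" unfolding q using that assms by (intro power_mono) auto
    then have "?u x = 0" by (simp add: flat_def power_mult_distrib)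
    then show ?thesis by simp
  qed
  ultimately show ?thesis using that by blast
qed

subsection \<open>Inverses of smooth families of linear maps\<close>

text \<open>Inverse function theorem for \<open>(u, w) \<mapsto> (u, A u w)\<close>.\<close>

lemma has_derivative_linear_inverse:
  fixes A :: "'u::euclidean_space \<Rightarrow> 'a::euclidean_space \<Rightarrow> 'a"
  assumes S: "open S" "u \<in> S" and lin: "\<And>u. u \<in> S \<Longrightarrow> linear (A u)" and inj: "\<And>u. u \<in> S \<Longrightarrow> inj (A u)"
    and sm: "\<And>b. smooth_on S (\<lambda>u. A u b)"
  shows "((\<lambda>u. inv (A u) y) has_derivative (\<lambda>h. - inv (A u)
    (\<Sum>b\<in>Basis. (inv (A u) y \<bullet> b) *\<^sub>R frechet_derivative (\<lambda>u. A u b) (at u) h))) (at u)"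
proof -
  have surj: "surj (A v)" if "v \<in> S" for v
    using lin[OF that] inj[OF that] linear_injective_imp_surjective by blast
  have inv1: "A v (inv (A v) w) = w" if "v \<in> S" for v w using surj[OF that] by (rule surj_f_inv_f)
  have inv2: "inv (A v) (A v w) = w" if "v \<in> S" for v w using inj[OF that] by simp
  define w where "w = inv (A u) y"
  \<comment> \<open>Expansion in \<open>Basis\<close> turns \<open>A u w\<close> into a sum of
    smooth functions of u times coordinates of w, so joint smoothness follows from smoothness for
    each fixed b.\<close>
  define F where "F = (\<lambda>p::'u \<times> 'a. (fst p, \<Sum>b\<in>Basis. (snd p \<bullet> b) *\<^sub>R A (fst p) b))"
  define Q where "Q = (\<lambda>h. \<Sum>b\<in>Basis. (w \<bullet> b) *\<^sub>R frechet_derivative (\<lambda>u. A u b) (at u) h)"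
  define F' where "F' = (\<lambda>p::'u \<times> 'a. (fst p, Q (fst p) + A u (snd p)))"
  define G where "G = (\<lambda>p::'u \<times> 'a. (fst p, inv (A (fst p)) (snd p)))"
  \<comment> \<open>\<open>F'\<close> is block triangular with diagonal blocks the identity and
    \<open>A u\<close>; back substitution inverts it.\<close>
  define G' where "G' = (\<lambda>p::'u \<times> 'a. (fst p, inv (A u) (snd p - Q (fst p))))"
  have rep: "(\<Sum>b\<in>Basis. (x \<bullet> b) *\<^sub>R A v b) = A v x" if "v \<in> S" for v x
    using linear_sum_Basis[OF lin[OF that]] by (rule sym)
  have F: "F (v, x) = (v, A v x)" if "v \<in> S" for v x using rep[OF that] by (simp add: F_def)
  have "smooth_on (S \<times> UNIV) F" unfolding F_def
    by (intro smooth_on_Pair smooth_on_sum smooth_on_scaleR smooth_on_inner_left smooth_on_fst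
        smooth_on_snd smooth_on_id open_Times S open_UNIV smooth_on_compose[OF _ S(1) sm]) auto
  then have cont: "continuous_on (S \<times> UNIV) F" by (rule smooth_on_continuous)
  have dA: "((\<lambda>u. A u b) has_derivative frechet_derivative (\<lambda>u. A u b) (at u)) (at u)" for b
    by (rule has_derivative_frechet[OF smooth_on_differentiable[OF sm S(2)]])
  have dA': "((\<lambda>p. A (fst p) b) has_derivative (\<lambda>p. frechet_derivative (\<lambda>u. A u b) (at u) (fst p))) (at (u, w))" for b
    by (rule has_derivative_compose[of fst fst "(u, w)" UNIV "\<lambda>u. A u b", simplified, OF has_derivative_fst[OF has_derivative_ident]])
      (use dA in simp)
  have dF: "(F has_derivative F') (at (u, w))"
    unfolding F_def
  proof (rule has_derivative_eq_rhs[OF has_derivative_Pair[OF has_derivative_fst[OF has_derivative_ident] has_derivative_sum]])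
    show "((\<lambda>p. (snd p \<bullet> b) *\<^sub>R A (fst p) b) has_derivative (\<lambda>h. (snd (u, w) \<bullet> b) *\<^sub>R
        frechet_derivative (\<lambda>u. A u b) (at u) (fst h) + (snd h \<bullet> b) *\<^sub>R A (fst (u, w)) b)) (at (u, w))" for b
      by (rule has_derivative_scaleR[OF _ dA'])
        (intro bounded_linear_imp_has_derivative bounded_linear_compose[OF bounded_linear_inner_left bounded_linear_snd])
  qed (simp add: F'_def fun_eq_iff sum.distrib rep[OF S(2)] Q_def)
  have GF: "G (F z) = z" if "z \<in> S \<times> UNIV" for z
    using that inv2 by (cases z) (auto simp: F G_def)
  have FG: "F' \<circ> G' = id" using inv1[OF S(2)] by (auto simp: F'_def G'_def)
  have "(G has_derivative G') (at (F (u, w)))"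
    by (rule has_derivative_inverse_strong[OF _ _ cont GF dF FG]) (use S in \<open>auto intro: open_Times\<close>)
  moreover have "F (u, w) = (u, y)" by (simp add: F S w_def inv1)
  ultimately have G: "(G has_derivative G') (at (u, y))" by simp
  have "((\<lambda>v. snd (G (v, y))) has_derivative (\<lambda>h. snd (G' (h, 0)))) (at u)"
    by (rule has_derivative_snd, rule has_derivative_compose[where g = G and f = "\<lambda>v. (v, y)", OF _ G])
      (auto intro!: derivative_eq_intros)
  moreover have "inv (A u) (- x) = - inv (A u) x" for x
    using linear_neg[OF inj_linear_imp_inv_linear[OF lin inj], OF S(2) S(2)] .
  ultimately show ?thesis by (simp add: G_def G'_def Q_def w_def)
qed

text \<open>Bootstrapping: the derivative of the inverse is built from the inverse and derivatives
  of A, so order n for all y at once gives order n + 1.\<close>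

lemma smooth_linear_inverse:
  fixes A :: "'u::euclidean_space \<Rightarrow> 'a::euclidean_space \<Rightarrow> 'a"
  assumes S: "open S" and lin: "\<And>u. u \<in> S \<Longrightarrow> linear (A u)" and inj: "\<And>u. u \<in> S \<Longrightarrow> inj (A u)"
    and sm: "\<And>b. smooth_on S (\<lambda>u. A u b)"
  shows "smooth_on S (\<lambda>u. inv (A u) y)"
proof -
  have d: "((\<lambda>u. inv (A u) y) has_derivative (\<lambda>h. - inv (A u)
    (\<Sum>b\<in>Basis. (inv (A u) y \<bullet> b) *\<^sub>R frechet_derivative (\<lambda>u. A u b) (at u) h))) (at u)" if "u \<in> S" for u y
    by (rule has_derivative_linear_inverse[OF S that lin inj sm])
  \<comment> \<open>The outer inverse is applied to a vector that depends on u, while the induction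
    hypothesis concerns fixed arguments; linearity separates the two.\<close>
  have rep: "inv (A u) x = (\<Sum>c\<in>Basis. (x \<bullet> c) *\<^sub>R inv (A u) c)" if "u \<in> S" for u x
    by (rule linear_sum_Basis[OF inj_linear_imp_inv_linear[OF lin inj, OF that that]])
  have "Ck_on n S (\<lambda>u. inv (A u) y)" for n
  proof (induction n arbitrary: y)
    case 0
    show ?case unfolding Ck_on.simps
      by (rule continuous_at_imp_continuous_on) (use d has_derivative_continuous in blast)
  next
    case (Suc n)
    let ?Q = "\<lambda>u h. \<Sum>b\<in>Basis. (inv (A u) y \<bullet> b) *\<^sub>R frechet_derivative (\<lambda>u. A u b) (at u) h"
    show ?case
    proof (rule Ck_on_SucI[OF S d])
      fix v
      have Q: "Ck_on n S (\<lambda>u. ?Q u v)"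
        using smooth_on_frechet[OF sm] by (intro Ck_on_sum Ck_on_scaleR S Ck_on_bounded_linear[OF S bounded_linear_inner_left] Suc)
          (auto simp: smooth_on_def)
      have "Ck_on n S (\<lambda>u. - (\<Sum>c\<in>Basis. (?Q u v \<bullet> c) *\<^sub>R inv (A u) c))"
        by (intro Ck_on_bounded_linear[OF S bounded_linear_minus[OF bounded_linear_ident]] Ck_on_sum Ck_on_scaleR S
            Ck_on_bounded_linear[OF S bounded_linear_inner_left] Suc Q)
      then show "Ck_on n S (\<lambda>u. - inv (A u) (?Q u v))"
        by (rule Ck_on_cong[OF S, THEN iffD2, rotated]) (erule arg_cong[OF rep])
    qed
  qed
  then show ?thesis by (simp add: smooth_on_def)
qed

section \<open>Smooth functions on manifolds\<close>

text \<open>\<open>smooth_manifold\<close> without the Hausdorff and countability axioms. The normal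
  bundle enters only through this notion, so its topology is never examined.\<close>

definition smooth_atlas :: "('m, 'e::euclidean_space) atlas \<Rightarrow> bool" where
  "smooth_atlas A \<longleftrightarrow>
     (\<forall>c\<in>A. inj_on (snd c) (fst c) \<and> open (snd c ` fst c)) \<and>
     (\<forall>c\<in>A. \<forall>d\<in>A. open (snd c ` (fst c \<inter> fst d)) \<and>
        smooth_on (snd c ` (fst c \<inter> fst d)) (\<lambda>u. snd d (chart_inv c u)))"

definition msmooth :: "('m, 'e::euclidean_space) atlas \<Rightarrow> ('m \<Rightarrow> 'v::real_normed_vector) \<Rightarrow> bool" where
  "msmooth A F \<longleftrightarrow> (\<forall>c\<in>A. smooth_on (snd c ` fst c) (\<lambda>u. F (chart_inv c u)))"

text \<open>Openness is tested chart by chart. Only the part of S inside the manifold counts, so S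
  may be a complement or all of \<open>UNIV\<close>.\<close>

definition mopen :: "('m, 'e::euclidean_space) atlas \<Rightarrow> 'm set \<Rightarrow> bool" where
  "mopen A S \<longleftrightarrow> (\<forall>c\<in>A. open (snd c ` (fst c \<inter> S)))"

text \<open>The open submanifold on S. Its preferred charts may differ from those of A, so tangent
  vectors and derivatives keep referring to A.\<close>

definition restr :: "('m, 'e) atlas \<Rightarrow> 'm set \<Rightarrow> ('m, 'e) atlas" where
  "restr A S = (\<lambda>c. (fst c \<inter> S, snd c)) ` A"

lemma smooth_manifold_atlas: "smooth_manifold A \<Longrightarrow> smooth_atlas A"
  by (simp add: smooth_manifold_def smooth_atlas_def o_def)

lemma smooth_fun_iff: "smooth_fun A f \<longleftrightarrow> msmooth A f"
  by (simp add: smooth_fun_def msmooth_def o_def)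

lemma smooth_atlasD:
  assumes "smooth_atlas A" "c \<in> A"
  shows "inj_on (snd c) (fst c)" "open (snd c ` fst c)"
    "d \<in> A \<Longrightarrow> open (snd c ` (fst c \<inter> fst d))"
    "d \<in> A \<Longrightarrow> smooth_on (snd c ` (fst c \<inter> fst d)) (\<lambda>u. snd d (chart_inv c u))"
  using assms by (auto simp: smooth_atlas_def)

lemma chart_inv_apply: "inj_on (snd c) (fst c) \<Longrightarrow> y \<in> fst c \<Longrightarrow> chart_inv c (snd c y) = y"
  by (simp add: chart_inv_def)

lemma chart_inv_apply_atlas [simp]:
  "smooth_atlas A \<Longrightarrow> c \<in> A \<Longrightarrow> y \<in> fst c \<Longrightarrow> chart_inv c (snd c y) = y"
  by (simp add: chart_inv_apply smooth_atlasD)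

lemma chart_inv_in: "u \<in> snd c ` fst c \<Longrightarrow> chart_inv c u \<in> fst c"
  by (simp add: chart_inv_def inv_into_into)

lemma chart_apply_inv: "u \<in> snd c ` fst c \<Longrightarrow> snd c (chart_inv c u) = u"
  by (simp add: chart_inv_def f_inv_into_f)

lemma image_chart_Int:
  assumes "smooth_atlas A" "c \<in> A"
  shows "snd c ` (fst c \<inter> S) = {u \<in> snd c ` fst c. chart_inv c u \<in> S}"
  using assms by auto

lemma chart_inv_restr:
  assumes "inj_on (snd c) (fst c)" "u \<in> snd c ` (fst c \<inter> S)"
  shows "chart_inv (fst c \<inter> S, snd c) u = chart_inv c u"
proof -
  obtain y where y: "y \<in> fst c" "y \<in> S" "u = snd c y" using assms(2) by auto
  have "inj_on (snd c) (fst c \<inter> S)" using assms(1) by (rule inj_on_subset) auto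
  then show ?thesis using chart_inv_apply[of "(fst c \<inter> S, snd c)" y] chart_inv_apply[OF assms(1), of y] y by simp
qed

lemma points_restr [simp]: "points (restr A S) = points A \<inter> S"
  by (auto simp: points_def restr_def)

lemma restr_UNIV [simp]: "restr A UNIV = A" by (simp add: restr_def)

lemma restr_restr [simp]: "restr (restr A S) T = restr A (S \<inter> T)"
  by (auto simp: restr_def image_image Int_assoc)

lemma chart_at:
  assumes "x \<in> points A" shows "chart_at A x \<in> A" "x \<in> fst (chart_at A x)"
  using assms someI_ex[of "\<lambda>c. c \<in> A \<and> x \<in> fst c"] unfolding points_def chart_at_def by blast+

lemma points_chart: "c \<in> A \<Longrightarrow> x \<in> fst c \<Longrightarrow> x \<in> points A" by (auto simp: points_def)

lemma mopen_UNIV [simp]: "smooth_atlas A \<Longrightarrow> mopen A UNIV"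
  by (simp add: mopen_def smooth_atlasD)

lemma mopen_chart: "smooth_atlas A \<Longrightarrow> c \<in> A \<Longrightarrow> mopen A (fst c)"
  by (simp add: mopen_def smooth_atlasD)

lemma mopen_Int:
  assumes "smooth_atlas A" "mopen A S" "mopen A T" shows "mopen A (S \<inter> T)"
  unfolding mopen_def
proof
  fix c assume c: "c \<in> A"
  have "snd c ` (fst c \<inter> (S \<inter> T)) = snd c ` (fst c \<inter> S) \<inter> snd c ` (fst c \<inter> T)"
    using smooth_atlasD(1)[OF assms(1) c] by (auto simp: inj_on_def)
  then show "open (snd c ` (fst c \<inter> (S \<inter> T)))" using assms c by (simp add: mopen_def open_Int)
qed

lemma smooth_atlas_restr:
  assumes A: "smooth_atlas A" and S: "mopen A S" shows "smooth_atlas (restr A S)"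
proof -
  have "inj_on (snd c) (fst c \<inter> S)" if "c \<in> A" for c
    using smooth_atlasD(1)[OF A that] by (rule inj_on_subset) auto
  moreover have "open (snd c ` (fst c \<inter> S))" if "c \<in> A" for c using S that by (simp add: mopen_def)
  moreover have o: "open (snd c ` (fst c \<inter> (S \<inter> fst d)))" if "c \<in> A" "d \<in> A" for c d
    using mopen_Int[OF A S mopen_chart[OF A that(2)]] that by (simp add: mopen_def)
  moreover have "smooth_on (snd c ` (fst c \<inter> (S \<inter> fst d))) (\<lambda>u. snd d (chart_inv (fst c \<inter> S, snd c) u))"
    if "c \<in> A" "d \<in> A" for c d
  proof (rule smooth_on_cong[OF o[OF that], THEN iffD2])
    show "smooth_on (snd c ` (fst c \<inter> (S \<inter> fst d))) (\<lambda>u. snd d (chart_inv c u))"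
      by (rule smooth_on_subset[OF smooth_atlasD(4)[OF A that]]) auto
  qed (use chart_inv_restr[OF smooth_atlasD(1)[OF A that(1)]] in auto)
  moreover have "fst c \<inter> S \<inter> (fst d \<inter> S) = fst c \<inter> (S \<inter> fst d)" for c d :: "('a, 'b) chart" by auto
  ultimately show ?thesis unfolding smooth_atlas_def restr_def by auto
qed

text \<open>\<open>chart_inv\<close> depends on the domain of its chart; on the image of the smaller
  domain it agrees with the inverse of the whole chart, which the right-hand side uses.\<close>

lemma msmooth_restr_iff:
  assumes A: "smooth_atlas A" and S: "mopen A S"
  shows "msmooth (restr A S) F \<longleftrightarrow> (\<forall>c\<in>A. smooth_on (snd c ` (fst c \<inter> S)) (\<lambda>u. F (chart_inv c u)))"
proof -
  have "smooth_on (snd c ` (fst c \<inter> S)) (\<lambda>u. F (chart_inv (fst c \<inter> S, snd c) u)) \<longleftrightarrow>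
      smooth_on (snd c ` (fst c \<inter> S)) (\<lambda>u. F (chart_inv c u))" if "c \<in> A" for c
    by (rule smooth_on_cong) (use that S chart_inv_restr[OF smooth_atlasD(1)[OF A that]] in \<open>auto simp: mopen_def\<close>)
  then show ?thesis by (simp add: msmooth_def restr_def)
qed

lemma mopen_restr:
  assumes "smooth_atlas A" "mopen A S" "mopen A T" shows "mopen (restr A S) T"
  using mopen_Int[OF assms] by (auto simp: mopen_def restr_def Int_assoc)

lemma msmooth_subset:
  assumes A: "smooth_atlas A" "mopen A S" "mopen A T" "T \<subseteq> S" and F: "msmooth (restr A S) F"
  shows "msmooth (restr A T) F"
  unfolding msmooth_restr_iff[OF A(1,3)]
proof
  fix c assume "c \<in> A"
  then have "smooth_on (snd c ` (fst c \<inter> S)) (\<lambda>u. F (chart_inv c u))"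
    using F by (simp add: msmooth_restr_iff[OF A(1,2)])
  then show "smooth_on (snd c ` (fst c \<inter> T)) (\<lambda>u. F (chart_inv c u))"
    by (rule smooth_on_subset) (use A(4) in auto)
qed

lemma msmooth_restr: "smooth_atlas A \<Longrightarrow> mopen A T \<Longrightarrow> msmooth A F \<Longrightarrow> msmooth (restr A T) F"
  using msmooth_subset[of A UNIV T F] by simp

lemma msmooth_cong:
  assumes "smooth_atlas A" "\<And>x. x \<in> points A \<Longrightarrow> F x = G x" shows "msmooth A F \<longleftrightarrow> msmooth A G"
  unfolding msmooth_def
  by (rule ball_cong[OF refl], rule smooth_on_cong)
    (use assms in \<open>auto simp: smooth_atlasD dest!: points_chart[OF _ chart_inv_in]\<close>)

lemma msmooth_local:
  assumes A: "smooth_atlas A" and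
    *: "\<And>x. x \<in> points A \<Longrightarrow> \<exists>S. mopen A S \<and> x \<in> S \<and> msmooth (restr A S) F"
  shows "msmooth A F"
  unfolding msmooth_def
proof (intro ballI smooth_on_local)
  fix c u assume c: "c \<in> A" and u: "u \<in> snd c ` fst c"
  then obtain x where x: "x \<in> fst c" "u = snd c x" by auto
  obtain S where S: "mopen A S" "x \<in> S" "msmooth (restr A S) F" using *[OF points_chart[OF c x(1)]] by blast
  have "open (snd c ` (fst c \<inter> S))" using S c by (simp add: mopen_def)
  moreover have "u \<in> snd c ` (fst c \<inter> S)" using x S by auto
  moreover have "smooth_on (snd c ` (fst c \<inter> S)) (\<lambda>u. F (chart_inv c u))"
    using S(3) c by (simp add: msmooth_restr_iff[OF A S(1)])
  ultimately show "\<exists>T. open T \<and> u \<in> T \<and> smooth_on T (\<lambda>u. F (chart_inv c u))" by blast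
qed

lemma mopen_local:
  assumes A: "smooth_atlas A" and
    *: "\<And>x. x \<in> points A \<Longrightarrow> x \<in> S \<Longrightarrow> \<exists>T. mopen A T \<and> x \<in> T \<and> points A \<inter> T \<subseteq> S"
  shows "mopen A S"
  unfolding mopen_def
proof (rule ballI, rule Topological_Spaces.openI)
  fix c u assume c: "c \<in> A" and u: "u \<in> snd c ` (fst c \<inter> S)"
  then obtain x where x: "x \<in> fst c" "x \<in> S" "u = snd c x" by auto
  obtain T where T: "mopen A T" "x \<in> T" "points A \<inter> T \<subseteq> S" using *[OF points_chart[OF c x(1)] x(2)] by blast
  show "\<exists>U. open U \<and> u \<in> U \<and> U \<subseteq> snd c ` (fst c \<inter> S)"
    by (rule exI[of _ "snd c ` (fst c \<inter> T)"]) (use T x c points_chart[OF c] in \<open>auto simp: mopen_def\<close>)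
qed

lemma mopen_chart_preimage:
  assumes A: "smooth_atlas A" and c: "c \<in> A" and T: "open T"
  shows "mopen A {x \<in> fst c. snd c x \<in> T}"
  unfolding mopen_def
proof
  fix d assume d: "d \<in> A"
  have "snd d ` (fst d \<inter> {x \<in> fst c. snd c x \<in> T}) =
      snd d ` (fst d \<inter> fst c) \<inter> (\<lambda>u. snd c (chart_inv d u)) -` T"
    using A d by (auto simp: image_iff)
  moreover have "open (snd d ` (fst d \<inter> fst c) \<inter> (\<lambda>u. snd c (chart_inv d u)) -` T)"
    by (rule continuous_open_preimage[OF smooth_on_continuous[OF smooth_atlasD(4)[OF A d c]]
          smooth_atlasD(3)[OF A d c] T])
  ultimately show "open (snd d ` (fst d \<inter> {x \<in> fst c. snd c x \<in> T}))" by simp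
qed

text \<open>One chart suffices: in any other, the function is composed with a smooth transition
  map.\<close>

lemma msmooth_in_chart:
  assumes A: "smooth_atlas A" and c: "c \<in> A" and T: "open T" "smooth_on T \<phi>"
    and F: "\<And>y. y \<in> fst c \<Longrightarrow> snd c y \<in> T \<Longrightarrow> F y = \<phi> (snd c y)"
  shows "msmooth (restr A {x \<in> fst c. snd c x \<in> T}) F"
  unfolding msmooth_restr_iff[OF A mopen_chart_preimage[OF A c T(1)]]
proof
  fix d assume d: "d \<in> A"
  let ?S = "snd d ` (fst d \<inter> {x \<in> fst c. snd c x \<in> T})"
  have o: "open ?S" using mopen_chart_preimage[OF A c T(1)] d by (simp add: mopen_def)
  have "smooth_on ?S (\<lambda>u. \<phi> (snd c (chart_inv d u)))"
    by (rule smooth_on_compose[OF o T smooth_on_subset[OF smooth_atlasD(4)[OF A d c]]]) (use A d in auto)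
  then show "smooth_on ?S (\<lambda>u. F (chart_inv d u))"
    by (rule smooth_on_cong[OF o, THEN iffD2, rotated]) (use A d F in auto)
qed

lemma msmooth_chart_coord:
  assumes "smooth_atlas A" "c \<in> A" shows "msmooth (restr A (fst c)) (snd c)"
  using msmooth_in_chart[OF assms open_UNIV smooth_on_id[OF open_UNIV]] by simp

lemma msmooth_const: "smooth_atlas A \<Longrightarrow> msmooth A (\<lambda>x. k)"
  by (simp add: msmooth_def smooth_atlasD smooth_on_const)

lemma msmooth_add: "smooth_atlas A \<Longrightarrow> msmooth A F \<Longrightarrow> msmooth A G \<Longrightarrow> msmooth A (\<lambda>x. F x + G x)"
  by (simp add: msmooth_def smooth_atlasD smooth_on_add)

lemma msmooth_diff: "smooth_atlas A \<Longrightarrow> msmooth A F \<Longrightarrow> msmooth A G \<Longrightarrow> msmooth A (\<lambda>x. F x - G x)"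
  by (simp add: msmooth_def smooth_atlasD smooth_on_diff)

lemma msmooth_scaleR: "smooth_atlas A \<Longrightarrow> msmooth A F \<Longrightarrow> msmooth A G \<Longrightarrow> msmooth A (\<lambda>x. F x *\<^sub>R G x)"
  by (simp add: msmooth_def smooth_atlasD smooth_on_scaleR)

lemma msmooth_mult:
  fixes F G :: "'m \<Rightarrow> real"
  shows "smooth_atlas A \<Longrightarrow> msmooth A F \<Longrightarrow> msmooth A G \<Longrightarrow> msmooth A (\<lambda>x. F x * G x)"
  by (simp add: msmooth_def smooth_atlasD smooth_on_mult)

lemma msmooth_sum:
  "smooth_atlas A \<Longrightarrow> (\<And>i. i \<in> I \<Longrightarrow> msmooth A (F i)) \<Longrightarrow> msmooth A (\<lambda>x. \<Sum>i\<in>I. F i x)"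
  by (simp add: msmooth_def smooth_atlasD smooth_on_sum)

lemma msmooth_inner: "smooth_atlas A \<Longrightarrow> msmooth A F \<Longrightarrow> msmooth A (\<lambda>x. F x \<bullet> b)"
  by (simp add: msmooth_def smooth_atlasD smooth_on_inner_left)

lemma msmooth_componentwise:
  fixes F :: "'m \<Rightarrow> 'b::euclidean_space"
  shows "smooth_atlas A \<Longrightarrow> (\<And>b. b \<in> Basis \<Longrightarrow> msmooth A (\<lambda>x. F x \<bullet> b)) \<Longrightarrow> msmooth A F"
  unfolding msmooth_def by (blast intro: smooth_on_componentwise smooth_atlasD(2))

lemma msmooth_compose:
  assumes "smooth_atlas A" "open T" "smooth_on T \<phi>" "msmooth A F" "\<And>x. x \<in> points A \<Longrightarrow> F x \<in> T"
  shows "msmooth A (\<lambda>x. \<phi> (F x))"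
  unfolding msmooth_def
proof
  fix c assume c: "c \<in> A"
  show "smooth_on (snd c ` fst c) (\<lambda>u. \<phi> (F (chart_inv c u)))"
    by (rule smooth_on_compose[OF smooth_atlasD(2)[OF assms(1) c] assms(2,3)])
      (use assms(1,4) c in \<open>auto simp: msmooth_def intro!: assms(5) points_chart[OF c]\<close>)
qed

subsection \<open>Derivatives\<close>

text \<open>One calculus for three notions: \<open>dir_deriv\<close>, \<open>coord_change\<close>
  out of the preferred chart and \<open>differential\<close> are instances, with F a real function,
  a coordinate map, or a map read in the chart at its image point.\<close>

definition mderiv :: "('m, 'e::euclidean_space) atlas \<Rightarrow> ('m \<Rightarrow> 'v::real_normed_vector) \<Rightarrow> 'm \<Rightarrow> 'e \<Rightarrow> 'v" where
  "mderiv A F x = frechet_derivative (\<lambda>u. F (chart_inv (chart_at A x) u)) (at (snd (chart_at A x) x))"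

definition has_mderiv ::
  "('m, 'e::euclidean_space) atlas \<Rightarrow> ('m \<Rightarrow> 'v::real_normed_vector) \<Rightarrow> 'm \<Rightarrow> ('e \<Rightarrow> 'v) \<Rightarrow> bool" where
  "has_mderiv A F x F' \<longleftrightarrow>
     ((\<lambda>u. F (chart_inv (chart_at A x) u)) has_derivative F') (at (snd (chart_at A x) x))"

lemma dir_deriv_eq: "dir_deriv A f x = mderiv A f x"
  by (simp add: dir_deriv_def mderiv_def o_def)

lemma coord_change_eq: "coord_change (chart_at A x) d x = mderiv A (snd d) x"
  by (simp add: coord_change_def mderiv_def o_def)

lemma differential_eq: "differential A B f x = mderiv A (\<lambda>y. snd (chart_at B (f x)) (f y)) x"
  by (simp add: differential_def mderiv_def o_def)

lemma has_mderivD: "has_mderiv A F x F' \<Longrightarrow> mderiv A F x = F'"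
  unfolding has_mderiv_def mderiv_def by (rule frechet_derivative_at[symmetric])

lemma has_mderiv_linear: "has_mderiv A F x F' \<Longrightarrow> linear F'"
  unfolding has_mderiv_def by (rule has_derivative_linear)

lemma has_mderiv_cong:
  assumes A: "smooth_atlas A" and S: "mopen A S" "x \<in> S" "x \<in> points A"
    and eq: "\<And>y. y \<in> S \<Longrightarrow> y \<in> points A \<Longrightarrow> F y = G y"
  shows "has_mderiv A F x F' \<longleftrightarrow> has_mderiv A G x F'"
proof -
  let ?c = "chart_at A x"
  have c: "?c \<in> A" "x \<in> fst ?c" using chart_at[OF S(3)] .
  show ?thesis unfolding has_mderiv_def
    by (rule has_derivative_cong_open[of "snd ?c ` (fst ?c \<inter> S)"])
      (use S c eq A points_chart[OF c(1)] in \<open>auto simp: mopen_def\<close>)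
qed

lemma mderiv_cong:
  assumes A: "smooth_atlas A" and S: "mopen A S" "x \<in> S" "x \<in> points A"
    and eq: "\<And>y. y \<in> S \<Longrightarrow> y \<in> points A \<Longrightarrow> F y = G y"
  shows "mderiv A F x = mderiv A G x"
proof -
  have "has_mderiv A F x F' = has_mderiv A G x F'" for F'
    by (rule has_mderiv_cong[OF A S eq])
  then show ?thesis unfolding has_mderiv_def mderiv_def frechet_derivative_def fun_eq_iff by simp
qed

lemma msmooth_has_mderiv:
  assumes A: "smooth_atlas A" and S: "mopen A S" "x \<in> S" "x \<in> points A" and F: "msmooth (restr A S) F"
  shows "has_mderiv A F x (mderiv A F x)"
proof -
  let ?c = "chart_at A x"
  have c: "?c \<in> A" "x \<in> fst ?c" using chart_at[OF S(3)] .
  have "smooth_on (snd ?c ` (fst ?c \<inter> S)) (\<lambda>u. F (chart_inv ?c u))"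
    using F c by (simp add: msmooth_restr_iff[OF A S(1)])
  then have "(\<lambda>u. F (chart_inv ?c u)) differentiable (at (snd ?c x))"
    by (rule smooth_on_differentiable) (use c S in auto)
  then show ?thesis unfolding has_mderiv_def mderiv_def by (rule has_derivative_frechet)
qed

lemma msmooth_has_mderiv_UNIV:
  "smooth_atlas A \<Longrightarrow> x \<in> points A \<Longrightarrow> msmooth A F \<Longrightarrow> has_mderiv A F x (mderiv A F x)"
  using msmooth_has_mderiv[of A UNIV x F] by simp

lemma has_mderiv_const: "has_mderiv A (\<lambda>x. k) x (\<lambda>v. 0)"
  by (simp add: has_mderiv_def)

lemma has_mderiv_add:
  "has_mderiv A F x F' \<Longrightarrow> has_mderiv A G x G' \<Longrightarrow> has_mderiv A (\<lambda>x. F x + G x) x (\<lambda>v. F' v + G' v)"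
  unfolding has_mderiv_def by (rule has_derivative_add)

lemma has_mderiv_scaleR:
  assumes "smooth_atlas A" "x \<in> points A" "has_mderiv A F x F'" "has_mderiv A G x G'"
  shows "has_mderiv A (\<lambda>x. F x *\<^sub>R G x) x (\<lambda>v. F x *\<^sub>R G' v + F' v *\<^sub>R G x)"
  using has_derivative_scaleR[OF assms(3,4)[unfolded has_mderiv_def]] chart_at[OF assms(2)] assms(1)
  by (simp add: has_mderiv_def)

lemma has_mderiv_mult:
  fixes F G :: "'m \<Rightarrow> real"
  assumes "smooth_atlas A" "x \<in> points A" "has_mderiv A F x F'" "has_mderiv A G x G'"
  shows "has_mderiv A (\<lambda>x. F x * G x) x (\<lambda>v. F x * G' v + F' v * G x)"
  using has_mderiv_scaleR[OF assms] by simp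

lemma has_mderiv_compose:
  assumes "smooth_atlas A" "x \<in> points A" "has_mderiv A F x F'" "(\<phi> has_derivative \<phi>') (at (F x))"
  shows "has_mderiv A (\<lambda>x. \<phi> (F x)) x (\<lambda>v. \<phi>' (F' v))"
  using has_derivative_compose[OF assms(3)[unfolded has_mderiv_def], of \<phi> \<phi>'] chart_at[OF assms(2)] assms(1,4)
  by (simp add: has_mderiv_def)

lemma has_mderiv_chart:
  assumes A: "smooth_atlas A" and d: "d \<in> A" "x \<in> fst d"
  shows "has_mderiv A (snd d) x (mderiv A (snd d) x)"
  by (rule msmooth_has_mderiv[OF A mopen_chart[OF A d(1)] d(2) points_chart[OF d] msmooth_chart_coord[OF A d(1)]])

text \<open>The preferred chart is an arbitrary choice. This moves a computation into a chart d at
  hand, with \<open>mderiv A (snd d) x v\<close> as the components of v in d.\<close>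

lemma has_mderiv_in_chart:
  assumes A: "smooth_atlas A" and d: "d \<in> A" "x \<in> fst d"
    and F: "((\<lambda>u. F (chart_inv d u)) has_derivative F') (at (snd d x))"
  shows "has_mderiv A F x (\<lambda>v. F' (mderiv A (snd d) x v))"
proof -
  have "has_mderiv A (\<lambda>y. F (chart_inv d (snd d y))) x (\<lambda>v. F' (mderiv A (snd d) x v))"
    by (rule has_mderiv_compose[OF A points_chart[OF d] has_mderiv_chart[OF A d]]) (use F in simp)
  then show ?thesis
    by (rule has_mderiv_cong[OF A mopen_chart[OF A d(1)] d(2) points_chart[OF d], THEN iffD1, rotated])
      (use A d in simp)
qed

lemma mderiv_in_chart:
  assumes A: "smooth_atlas A" and d: "d \<in> A" "x \<in> fst d" and S: "mopen A S" "x \<in> S"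
    and F: "msmooth (restr A S) F"
  shows "mderiv A F x v = frechet_derivative (\<lambda>u. F (chart_inv d u)) (at (snd d x)) (mderiv A (snd d) x v)"
proof -
  have "smooth_on (snd d ` (fst d \<inter> S)) (\<lambda>u. F (chart_inv d u))"
    using F d by (simp add: msmooth_restr_iff[OF A S(1)])
  then have "(\<lambda>u. F (chart_inv d u)) differentiable (at (snd d x))"
    by (rule smooth_on_differentiable) (use d S in auto)
  from has_mderivD[OF has_mderiv_in_chart[OF A d has_derivative_frechet[OF this]]] show ?thesis by simp
qed

section \<open>Coordinate changes and coordinate vector fields\<close>

lemma coord_change_has_derivative:
  assumes A: "smooth_atlas A" and c: "c \<in> A" "x \<in> fst c" and d: "d \<in> A" "x \<in> fst d"
  shows "((\<lambda>u. snd d (chart_inv c u)) has_derivative coord_change c d x) (at (snd c x))"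
proof -
  have "(\<lambda>u. snd d (chart_inv c u)) differentiable (at (snd c x))"
    by (rule smooth_on_differentiable[OF smooth_atlasD(4)[OF A c(1) d(1)]]) (use c d in auto)
  then show ?thesis unfolding coord_change_def o_def by (rule has_derivative_frechet)
qed

lemma coord_change_linear:
  assumes "smooth_atlas A" "c \<in> A" "x \<in> fst c" "d \<in> A" "x \<in> fst d"
  shows "linear (coord_change c d x)"
  using coord_change_has_derivative[OF assms] by (rule has_derivative_linear)

lemma mderiv_chart_coord_change:
  assumes A: "smooth_atlas A" and c: "c \<in> A" "x \<in> fst c" and d: "d \<in> A" "x \<in> fst d"
  shows "mderiv A (snd d) x v = coord_change c d x (mderiv A (snd c) x v)"
  using has_mderivD[OF has_mderiv_in_chart[OF A c coord_change_has_derivative[OF A c d]]] by simp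

lemma coord_change_compose:
  assumes A: "smooth_atlas A" and c: "c \<in> A" "x \<in> fst c" and d: "d \<in> A" "x \<in> fst d" and e: "e \<in> A" "x \<in> fst e"
  shows "coord_change d e x (coord_change c d x v) = coord_change c e x v"
proof -
  have 1: "((\<lambda>u. snd e (chart_inv d (snd d (chart_inv c u)))) has_derivative
      (\<lambda>v. coord_change d e x (coord_change c d x v))) (at (snd c x))"
    by (rule has_derivative_compose[OF coord_change_has_derivative[OF A c d], where g = "\<lambda>w. snd e (chart_inv d w)"])
      (use coord_change_has_derivative[OF A d e] A c in simp)
  have "((\<lambda>u. snd e (chart_inv c u)) has_derivative
      (\<lambda>v. coord_change d e x (coord_change c d x v))) (at (snd c x))"
    by (rule has_derivative_cong_open[of "snd c ` (fst c \<inter> fst d)", THEN iffD1, OF _ _ _ 1])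
      (use A c d smooth_atlasD(3)[OF A c(1) d(1)] in auto)
  then show ?thesis using has_derivative_unique[OF coord_change_has_derivative[OF A c e]] by metis
qed

lemma coord_change_self:
  assumes A: "smooth_atlas A" and c: "c \<in> A" "x \<in> fst c"
  shows "coord_change c c x v = v"
proof -
  have "((\<lambda>u. snd c (chart_inv c u)) has_derivative (\<lambda>v. v)) (at (snd c x))"
    by (rule has_derivative_cong_open[of "snd c ` fst c" _ "\<lambda>u. u", THEN iffD1])
      (use A c smooth_atlasD(2)[OF A c(1)] in \<open>auto simp: chart_apply_inv\<close>)
  then show ?thesis using has_derivative_unique[OF coord_change_has_derivative[OF A c c]] by metis
qed

text \<open>The tangent vector at x with components b in the chart d; for fixed b, a coordinate
  vector field. As a map in b it inverts \<open>mderiv A (snd d) x\<close>.\<close>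

definition coord_vec :: "('m, 'e::euclidean_space) atlas \<Rightarrow> ('m, 'e) chart \<Rightarrow> 'e \<Rightarrow> 'm \<Rightarrow> 'e" where
  "coord_vec A d b x = coord_change d (chart_at A x) x b"

lemma mderiv_coord_vec:
  assumes A: "smooth_atlas A" and d: "d \<in> A" "x \<in> fst d"
  shows "mderiv A (snd d) x (coord_vec A d b x) = b"
    "coord_vec A d (mderiv A (snd d) x v) x = v"
  using coord_change_compose[OF A d chart_at[OF points_chart[OF d]] d, of b]
    coord_change_compose[OF A chart_at[OF points_chart[OF d]] d chart_at[OF points_chart[OF d]], of v]
    coord_change_self[OF A d] coord_change_self[OF A chart_at[OF points_chart[OF d]]]
  by (simp_all add: coord_change_eq coord_vec_def)

lemma linear_coord_vec:
  assumes A: "smooth_atlas A" and d: "d \<in> A" "x \<in> fst d"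
  shows "linear (\<lambda>b. coord_vec A d b x)"
  using coord_change_linear[OF A d chart_at[OF points_chart[OF d]]] by (simp add: coord_vec_def)

lemma linear_mderiv_chart:
  assumes A: "smooth_atlas A" and d: "d \<in> A" "x \<in> fst d"
  shows "linear (mderiv A (snd d) x)"
  using has_mderiv_chart[OF assms] by (rule has_mderiv_linear)

lemma coord_vec_expand:
  assumes A: "smooth_atlas A" and d: "d \<in> A" "x \<in> fst d"
  shows "v = (\<Sum>b\<in>Basis. (mderiv A (snd d) x v \<bullet> b) *\<^sub>R coord_vec A d b x)"
  using linear_sum_Basis[OF linear_coord_vec[OF assms], of "mderiv A (snd d) x v"]
  by (simp add: mderiv_coord_vec(2)[OF assms])

text \<open>Stated with smoothness in the single chart at \<open>f x\<close>, so that it covers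
  inclusions, sections and the bundle projection alike.\<close>

lemma mderiv_chain:
  assumes A: "smooth_atlas A" and S: "mopen A S" "x \<in> S" "x \<in> points A"
    and B: "smooth_atlas B" "f x \<in> points B"
    and f: "\<And>y. y \<in> S \<Longrightarrow> y \<in> points A \<Longrightarrow> f y \<in> fst (chart_at B (f x))"
      "msmooth (restr A S) (\<lambda>y. snd (chart_at B (f x)) (f y))"
    and F: "has_mderiv B F (f x) F'"
  shows "has_mderiv A (\<lambda>y. F (f y)) x (\<lambda>v. F' (differential A B f x v))"
proof -
  let ?d = "chart_at B (f x)"
  have 1: "has_mderiv A (\<lambda>y. snd ?d (f y)) x (differential A B f x)"
    unfolding differential_eq by (rule msmooth_has_mderiv[OF A S f(2)])
  have "has_mderiv A (\<lambda>y. F (chart_inv ?d (snd ?d (f y)))) x (\<lambda>v. F' (differential A B f x v))"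
    by (rule has_mderiv_compose[OF A S(3) 1]) (use F in \<open>simp add: has_mderiv_def\<close>)
  then show ?thesis
    by (rule has_mderiv_cong[OF A S, THEN iffD1, rotated]) (use f(1) B chart_at[OF B(2)] in simp)
qed

section \<open>Vector fields and sections\<close>

lemma mopen_preimage:
  assumes A: "smooth_atlas A" and S: "mopen A S" and F: "msmooth (restr A S) F" and T: "open T"
  shows "mopen A {x \<in> S. F x \<in> T}"
  unfolding mopen_def
proof
  fix c assume c: "c \<in> A"
  have "snd c ` (fst c \<inter> {x \<in> S. F x \<in> T}) = snd c ` (fst c \<inter> S) \<inter> (\<lambda>u. F (chart_inv c u)) -` T"
    using A c by (auto simp: image_iff)
  moreover have "smooth_on (snd c ` (fst c \<inter> S)) (\<lambda>u. F (chart_inv c u))"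
    using F c by (simp add: msmooth_restr_iff[OF A S])
  ultimately show "open (snd c ` (fst c \<inter> {x \<in> S. F x \<in> T}))"
    using continuous_open_preimage[OF smooth_on_continuous _ T, of "snd c ` (fst c \<inter> S)"] S c
    by (simp add: mopen_def)
qed

text \<open>The direction k moves with the point; expansion in \<open>Basis\<close> leaves
  derivatives in fixed directions with smooth coefficients.\<close>

lemma msmooth_frechet:
  assumes A: "smooth_atlas A" and T: "open T" "smooth_on T \<phi>" and h: "msmooth A h" "\<And>x. x \<in> points A \<Longrightarrow> h x \<in> T"
    and k: "msmooth A k"
  shows "msmooth A (\<lambda>y. frechet_derivative \<phi> (at (h y)) (k y))"
proof -
  have *: "msmooth A (\<lambda>y. \<Sum>b\<in>Basis. (k y \<bullet> b) *\<^sub>R frechet_derivative \<phi> (at (h y)) b)"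
    by (intro msmooth_sum msmooth_scaleR msmooth_inner A k
        msmooth_compose[OF A T(1) smooth_on_frechet[OF T(2)] h])
  show ?thesis
    by (rule msmooth_cong[OF A, THEN iffD2, OF _ *])
      (rule frechet_derivative_sum_Basis[OF smooth_on_differentiable[OF T(2) h(2)]])
qed

text \<open>What an atlas inside itself, an open restriction, and L inside M have in common;
  sections along an inclusion are developed once for all three.\<close>

definition minclusion :: "('m, 'e::euclidean_space) atlas \<Rightarrow> ('m, 'f::euclidean_space) atlas \<Rightarrow> bool" where
  "minclusion A B \<longleftrightarrow> smooth_atlas A \<and> smooth_atlas B \<and> points A \<subseteq> points B \<and>
     (\<forall>d\<in>B. mopen A (fst d) \<and> msmooth (restr A (fst d)) (snd d))"

lemma minclusionD:
  assumes "minclusion A B"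
  shows "smooth_atlas A" "smooth_atlas B" "x \<in> points A \<Longrightarrow> x \<in> points B"
    "d \<in> B \<Longrightarrow> mopen A (fst d)" "d \<in> B \<Longrightarrow> msmooth (restr A (fst d)) (snd d)"
  using assms by (auto simp: minclusion_def)

lemma minclusion_refl: "smooth_atlas A \<Longrightarrow> minclusion A A"
  by (simp add: minclusion_def mopen_chart msmooth_chart_coord)

lemma minclusion_restr:
  assumes "minclusion A B" "mopen A S" shows "minclusion (restr A S) B"
proof -
  note AB = minclusionD[OF assms(1)]
  have "msmooth (restr A (S \<inter> fst d)) (snd d)" if "d \<in> B" for d
    by (rule msmooth_subset[OF AB(1) AB(4)[OF that] mopen_Int[OF AB(1) assms(2) AB(4)[OF that]] _ AB(5)[OF that]]) auto
  then show ?thesis unfolding minclusion_def using AB assms(2)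
    by (auto intro!: smooth_atlas_restr mopen_restr)
qed

lemma minclusion_chart_at:
  assumes "minclusion A B" "x \<in> points A" shows "chart_at B x \<in> B" "x \<in> fst (chart_at B x)"
  using chart_at[OF minclusionD(3)[OF assms]] .

lemma minclusion_chart_restr: "minclusion A B \<Longrightarrow> d \<in> B \<Longrightarrow> smooth_atlas (restr A (fst d))"
  by (simp add: minclusionD smooth_atlas_restr)

lemma msmooth_restr_full:
  assumes A: "smooth_atlas A" and "mopen A S" "points A \<subseteq> S" "msmooth (restr A S) F"
  shows "msmooth A F"
  by (rule msmooth_local[OF A]) (use assms in blast)

text \<open>Continuity of the inclusion: near x the set S is the preimage of an open set under
  coordinates of B, and these restrict to smooth functions on A.\<close>

lemma minclusion_mopen:
  assumes AB: "minclusion A B" and S: "mopen B S" shows "mopen A S"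
proof (rule mopen_local[OF minclusionD(1)[OF AB]])
  note AB' = minclusionD[OF AB]
  fix x assume x: "x \<in> points A" "x \<in> S"
  let ?d = "chart_at B x"
  have d: "?d \<in> B" "x \<in> fst ?d" using minclusion_chart_at[OF AB x(1)] .
  let ?T = "{y \<in> fst ?d. snd ?d y \<in> snd ?d ` (fst ?d \<inter> S)}"
  have "mopen A ?T"
    by (rule mopen_preimage[OF AB'(1) AB'(4)[OF d(1)] AB'(5)[OF d(1)]]) (use S d in \<open>simp add: mopen_def\<close>)
  moreover have "?T \<subseteq> S" using smooth_atlasD(1)[OF AB'(2) d(1)] by (auto simp: inj_on_def)
  ultimately show "\<exists>T. mopen A T \<and> x \<in> T \<and> points A \<inter> T \<subseteq> S"
    using x d by (intro exI[of _ ?T]) auto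
qed

lemma minclusion_msmooth:
  assumes AB: "minclusion A B" and S: "mopen B S" and F: "msmooth (restr B S) F"
  shows "msmooth (restr A S) F"
proof -
  note AB' = minclusionD[OF AB]
  have SA: "mopen A S" by (rule minclusion_mopen[OF AB S])
  note R = smooth_atlas_restr[OF AB'(1) SA]
  show ?thesis
  proof (rule msmooth_local[OF R])
    fix x assume x: "x \<in> points (restr A S)"
    let ?d = "chart_at B x"
    have d: "?d \<in> B" "x \<in> fst ?d" using minclusion_chart_at[OF AB, of x] x by auto
    have U: "mopen A (S \<inter> fst ?d)" by (rule mopen_Int[OF AB'(1) SA AB'(4)[OF d(1)]])
    have o: "open (snd ?d ` (fst ?d \<inter> S))" using S d by (simp add: mopen_def)
    have "smooth_on (snd ?d ` (fst ?d \<inter> S)) (\<lambda>u. F (chart_inv ?d u))"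
      using F d by (simp add: msmooth_restr_iff[OF AB'(2) S])
    then have "msmooth (restr A (S \<inter> fst ?d)) (\<lambda>y. F (chart_inv ?d (snd ?d y)))"
      by (rule msmooth_compose[OF smooth_atlas_restr[OF AB'(1) U] o])
        (use msmooth_subset[OF AB'(1) AB'(4)[OF d(1)] U _ AB'(5)[OF d(1)]] d in auto)
    then have "msmooth (restr A (S \<inter> fst ?d)) F"
      by (rule msmooth_cong[OF smooth_atlas_restr[OF AB'(1) U], THEN iffD1, rotated])
        (use AB'(2) d in auto)
    then show "\<exists>T. mopen (restr A S) T \<and> x \<in> T \<and> msmooth (restr (restr A S) T) F"
      using d mopen_restr[OF AB'(1) SA AB'(4)[OF d(1)]] by auto
  qed
qed

lemma submanifold_minclusion:
  assumes "smooth_manifold M" "submanifold L M" shows "minclusion L M"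
proof -
  have L: "smooth_atlas L" and M: "smooth_atlas M" and i: "smooth_map L M (\<lambda>x. x)"
    using assms by (auto simp: submanifold_def smooth_manifold_atlas)
  have 1: "mopen L (fst d)" if "d \<in> M" for d
    using i that by (auto simp: smooth_map_def mopen_def)
  have 2: "msmooth (restr L (fst d)) (snd d)" if "d \<in> M" for d
    using i that by (auto simp: smooth_map_def msmooth_restr_iff[OF L 1] o_def)
  show ?thesis using L M 1 2 i by (auto simp: minclusion_def smooth_map_def)
qed

text \<open>The raw values of a section refer to preferred charts, which jump from point to point.
  Its components in a fixed chart d are \<open>mderiv B (snd d) y (\<xi> y)\<close>, and smoothness
  refers to these.\<close>

lemma smooth_along_iff:
  assumes AB: "minclusion A B"
  shows "smooth_along A B \<xi> \<longleftrightarrow> (\<forall>d\<in>B. msmooth (restr A (fst d)) (\<lambda>y. mderiv B (snd d) y (\<xi> y)))"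
  unfolding smooth_along_def using minclusionD[OF AB] by (auto simp: msmooth_restr_iff coord_change_eq)

lemma smooth_along_restr_iff:
  assumes AB: "minclusion A B" and S: "mopen A S"
  shows "smooth_along (restr A S) B \<xi> \<longleftrightarrow> (\<forall>d\<in>B. msmooth (restr A (S \<inter> fst d)) (\<lambda>y. mderiv B (snd d) y (\<xi> y)))"
  using smooth_along_iff[OF minclusion_restr[OF AB S]] by simp

lemma smooth_along_subset:
  assumes AB: "minclusion A B" and S: "mopen A S" and T: "mopen A T" "T \<subseteq> S" and "smooth_along (restr A S) B \<xi>"
  shows "smooth_along (restr A T) B \<xi>"
  using assms(5) minclusionD[OF AB] S T mopen_Int[of A] unfolding smooth_along_restr_iff[OF AB S] smooth_along_restr_iff[OF AB T(1)]
  by (meson Int_mono msmooth_subset order_refl)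

lemma smooth_along_restr:
  assumes AB: "minclusion A B" and T: "mopen A T" and "smooth_along A B \<xi>"
  shows "smooth_along (restr A T) B \<xi>"
  using smooth_along_subset[OF AB mopen_UNIV T subset_UNIV] minclusionD(1)[OF AB] assms(3) by simp

lemma smooth_along_cong:
  assumes AB: "minclusion A B" and "\<And>x. x \<in> points A \<Longrightarrow> \<xi> x = \<eta> x"
  shows "smooth_along A B \<xi> \<longleftrightarrow> smooth_along A B \<eta>"
proof -
  note AB' = minclusionD[OF AB]
  have "msmooth (restr A (fst d)) (\<lambda>y. mderiv B (snd d) y (\<xi> y)) \<longleftrightarrow>
      msmooth (restr A (fst d)) (\<lambda>y. mderiv B (snd d) y (\<eta> y))" if "d \<in> B" for d
    by (rule msmooth_cong[OF minclusion_chart_restr[OF AB that]]) (use assms(2) in simp)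
  then show ?thesis by (simp add: smooth_along_iff[OF AB])
qed

lemma smooth_along_local:
  assumes AB: "minclusion A B"
    and *: "\<And>x. x \<in> points A \<Longrightarrow> \<exists>S. mopen A S \<and> x \<in> S \<and> smooth_along (restr A S) B \<xi>"
  shows "smooth_along A B \<xi>"
  unfolding smooth_along_iff[OF AB]
proof
  note AB' = minclusionD[OF AB]
  fix d assume d: "d \<in> B"
  show "msmooth (restr A (fst d)) (\<lambda>y. mderiv B (snd d) y (\<xi> y))"
  proof (rule msmooth_local[OF minclusion_chart_restr[OF AB d]])
    fix x assume x: "x \<in> points (restr A (fst d))"
    then obtain S where S: "mopen A S" "x \<in> S" "smooth_along (restr A S) B \<xi>" using * by auto
    then have "msmooth (restr A (fst d \<inter> S)) (\<lambda>y. mderiv B (snd d) y (\<xi> y))"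
      using d smooth_along_restr_iff[OF AB S(1)] by (simp add: Int_commute)
    then show "\<exists>T. mopen (restr A (fst d)) T \<and> x \<in> T \<and> msmooth (restr (restr A (fst d)) T) (\<lambda>y. mderiv B (snd d) y (\<xi> y))"
      using S mopen_restr[OF AB'(1) AB'(4)[OF d] S(1)] by auto
  qed
qed

lemma smooth_along_zero:
  assumes AB: "minclusion A B" shows "smooth_along A B (\<lambda>x. 0)"
  unfolding smooth_along_iff[OF AB]
proof
  fix d assume d: "d \<in> B"
  note R = minclusion_chart_restr[OF AB d]
  have "mderiv B (snd d) y 0 = 0" if "y \<in> fst d" for y
    using linear_mderiv_chart[OF minclusionD(2)[OF AB] d that] by (rule linear_0)
  then show "msmooth (restr A (fst d)) (\<lambda>y. mderiv B (snd d) y 0)"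
    by (intro msmooth_cong[OF R, THEN iffD1, OF _ msmooth_const[OF R]]) simp
qed

lemma smooth_along_add:
  assumes AB: "minclusion A B" and "smooth_along A B \<xi>" "smooth_along A B \<eta>"
  shows "smooth_along A B (\<lambda>x. \<xi> x + \<eta> x)"
  unfolding smooth_along_iff[OF AB]
proof
  note AB' = minclusionD[OF AB]
  fix d assume d: "d \<in> B"
  note R = minclusion_chart_restr[OF AB d]
  have "msmooth (restr A (fst d)) (\<lambda>y. mderiv B (snd d) y (\<xi> y) + mderiv B (snd d) y (\<eta> y))"
    using assms d by (intro msmooth_add R) (auto simp: smooth_along_iff[OF AB])
  then show "msmooth (restr A (fst d)) (\<lambda>y. mderiv B (snd d) y (\<xi> y + \<eta> y))"
    by (rule msmooth_cong[OF R, THEN iffD1, rotated])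
      (use linear_mderiv_chart[OF AB'(2) d] in \<open>auto simp: linear_add\<close>)
qed

lemma smooth_along_scaleR:
  assumes AB: "minclusion A B" and "msmooth A f" "smooth_along A B \<xi>"
  shows "smooth_along A B (\<lambda>x. f x *\<^sub>R \<xi> x)"
  unfolding smooth_along_iff[OF AB]
proof
  note AB' = minclusionD[OF AB]
  fix d assume d: "d \<in> B"
  note R = minclusion_chart_restr[OF AB d]
  have "msmooth (restr A (fst d)) (\<lambda>y. f y *\<^sub>R mderiv B (snd d) y (\<xi> y))"
    using assms(3) d by (intro msmooth_scaleR R msmooth_restr[OF AB'(1) AB'(4)[OF d] assms(2)])
      (auto simp: smooth_along_iff[OF AB])
  then show "msmooth (restr A (fst d)) (\<lambda>y. mderiv B (snd d) y (f y *\<^sub>R \<xi> y))"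
    by (rule msmooth_cong[OF R, THEN iffD1, rotated])
      (use linear_mderiv_chart[OF AB'(2) d] in \<open>auto simp: linear_scale\<close>)
qed

text \<open>Components in another chart arise by applying the derivative of the transition map,
  which is smooth in the base point and linear in the components.\<close>

lemma smooth_along_in_chart:
  assumes AB: "minclusion A B" and d: "d \<in> B" "points A \<subseteq> fst d"
    and sm: "msmooth A (\<lambda>y. mderiv B (snd d) y (\<xi> y))"
  shows "smooth_along A B \<xi>"
  unfolding smooth_along_iff[OF AB]
proof
  note AB' = minclusionD[OF AB]
  fix e assume e: "e \<in> B"
  note R = minclusion_chart_restr[OF AB e]
  have o: "open (snd d ` (fst d \<inter> fst e))" by (rule smooth_atlasD(3)[OF AB'(2) d(1) e])
  have "msmooth A (snd d)" by (rule msmooth_restr_full[OF AB'(1) AB'(4)[OF d(1)] d(2) AB'(5)[OF d(1)]])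
  then have "msmooth (restr A (fst e)) (\<lambda>y. frechet_derivative (\<lambda>u. snd e (chart_inv d u)) (at (snd d y))
      (mderiv B (snd d) y (\<xi> y)))"
    using d(2) by (intro msmooth_frechet[OF R o smooth_atlasD(4)[OF AB'(2) d(1) e]]
        msmooth_restr[OF AB'(1) AB'(4)[OF e]] sm) auto
  then show "msmooth (restr A (fst e)) (\<lambda>y. mderiv B (snd e) y (\<xi> y))"
  proof (rule msmooth_cong[OF R, THEN iffD1, rotated])
    fix x assume "x \<in> points (restr A (fst e))"
    then have x: "x \<in> fst e" "x \<in> fst d" using d(2) by auto
    show "frechet_derivative (\<lambda>u. snd e (chart_inv d u)) (at (snd d x)) (mderiv B (snd d) x (\<xi> x)) =
        mderiv B (snd e) x (\<xi> x)"
      using mderiv_chart_coord_change[OF AB'(2) d(1) x(2) e x(1)] by (simp add: coord_change_def o_def)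
  qed
qed

lemma msmooth_mderiv:
  assumes AB: "minclusion A B" and \<xi>: "smooth_along A B \<xi>"
    and S: "mopen B S" "points A \<subseteq> S" and F: "msmooth (restr B S) F"
  shows "msmooth A (\<lambda>y. mderiv B F y (\<xi> y))"
proof (rule msmooth_local[OF minclusionD(1)[OF AB]])
  note AB' = minclusionD[OF AB]
  fix x assume x: "x \<in> points A"
  let ?d = "chart_at B x"
  have d: "?d \<in> B" "x \<in> fst ?d" using minclusion_chart_at[OF AB x] .
  note R = minclusion_chart_restr[OF AB d(1)]
  have "msmooth (restr A (fst ?d)) (\<lambda>y. frechet_derivative (\<lambda>u. F (chart_inv ?d u)) (at (snd ?d y))
      (mderiv B (snd ?d) y (\<xi> y)))"
  proof (rule msmooth_frechet[OF R _ _ AB'(5)[OF d(1)]])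
    show "open (snd ?d ` (fst ?d \<inter> S))" using S d by (simp add: mopen_def)
    show "smooth_on (snd ?d ` (fst ?d \<inter> S)) (\<lambda>u. F (chart_inv ?d u))"
      using F d by (simp add: msmooth_restr_iff[OF AB'(2) S(1)])
    show "msmooth (restr A (fst ?d)) (\<lambda>y. mderiv B (snd ?d) y (\<xi> y))"
      using \<xi> d by (simp add: smooth_along_iff[OF AB])
  qed (use S(2) in auto)
  then have "msmooth (restr A (fst ?d)) (\<lambda>y. mderiv B F y (\<xi> y))"
    by (rule msmooth_cong[OF R, THEN iffD1, rotated])
      (use mderiv_in_chart[OF AB'(2) d(1) _ S(1) _ F] S(2) in auto)
  then show "\<exists>S. mopen A S \<and> x \<in> S \<and> msmooth (restr A S) (\<lambda>y. mderiv B F y (\<xi> y))"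
    using AB'(4) d by blast
qed

lemma msmooth_mderiv_UNIV:
  "minclusion A B \<Longrightarrow> smooth_along A B \<xi> \<Longrightarrow> msmooth B F \<Longrightarrow> msmooth A (\<lambda>y. mderiv B F y (\<xi> y))"
  using msmooth_mderiv[of A B \<xi> UNIV F] minclusionD(2)[of A B] by simp

lemma smooth_along_coord_vec:
  assumes AB: "minclusion A B" and d: "d \<in> B"
  shows "smooth_along (restr A (fst d)) B (coord_vec B d b)"
proof (rule smooth_along_in_chart[OF minclusion_restr[OF AB] d])
  note AB' = minclusionD[OF AB]
  show "mopen A (fst d)" by (rule AB'(4)[OF d])
  have "msmooth (restr A (fst d)) (\<lambda>y. b)" by (rule msmooth_const[OF minclusion_chart_restr[OF AB d]])
  then show "msmooth (restr A (fst d)) (\<lambda>y. mderiv B (snd d) y (coord_vec B d b y))"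
    by (rule msmooth_cong[OF minclusion_chart_restr[OF AB d], THEN iffD1, rotated])
      (use mderiv_coord_vec(1)[OF AB'(2) d] in simp)
qed auto

lemma mderiv_incl_deriv:
  assumes AB: "minclusion A B" and x: "x \<in> points A" and S: "mopen B S" "x \<in> S" "msmooth (restr B S) F"
  shows "mderiv B F x (incl_deriv A B x u) = mderiv A F x u"
proof -
  note AB' = minclusionD[OF AB]
  note d = minclusion_chart_at[OF AB x]
  have "has_mderiv A (\<lambda>y. F y) x (\<lambda>v. mderiv B F x (incl_deriv A B x v))"
    by (rule mderiv_chain[OF AB'(1) AB'(4)[OF d(1)] d(2) x AB'(2) AB'(3)[OF x] _ AB'(5)[OF d(1)]])
      (auto intro: msmooth_has_mderiv[OF AB'(2) S(1,2) AB'(3)[OF x] S(3)])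
  from has_mderivD[OF this] show ?thesis by simp
qed

section \<open>Smoothness of Riemannian metrics on sections\<close>

lemma riemannian_metricD:
  assumes "riemannian_metric B g" "x \<in> points B"
  shows "bilinear (g x)" "g x v w = g x w v" "v \<noteq> 0 \<Longrightarrow> g x v v > 0"
  using assms by (auto simp: riemannian_metric_def)

lemma msmooth_metric_coord:
  assumes B: "smooth_atlas B" and g: "riemannian_metric B g" and d: "d \<in> B"
  shows "msmooth (restr B (fst d)) (\<lambda>y. g y (coord_vec B d a y) (coord_vec B d b y))"
proof -
  have "smooth_on (snd d ` fst d) (\<lambda>u. let y = chart_inv d u in
           g y (coord_change d (chart_at B y) y a) (coord_change d (chart_at B y) y b))"
    using g d unfolding riemannian_metric_def by blast
  then have "msmooth (restr B {x \<in> fst d. snd d x \<in> snd d ` fst d}) (\<lambda>y. g y (coord_vec B d a y) (coord_vec B d b y))"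
    by (rule msmooth_in_chart[OF B d smooth_atlasD(2)[OF B d]]) (use B d in \<open>simp add: coord_vec_def\<close>)
  moreover have "{x \<in> fst d. snd d x \<in> snd d ` fst d} = fst d" by auto
  ultimately show ?thesis by simp
qed

text \<open>Expand both sections in a coordinate frame of B: the Gram coefficients are smooth by
  definition of a metric, the components by definition of a section.\<close>

lemma msmooth_metric:
  assumes AB: "minclusion A B" and g: "riemannian_metric B g"
    and \<xi>: "smooth_along A B \<xi>" and \<eta>: "smooth_along A B \<eta>"
  shows "msmooth A (\<lambda>y. g y (\<xi> y) (\<eta> y))"
proof (rule msmooth_local[OF minclusionD(1)[OF AB]])
  note AB' = minclusionD[OF AB]
  fix x assume x: "x \<in> points A"
  let ?d = "chart_at B x"
  have d: "?d \<in> B" "x \<in> fst ?d" using minclusion_chart_at[OF AB x] .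
  note R = minclusion_chart_restr[OF AB d(1)]
  let ?e = "coord_vec B ?d"
  have "msmooth (restr A (fst ?d)) (\<lambda>y. mderiv B (snd ?d) y (\<xi> y))"
    "msmooth (restr A (fst ?d)) (\<lambda>y. mderiv B (snd ?d) y (\<eta> y))"
    using \<xi> \<eta> d by (auto simp: smooth_along_iff[OF AB])
  moreover have "msmooth (restr A (fst ?d)) (\<lambda>y. g y (?e a y) (?e b y))" for a b
    by (rule minclusion_msmooth[OF AB mopen_chart[OF AB'(2) d(1)] msmooth_metric_coord[OF AB'(2) g d(1)]])
  ultimately have "msmooth (restr A (fst ?d)) (\<lambda>y. \<Sum>a\<in>Basis. \<Sum>b\<in>Basis.
      ((mderiv B (snd ?d) y (\<xi> y) \<bullet> a) * (mderiv B (snd ?d) y (\<eta> y) \<bullet> b)) * g y (?e a y) (?e b y))"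
    by (intro msmooth_sum msmooth_mult msmooth_inner R)
  then have "msmooth (restr A (fst ?d)) (\<lambda>y. g y (\<xi> y) (\<eta> y))"
  proof (rule msmooth_cong[OF R, THEN iffD1, rotated])
    fix y assume "y \<in> points (restr A (fst ?d))"
    then have y: "y \<in> points B" "y \<in> fst ?d" using AB' by auto
    have bl: "bilinear (g y)" by (rule riemannian_metricD[OF g y(1)])
    have "g y (\<xi> y) (\<eta> y) = g y (\<Sum>a\<in>Basis. (mderiv B (snd ?d) y (\<xi> y) \<bullet> a) *\<^sub>R ?e a y)
        (\<Sum>b\<in>Basis. (mderiv B (snd ?d) y (\<eta> y) \<bullet> b) *\<^sub>R ?e b y)"
      using coord_vec_expand[OF AB'(2) d(1) y(2)] by simp
    also have "\<dots> = (\<Sum>a\<in>Basis. \<Sum>b\<in>Basis.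
      ((mderiv B (snd ?d) y (\<xi> y) \<bullet> a) * (mderiv B (snd ?d) y (\<eta> y) \<bullet> b)) * g y (?e a y) (?e b y))"
      by (simp add: bilinear_sum[OF bl] bilinear_lmul[OF bl] bilinear_rmul[OF bl] sum.cartesian_product
          mult.assoc mult.left_commute)
    finally show "(\<Sum>a\<in>Basis. \<Sum>b\<in>Basis.
      ((mderiv B (snd ?d) y (\<xi> y) \<bullet> a) * (mderiv B (snd ?d) y (\<eta> y) \<bullet> b)) * g y (?e a y) (?e b y)) = g y (\<xi> y) (\<eta> y)" ..
  qed
  then show "\<exists>S. mopen A S \<and> x \<in> S \<and> msmooth (restr A S) (\<lambda>y. g y (\<xi> y) (\<eta> y))"
    using AB'(4) d by blast
qed

subsection \<open>Cutoff functions\<close>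

text \<open>The Hausdorff axiom speaks of the generated topology; this brings its consequences into
  the chartwise notion of openness.\<close>

lemma openin_atlas_topology_mopen:
  assumes A: "smooth_atlas A" and U: "openin (atlas_topology A) U"
  shows "mopen A U"
proof -
  have "generate_topology_on {fst c \<inter> snd c -` T | c T. c \<in> A \<and> open T} U"
    using U by (simp add: atlas_topology_def openin_topology_generated_by_iff)
  then show ?thesis
  proof induction
    case Empty
    then show ?case by (simp add: mopen_def)
  next
    case (Int a b)
    then show ?case by (intro mopen_Int A)
  next
    case (UN K)
    then show ?case by (intro mopen_local[OF A]) blast
  next
    case (Basis s)
    then obtain c T where s: "c \<in> A" "open T" "s = fst c \<inter> snd c -` T" by blast
    have "s = {x \<in> fst c. snd c x \<in> T}" using s(3) by auto
    then show ?case using mopen_chart_preimage[OF A s(1,2)] by simp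
  qed
qed

lemma topspace_atlas_topology: "topspace (atlas_topology A) = points A"
proof (intro equalityI subsetI)
  fix x assume "x \<in> topspace (atlas_topology A)"
  then show "x \<in> points A" unfolding atlas_topology_def topology_generated_by_topspace points_def by blast
next
  fix x assume "x \<in> points A"
  then obtain c where c: "c \<in> A" "x \<in> fst c" by (auto simp: points_def)
  have "fst c \<inter> snd c -` UNIV \<in> {fst c \<inter> snd c -` T | c T. c \<in> A \<and> open T}" using c by blast
  then show "x \<in> topspace (atlas_topology A)"
    unfolding atlas_topology_def topology_generated_by_topspace using c by blast
qed

text \<open>The set C is closed in the chartwise sense and contains the support. Recording C, rather
  than mere vanishing off S, makes products with functions on S smooth across the edge of S.\<close>

definition cutoff :: "('m, 'e::euclidean_space) atlas \<Rightarrow> 'm set \<Rightarrow> 'm set \<Rightarrow> ('m \<Rightarrow> real) \<Rightarrow> bool" where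
  "cutoff A S V \<rho> \<longleftrightarrow> msmooth A \<rho> \<and> mopen A S \<and> mopen A V \<and> V \<subseteq> S \<and> (\<forall>y\<in>V. \<rho> y = 1) \<and>
     (\<exists>C\<subseteq>S. mopen A (- C) \<and> (\<forall>y. y \<notin> C \<longrightarrow> \<rho> y = 0))"

text \<open>The place where the Hausdorff axiom acts: the preimage C of a closed coordinate ball is
  compact, hence closed in the whole manifold, so that extension by zero is smooth.\<close>

lemma cutoff_exists:
  fixes A :: "('a, 'b::euclidean_space) atlas"
  assumes M: "smooth_manifold A" and S: "mopen A S" and x: "x \<in> points A" "x \<in> S"
  obtains V \<rho> where "cutoff A S V \<rho>" "x \<in> V"
proof -
  have A: "smooth_atlas A" using M by (rule smooth_manifold_atlas)
  define c where "c = chart_at A x"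
  have c: "c \<in> A" "x \<in> fst c" using chart_at[OF x(1)] by (auto simp: c_def)
  have o: "open (snd c ` (fst c \<inter> S))" using S c by (simp add: mopen_def)
  then obtain e where e: "e > 0" "cball (snd c x) e \<subseteq> snd c ` (fst c \<inter> S)"
    using c x open_contains_cball[of "snd c ` (fst c \<inter> S)"] by blast
  \<comment> \<open>Half the radius, because the bump function vanishes only from twice its radius
    on.\<close>
  obtain \<psi> :: "'b \<Rightarrow> real" where \<psi>: "smooth_on UNIV \<psi>" "\<And>u. dist (snd c x) u \<le> e / 2 \<Longrightarrow> \<psi> u = 1"
    "\<And>u. dist (snd c x) u \<ge> 2 * (e / 2) \<Longrightarrow> \<psi> u = 0"
    using smooth_bump[OF half_gt_zero[OF e(1)], of "snd c x"] by blast
  define C where "C = chart_inv c ` cball (snd c x) e"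
  define \<rho> where "\<rho> y = (if y \<in> fst c then \<psi> (snd c y) else 0)" for y
  define V where "V = {y \<in> fst c. snd c y \<in> ball (snd c x) (e / 2)}"
  have inC: "y \<in> C \<longleftrightarrow> y \<in> fst c \<and> snd c y \<in> cball (snd c x) e" for y
  proof
    assume "y \<in> C"
    then obtain u where u: "u \<in> cball (snd c x) e" "y = chart_inv c u" by (auto simp: C_def)
    then have "u \<in> snd c ` fst c" using e(2) by blast
    then show "y \<in> fst c \<and> snd c y \<in> cball (snd c x) e"
      using u chart_inv_in chart_apply_inv by metis
  next
    assume y: "y \<in> fst c \<and> snd c y \<in> cball (snd c x) e"
    then show "y \<in> C" unfolding C_def by (intro image_eqI[of _ _ "snd c y"]) (simp_all add: chart_inv_apply_atlas[OF A c(1)])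
  qed
  have CS: "y \<in> S" if yc: "y \<in> fst c" "snd c y \<in> cball (snd c x) e" for y
  proof -
    obtain z where z: "z \<in> fst c" "z \<in> S" "snd c y = snd c z" using e(2) yc(2) by blast
    then show ?thesis using yc inj_onD[OF smooth_atlasD(1)[OF A c(1)], of y z] by simp
  qed
  have zero: "\<rho> y = 0" if "y \<notin> C" for y using that \<psi>(3) by (auto simp: \<rho>_def inC)
  \<comment> \<open>The inverse chart is continuous into the atlas topology, which makes C the image
    of a compact ball.\<close>
  have "continuous_map (top_of_set (snd c ` fst c)) (atlas_topology A) (chart_inv c)"
    unfolding continuous_map topspace_atlas_topology
  proof (intro conjI allI impI)
    show "chart_inv c ` topspace (top_of_set (snd c ` fst c)) \<subseteq> points A"
      using points_chart[OF c(1) chart_inv_in] by (simp add: image_subset_iff)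
    fix U assume "openin (atlas_topology A) U"
    then have "open (snd c ` (fst c \<inter> U))" using openin_atlas_topology_mopen[OF A] c by (auto simp: mopen_def)
    then show "openin (top_of_set (snd c ` fst c)) {u \<in> topspace (top_of_set (snd c ` fst c)). chart_inv c u \<in> U}"
      by (simp add: image_chart_Int[OF A c(1)] openin_open_eq[OF smooth_atlasD(2)[OF A c(1)]])
  qed
  moreover have "compactin (top_of_set (snd c ` fst c)) (cball (snd c x) e)"
    using e(2) by (auto simp: compactin_subtopology)
  ultimately have "compactin (atlas_topology A) C" unfolding C_def by (rule image_compactin[rotated])
  moreover have "Hausdorff_space (atlas_topology A)" using M by (simp add: smooth_manifold_def)
  ultimately have "closedin (atlas_topology A) C" by (rule compactin_imp_closedin[rotated])
  then have "openin (atlas_topology A) (points A - C)" by (simp add: closedin_def topspace_atlas_topology)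
  then have "mopen A (points A - C)" by (rule openin_atlas_topology_mopen[OF A])
  then have mC: "mopen A (- C)" by (intro mopen_local[OF A]) (auto intro!: exI[of _ "points A - C"])
  have mV: "mopen A V" unfolding V_def by (rule mopen_chart_preimage[OF A c(1)]) simp
  have VS: "V \<subseteq> S"
  proof
    fix y assume "y \<in> V"
    then have "y \<in> fst c" "dist (snd c x) (snd c y) < e / 2" by (auto simp: V_def)
    then show "y \<in> S" using e(1) by (intro CS) auto
  qed
  have CS': "C \<subseteq> S" using CS inC by blast
  have "msmooth A \<rho>"
  proof (rule msmooth_local[OF A])
    fix y assume y: "y \<in> points A"
    show "\<exists>T. mopen A T \<and> y \<in> T \<and> msmooth (restr A T) \<rho>"
    proof (cases "y \<in> fst c")
      case True
      have "msmooth (restr A {x \<in> fst c. snd c x \<in> UNIV}) \<rho>"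
        by (rule msmooth_in_chart[OF A c(1) open_UNIV \<psi>(1)]) (simp add: \<rho>_def)
      then show ?thesis using True mopen_chart[OF A c(1)] by auto
    next
      case False
      have "msmooth (restr A (- C)) (\<lambda>_. 0::real)" by (rule msmooth_const[OF smooth_atlas_restr[OF A mC]])
      then have "msmooth (restr A (- C)) \<rho>"
        by (rule msmooth_cong[OF smooth_atlas_restr[OF A mC], THEN iffD1, rotated]) (simp add: zero)
      then show ?thesis using mC False by (auto simp: inC)
    qed
  qed
  moreover have "\<forall>y\<in>V. \<rho> y = 1" using \<psi>(2) by (auto simp: V_def \<rho>_def)
  ultimately have "cutoff A S V \<rho>" unfolding cutoff_def using S mV VS CS' mC zero by blast
  moreover have "x \<in> V" using c e by (simp add: V_def)
  ultimately show ?thesis using that by blast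
qed

lemma cutoffD:
  assumes "cutoff A S V \<rho>"
  shows "msmooth A \<rho>" "mopen A S" "mopen A V" "V \<subseteq> S" "y \<in> V \<Longrightarrow> \<rho> y = 1"
  using assms by (auto simp: cutoff_def)

text \<open>S and the complement of C cover the manifold. On the first set the product has smooth
  factors, on the second it is zero whatever the values of F.\<close>

lemma cutoff_msmooth:
  assumes A: "smooth_atlas A" and \<rho>: "cutoff A S V \<rho>" and F: "msmooth (restr A S) F"
  shows "msmooth A (\<lambda>y. \<rho> y *\<^sub>R F y)"
proof (rule msmooth_local[OF A])
  fix x assume x: "x \<in> points A"
  note \<rho>' = cutoffD[OF \<rho>]
  obtain C where C: "C \<subseteq> S" "mopen A (- C)" "\<And>y. y \<notin> C \<Longrightarrow> \<rho> y = 0" using \<rho> by (auto simp: cutoff_def)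
  show "\<exists>T. mopen A T \<and> x \<in> T \<and> msmooth (restr A T) (\<lambda>y. \<rho> y *\<^sub>R F y)"
  proof (cases "x \<in> S")
    case True
    have "msmooth (restr A S) (\<lambda>y. \<rho> y *\<^sub>R F y)"
      by (intro msmooth_scaleR smooth_atlas_restr A \<rho>'(2) F msmooth_restr \<rho>'(1))
    then show ?thesis using True \<rho>' by blast
  next
    case False
    note R = smooth_atlas_restr[OF A C(2)]
    have "msmooth (restr A (- C)) (\<lambda>y. \<rho> y *\<^sub>R F y)"
      by (rule msmooth_cong[OF R, THEN iffD1, OF _ msmooth_const[OF R, of 0]]) (simp add: C)
    then show ?thesis using C False by blast
  qed
qed

lemma cutoff_smooth_along:
  assumes AB: "minclusion A B" and \<rho>: "cutoff A S V \<rho>" and \<xi>: "smooth_along (restr A S) B \<xi>"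
  shows "smooth_along A B (\<lambda>y. \<rho> y *\<^sub>R \<xi> y)"
proof (rule smooth_along_local[OF AB])
  note A = minclusionD(1)[OF AB]
  fix x assume x: "x \<in> points A"
  note \<rho>' = cutoffD[OF \<rho>]
  obtain C where C: "C \<subseteq> S" "mopen A (- C)" "\<And>y. y \<notin> C \<Longrightarrow> \<rho> y = 0" using \<rho> by (auto simp: cutoff_def)
  show "\<exists>T. mopen A T \<and> x \<in> T \<and> smooth_along (restr A T) B (\<lambda>y. \<rho> y *\<^sub>R \<xi> y)"
  proof (cases "x \<in> S")
    case True
    have "smooth_along (restr A S) B (\<lambda>y. \<rho> y *\<^sub>R \<xi> y)"
      by (intro smooth_along_scaleR minclusion_restr AB \<rho>'(2) \<xi> msmooth_restr[OF A] \<rho>'(1))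
    then show ?thesis using True \<rho>' by blast
  next
    case False
    note R = minclusion_restr[OF AB C(2)]
    have "smooth_along (restr A (- C)) B (\<lambda>y. 0)" by (rule smooth_along_zero[OF R])
    then have "smooth_along (restr A (- C)) B (\<lambda>y. \<rho> y *\<^sub>R \<xi> y)"
      by (rule smooth_along_cong[OF R, THEN iffD1, rotated]) (simp add: C)
    then show ?thesis using C False by blast
  qed
qed

subsection \<open>Tangent vectors as derivations\<close>

text \<open>The coordinates of every chart agree locally with members of \<open>F\<close>. Working with such families
  spares constructing bump functions on the normal bundle.\<close>

definition generates :: "('m, 'e::euclidean_space) atlas \<Rightarrow> ('m \<Rightarrow> real) set \<Rightarrow> bool" where
  "generates A F \<longleftrightarrow> (\<forall>f\<in>F. msmooth A f) \<and>
     (\<forall>d\<in>A. \<forall>x\<in>fst d. \<forall>b\<in>Basis. \<exists>f\<in>F. \<exists>S. mopen A S \<and> x \<in> S \<and> (\<forall>y\<in>S \<inter> fst d. f y = snd d y \<bullet> b))"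

lemma mderiv_chart_inner:
  assumes A: "smooth_atlas A" and d: "d \<in> A" "x \<in> fst d" and S: "mopen A S" "x \<in> S"
    and f: "\<And>y. y \<in> S \<inter> fst d \<Longrightarrow> f y = snd d y \<bullet> b"
  shows "mderiv A f x v = mderiv A (snd d) x v \<bullet> b"
proof -
  have "has_mderiv A (\<lambda>y. snd d y \<bullet> b) x (\<lambda>v. mderiv A (snd d) x v \<bullet> b)"
    by (rule has_mderiv_compose[OF A points_chart[OF d] has_mderiv_chart[OF A d]])
      (rule bounded_linear_imp_has_derivative[OF bounded_linear_inner_left])
  then have "has_mderiv A f x (\<lambda>v. mderiv A (snd d) x v \<bullet> b)"
    by (rule has_mderiv_cong[OF A mopen_Int[OF A S(1) mopen_chart[OF A d(1)]], THEN iffD1, rotated -1])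
      (use f S d points_chart[OF d] in auto)
  from has_mderivD[OF this] show ?thesis by simp
qed

text \<open>The components of a vector in a chart are its derivatives of the coordinate functions,
  and near x these are members of F.\<close>

lemma generates_separates:
  assumes A: "smooth_atlas A" and F: "generates A F" and x: "x \<in> points A"
    and eq: "\<And>f. f \<in> F \<Longrightarrow> mderiv A f x v = mderiv A f x w"
  shows "v = w"
proof -
  let ?d = "chart_at A x"
  note d = chart_at[OF x]
  have "mderiv A (snd ?d) x v \<bullet> b = mderiv A (snd ?d) x w \<bullet> b" if b: "b \<in> Basis" for b
  proof -
    obtain f S where f: "f \<in> F" "mopen A S" "x \<in> S" "\<And>y. y \<in> S \<inter> fst ?d \<Longrightarrow> f y = snd ?d y \<bullet> b"
      using F d b unfolding generates_def by metis
    from mderiv_chart_inner[OF A d f(2-4)] eq[OF f(1)] show ?thesis by metis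
  qed
  then have "mderiv A (snd ?d) x v = mderiv A (snd ?d) x w" by (rule euclidean_eqI)
  then show ?thesis using mderiv_coord_vec(2)[OF A d] by metis
qed

text \<open>In a chart, the components of Z are locally derivatives along Z of members of F.\<close>

lemma generates_vector_field:
  assumes A: "smooth_atlas A" and F: "generates A F"
    and Z: "\<And>f. f \<in> F \<Longrightarrow> msmooth A (\<lambda>x. mderiv A f x (Z x))"
  shows "vector_field A Z"
  unfolding vector_field_def smooth_along_iff[OF minclusion_refl[OF A]]
proof
  fix d assume d: "d \<in> A"
  note R = smooth_atlas_restr[OF A mopen_chart[OF A d]]
  show "msmooth (restr A (fst d)) (\<lambda>y. mderiv A (snd d) y (Z y))"
  proof (rule msmooth_componentwise[OF R], rule msmooth_local[OF R])
    fix b x assume b: "b \<in> (Basis::'b set)" and x: "x \<in> points (restr A (fst d))"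
    obtain f S where f: "f \<in> F" "mopen A S" "x \<in> S" "\<And>y. y \<in> S \<inter> fst d \<Longrightarrow> f y = snd d y \<bullet> b"
      using F d b x unfolding generates_def points_restr by (metis IntD2)
    have m: "mopen A (fst d \<inter> S)" by (rule mopen_Int[OF A mopen_chart[OF A d] f(2)])
    have "msmooth (restr A (fst d \<inter> S)) (\<lambda>x. mderiv A f x (Z x))"
      by (rule msmooth_restr[OF A m Z[OF f(1)]])
    then have "msmooth (restr A (fst d \<inter> S)) (\<lambda>x. mderiv A (snd d) x (Z x) \<bullet> b)"
      by (rule msmooth_cong[OF smooth_atlas_restr[OF A m], THEN iffD1, rotated])
        (use mderiv_chart_inner[OF A d _ f(2) _ f(4)] in auto)
    then show "\<exists>T. mopen (restr A (fst d)) T \<and> x \<in> T \<and>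
        msmooth (restr (restr A (fst d)) T) (\<lambda>x. mderiv A (snd d) x (Z x) \<bullet> b)"
      using f(3) mopen_restr[OF A mopen_chart[OF A d] f(2)] by auto
  qed
qed

lemma smooth_manifold_generates:
  assumes M: "smooth_manifold A" shows "generates A {f. msmooth A f}"
  unfolding generates_def
proof (intro conjI ballI)
  note A = smooth_manifold_atlas[OF M]
  fix d x and b :: 'b assume d: "d \<in> A" "x \<in> fst d"
  obtain V \<rho> where \<rho>: "cutoff A (fst d) V \<rho>" "x \<in> V"
    using cutoff_exists[OF M mopen_chart[OF A d(1)] points_chart[OF d] d(2)] by blast
  have "msmooth A (\<lambda>y. \<rho> y *\<^sub>R (snd d y \<bullet> b))"
    by (rule cutoff_msmooth[OF A \<rho>(1) msmooth_inner[OF smooth_atlas_restr[OF A mopen_chart[OF A d(1)]] msmooth_chart_coord[OF A d(1)]]])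
  then show "\<exists>f\<in>{f. msmooth A f}. \<exists>S. mopen A S \<and> x \<in> S \<and> (\<forall>y\<in>S \<inter> fst d. f y = snd d y \<bullet> b)"
    using \<rho>(2) cutoffD[OF \<rho>(1)] by (intro bexI[of _ "\<lambda>y. \<rho> y *\<^sub>R (snd d y \<bullet> b)"] exI[of _ V]) auto
qed simp

text \<open>Both sides are the Hessian on the pair a, c with one argument expanded in
  \<open>Basis\<close>; this is the term that cancels in a commutator.\<close>

lemma second_derivative_symmetric_sum:
  fixes f :: "'a::euclidean_space \<Rightarrow> real"
  assumes S: "open S" "smooth_on S f" "x \<in> S"
  shows "(\<Sum>b\<in>Basis. (c \<bullet> b) * frechet_derivative (\<lambda>y. frechet_derivative f (at y) b) (at x) a) =
    (\<Sum>b\<in>Basis. (a \<bullet> b) * frechet_derivative (\<lambda>y. frechet_derivative f (at y) b) (at x) c)"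
proof -
  let ?H = "\<lambda>b. frechet_derivative (\<lambda>y. frechet_derivative f (at y) b) (at x)"
  have ex: "?H b a = (\<Sum>b'\<in>Basis. (a \<bullet> b') * ?H b b')" for b a
    by (subst frechet_derivative_sum_Basis[OF smooth_on_differentiable[OF smooth_on_frechet[OF S(2)] S(3)]]) simp
  have "(\<Sum>b\<in>Basis. (c \<bullet> b) * ?H b a) = (\<Sum>b\<in>Basis. \<Sum>b'\<in>Basis. (c \<bullet> b) * ((a \<bullet> b') * ?H b b'))"
    by (rule sum.cong[OF refl], subst ex) (rule sum_distrib_left)
  also have "\<dots> = (\<Sum>b'\<in>Basis. \<Sum>b\<in>Basis. (c \<bullet> b) * ((a \<bullet> b') * ?H b b'))" by (rule sum.swap)
  also have "\<dots> = (\<Sum>b'\<in>Basis. \<Sum>b\<in>Basis. (a \<bullet> b') * ((c \<bullet> b) * ?H b' b))"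
    by (rule sum.cong[OF refl], rule sum.cong[OF refl])
      (subst frechet_derivative_symmetric[OF S], rule mult.left_commute)
  also have "\<dots> = (\<Sum>b'\<in>Basis. (a \<bullet> b') * ?H b' c)"
    by (rule sum.cong[OF refl], subst ex) (rule sum_distrib_left[symmetric])
  finally show ?thesis .
qed

text \<open>The product rule for X(Yf) in coordinates: a Hessian term, symmetric in X and Y, and a
  term that differentiates the components \<open>\<eta>\<close> of Y. Only the latter survives in a
  commutator.\<close>

lemma mderiv_iterated_in_chart:
  fixes f :: "'m \<Rightarrow> real" and A :: "('m, 'e::euclidean_space) atlas"
  assumes A: "smooth_atlas A" and X: "vector_field A X" and Y: "vector_field A Y" and d: "d \<in> A" "x \<in> fst d"
    and f: "msmooth A f"
  defines "\<phi> \<equiv> \<lambda>u. f (chart_inv d u)" and "\<eta> \<equiv> \<lambda>u. mderiv A (snd d) (chart_inv d u) (Y (chart_inv d u))"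
    and "a \<equiv> mderiv A (snd d) x (X x)"
  shows "mderiv A (\<lambda>y. mderiv A f y (Y y)) x (X x) =
    (\<Sum>b\<in>Basis. (\<eta> (snd d x) \<bullet> b) * frechet_derivative (\<lambda>u. frechet_derivative \<phi> (at u) b) (at (snd d x)) a) +
    frechet_derivative \<phi> (at (snd d x)) (frechet_derivative \<eta> (at (snd d x)) a)"
proof -
  let ?U = "snd d ` fst d" and ?u = "snd d x"
  have U: "open ?U" "?u \<in> ?U" using smooth_atlasD(2)[OF A d(1)] d by auto
  have s\<phi>: "smooth_on ?U \<phi>" using f d by (simp add: msmooth_def \<phi>_def)
  have s\<eta>: "smooth_on ?U \<eta>"
  proof -
    have "msmooth (restr A (fst d)) (\<lambda>y. mderiv A (snd d) y (Y y))"
      using Y d(1) by (simp add: vector_field_def smooth_along_iff[OF minclusion_refl[OF A]])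
    then have "smooth_on (snd d ` (fst d \<inter> fst d)) \<eta>"
      using d(1) unfolding msmooth_restr_iff[OF A mopen_chart[OF A d(1)]] \<eta>_def by blast
    then show ?thesis by simp
  qed
  have d\<phi>: "((\<lambda>u. frechet_derivative \<phi> (at u) b) has_derivative
      frechet_derivative (\<lambda>u. frechet_derivative \<phi> (at u) b) (at ?u)) (at ?u)" for b
    by (rule has_derivative_frechet[OF smooth_on_differentiable[OF smooth_on_frechet[OF s\<phi>] U(2)]])
  have d\<eta>: "(\<eta> has_derivative frechet_derivative \<eta> (at ?u)) (at ?u)"
    by (rule has_derivative_frechet[OF smooth_on_differentiable[OF s\<eta> U(2)]])
  have d\<phi>u: "\<phi> differentiable (at u)" if "u \<in> ?U" for u by (rule smooth_on_differentiable[OF s\<phi> that])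
  let ?G = "\<lambda>u. \<Sum>b\<in>Basis. (\<eta> u \<bullet> b) * frechet_derivative \<phi> (at u) b"
  have 1: "(?G has_derivative (\<lambda>h. \<Sum>b\<in>Basis. (\<eta> ?u \<bullet> b) *
        frechet_derivative (\<lambda>u. frechet_derivative \<phi> (at u) b) (at ?u) h +
        (frechet_derivative \<eta> (at ?u) h \<bullet> b) * frechet_derivative \<phi> (at ?u) b)) (at ?u)"
    by (intro has_derivative_sum has_derivative_mult has_derivative_inner_left d\<phi> d\<eta>)
  have 2: "mderiv A f (chart_inv d u) (Y (chart_inv d u)) = ?G u" if "u \<in> ?U" for u
    using mderiv_in_chart[OF A d(1) chart_inv_in[OF that] mopen_UNIV[OF A] UNIV_I, of f]
      f frechet_derivative_sum_Basis[OF d\<phi>u[OF that], of "\<eta> u"] by (simp add: \<phi>_def \<eta>_def chart_apply_inv[OF that])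
  have "((\<lambda>u. mderiv A f (chart_inv d u) (Y (chart_inv d u))) has_derivative
      (\<lambda>h. \<Sum>b\<in>Basis. (\<eta> ?u \<bullet> b) *
        frechet_derivative (\<lambda>u. frechet_derivative \<phi> (at u) b) (at ?u) h +
        (frechet_derivative \<eta> (at ?u) h \<bullet> b) * frechet_derivative \<phi> (at ?u) b)) (at ?u)"
    by (rule has_derivative_cong_open[OF U 2, THEN iffD2, OF _ 1])
  note E = fun_cong[OF has_mderivD[OF has_mderiv_in_chart[OF A d, of "\<lambda>y. mderiv A f y (Y y)", OF this]], of "X x"]
  have "(\<Sum>b\<in>Basis. (frechet_derivative \<eta> (at ?u) a \<bullet> b) * frechet_derivative \<phi> (at ?u) b) =
      frechet_derivative \<phi> (at ?u) (frechet_derivative \<eta> (at ?u) a)"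
    using frechet_derivative_sum_Basis[OF d\<phi>u[OF U(2)], of "frechet_derivative \<eta> (at ?u) a"] by simp
  then show ?thesis unfolding E sum.distrib a_def[symmetric] by simp
qed

text \<open>The witness has the classical components: the derivative along X of the components of Y
  minus the derivative along Y of those of X.\<close>

lemma commutator_exists:
  fixes A :: "('a, 'b::euclidean_space) atlas"
  assumes A: "smooth_atlas A" and X: "vector_field A X" and Y: "vector_field A Y" and x: "x \<in> points A"
  shows "\<exists>w. \<forall>f::_ \<Rightarrow> real. msmooth A f \<longrightarrow> mderiv A f x w =
    mderiv A (\<lambda>y. mderiv A f y (Y y)) x (X x) - mderiv A (\<lambda>y. mderiv A f y (X y)) x (Y x)"
proof (intro exI allI impI)
  define d where "d = chart_at A x"
  have d: "d \<in> A" "x \<in> fst d" using chart_at[OF x] by (auto simp: d_def)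
  let ?u = "snd d x"
  let ?U = "snd d ` fst d"
  have U: "open ?U" "?u \<in> ?U" using smooth_atlasD(2)[OF A d(1)] d by auto
  define a where "a = (\<lambda>X u. mderiv A (snd d) (chart_inv d u) (X (chart_inv d u)))"
  have a: "a X ?u = mderiv A (snd d) x (X x)" for X using A d by (simp add: a_def)
  fix f :: "'a \<Rightarrow> real" assume f: "msmooth A f"
  let ?w = "frechet_derivative (a Y) (at ?u) (a X ?u) - frechet_derivative (a X) (at ?u) (a Y ?u)"
  have sm: "smooth_on ?U (\<lambda>u. f (chart_inv d u))" using f d by (simp add: msmooth_def)
  have lin: "linear (frechet_derivative (\<lambda>u. f (chart_inv d u)) (at ?u))"
    by (rule linear_frechet_derivative[OF smooth_on_differentiable[OF sm U(2)]])
  have "mderiv A f x (coord_vec A d ?w x) = frechet_derivative (\<lambda>u. f (chart_inv d u)) (at ?u) ?w"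
    using mderiv_in_chart[OF A d mopen_UNIV[OF A] UNIV_I, of f] f by (simp add: mderiv_coord_vec(1)[OF A d])
  then show "mderiv A f x (coord_vec A d ?w x) =
      mderiv A (\<lambda>y. mderiv A f y (Y y)) x (X x) - mderiv A (\<lambda>y. mderiv A f y (X y)) x (Y x)"
    unfolding mderiv_iterated_in_chart[OF A X Y d f] mderiv_iterated_in_chart[OF A Y X d f]
    using second_derivative_symmetric_sum[OF U(1) sm U(2), of "a X ?u" "a Y ?u"]
    by (simp add: linear_diff[OF lin] a_def a[unfolded a_def])
qed

text \<open>Existence of the commutator vector and separation by F make the definite description
  denote. A generating family in place of bump functions lets the lemma apply to the normal
  bundle.\<close>

lemma lie_bracket_eq:
  fixes A :: "('a, 'b::euclidean_space) atlas" and f :: "'a \<Rightarrow> real"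
  assumes A: "smooth_atlas A" and F: "generates A F" and X: "vector_field A X" and Y: "vector_field A Y"
    and x: "x \<in> points A" and f: "msmooth A f"
  shows "mderiv A f x (lie_bracket A X Y x) =
    mderiv A (\<lambda>y. mderiv A f y (Y y)) x (X x) - mderiv A (\<lambda>y. mderiv A f y (X y)) x (Y x)"
proof -
  obtain w where w: "\<forall>f::'a \<Rightarrow> real. msmooth A f \<longrightarrow> mderiv A f x w =
    mderiv A (\<lambda>y. mderiv A f y (Y y)) x (X x) - mderiv A (\<lambda>y. mderiv A f y (X y)) x (Y x)"
    using commutator_exists[OF A X Y x] by blast
  have "lie_bracket A X Y x = w"
    unfolding lie_bracket_def smooth_fun_iff dir_deriv_eq
  proof (rule the_equality)
    fix w' assume w': "\<forall>f::'a \<Rightarrow> real. msmooth A f \<longrightarrow> mderiv A f x w' =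
      mderiv A (\<lambda>y. mderiv A f y (Y y)) x (X x) - mderiv A (\<lambda>y. mderiv A f y (X y)) x (Y x)"
    show "w' = w" by (rule generates_separates[OF A F x]) (use w w' F in \<open>simp add: generates_def\<close>)
  qed (rule w)
  then show ?thesis using w f by simp
qed

text \<open>Brackets on the normal bundle are found this way: a guess need only be checked on
  F.\<close>

lemma lie_bracket_unique:
  fixes A :: "('a, 'b::euclidean_space) atlas" and F :: "('a \<Rightarrow> real) set"
  assumes A: "smooth_atlas A" and F: "generates A F" and X: "vector_field A X" and Y: "vector_field A Y"
    and x: "x \<in> points A"
    and w: "\<And>f. f \<in> F \<Longrightarrow> mderiv A f x w =
      mderiv A (\<lambda>y. mderiv A f y (Y y)) x (X x) - mderiv A (\<lambda>y. mderiv A f y (X y)) x (Y x)"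
  shows "lie_bracket A X Y x = w"
  by (rule generates_separates[OF A F x]) (use lie_bracket_eq[OF A F X Y x] w F in \<open>simp add: generates_def\<close>)

lemma vector_field_mderiv:
  fixes f :: "'m \<Rightarrow> real"
  shows
  "smooth_atlas A \<Longrightarrow> vector_field A X \<Longrightarrow> msmooth A f \<Longrightarrow> msmooth A (\<lambda>x. mderiv A f x (X x))"
  using msmooth_mderiv_UNIV[OF minclusion_refl] by (simp add: vector_field_def)

lemma vector_field_lie_bracket:
  assumes A: "smooth_atlas A" and F: "generates A F" and X: "vector_field A X" and Y: "vector_field A Y"
  shows "vector_field A (lie_bracket A X Y)"
proof (rule generates_vector_field[OF A F])
  fix f assume "f \<in> F"
  then have f: "msmooth A f" using F by (simp add: generates_def)
  have "msmooth A (\<lambda>x. mderiv A (\<lambda>y. mderiv A f y (Y y)) x (X x) - mderiv A (\<lambda>y. mderiv A f y (X y)) x (Y x))"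
    by (intro msmooth_diff A vector_field_mderiv X Y f)
  then show "msmooth A (\<lambda>x. mderiv A f x (lie_bracket A X Y x))"
    by (rule msmooth_cong[OF A, THEN iffD1, rotated]) (simp add: lie_bracket_eq[OF A F X Y _ f])
qed

subsection \<open>Extension of vectors and tensoriality\<close>

text \<open>A field with constant components in a chart, cut off near x.\<close>

lemma smooth_along_extension:
  fixes v :: "'f::euclidean_space"
  assumes M: "smooth_manifold A" and AB: "minclusion A B" and x: "x \<in> points A"
  obtains \<xi> where "smooth_along A B \<xi>" "\<xi> x = v"
proof -
  note AB' = minclusionD[OF AB]
  let ?d = "chart_at B x"
  note d = minclusion_chart_at[OF AB x]
  obtain V \<rho> where \<rho>: "cutoff A (fst ?d) V \<rho>" "x \<in> V"
    using cutoff_exists[OF M AB'(4)[OF d(1)] x d(2)] by blast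
  show ?thesis
  proof (rule that)
    show "smooth_along A B (\<lambda>y. \<rho> y *\<^sub>R coord_vec B ?d (mderiv B (snd ?d) x v) y)"
      by (rule cutoff_smooth_along[OF AB \<rho>(1) smooth_along_coord_vec[OF AB d(1)]])
    show "\<rho> x *\<^sub>R coord_vec B ?d (mderiv B (snd ?d) x v) x = v"
      using cutoffD(5)[OF \<rho>] mderiv_coord_vec(2)[OF AB'(2) d] by simp
  qed
qed

text \<open>With a cutoff \<open>\<rho>\<close>, the section \<open>\<rho>\<^sup>2 \<xi>\<close> is a combination of global sections whose
  coefficients vanish at \<open>x\<close>.\<close>

lemma tensorial_zero:
  fixes T :: "('m \<Rightarrow> 'f::euclidean_space) \<Rightarrow> 'r::real_vector"
  assumes M: "smooth_manifold A" and AB: "minclusion A B" and x: "x \<in> points A"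
    and add: "\<And>\<xi> \<eta>. smooth_along A B \<xi> \<Longrightarrow> smooth_along A B \<eta> \<Longrightarrow> T (\<lambda>y. \<xi> y + \<eta> y) = T \<xi> + T \<eta>"
    and scale: "\<And>f \<xi>. msmooth A f \<Longrightarrow> smooth_along A B \<xi> \<Longrightarrow> T (\<lambda>y. f y *\<^sub>R \<xi> y) = f x *\<^sub>R T \<xi>"
    and \<xi>: "smooth_along A B \<xi>" "\<xi> x = 0"
  shows "T \<xi> = 0"
proof -
  note AB' = minclusionD[OF AB]
  note A = AB'(1)
  let ?d = "chart_at B x"
  note d = minclusion_chart_at[OF AB x]
  obtain V \<rho> where \<rho>: "cutoff A (fst ?d) V \<rho>" "x \<in> V"
    using cutoff_exists[OF M AB'(4)[OF d(1)] x d(2)] by blast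
  note \<rho>' = cutoffD[OF \<rho>(1)]
  have \<rho>x: "\<rho> x = 1" using \<rho>'(5) \<rho>(2) by simp
  have \<rho>0: "\<rho> y = 0" if "y \<notin> fst ?d" for y using \<rho>(1) that by (auto simp: cutoff_def)
  \<comment> \<open>One factor \<open>\<rho>\<close> makes the coordinate field global, the other
    its coefficient.\<close>
  let ?E = "\<lambda>b y. \<rho> y *\<^sub>R coord_vec B ?d b y"
  let ?f = "\<lambda>b y. \<rho> y *\<^sub>R (mderiv B (snd ?d) y (\<xi> y) \<bullet> b)"
  have E: "smooth_along A B (?E b)" for b
    by (rule cutoff_smooth_along[OF AB \<rho>(1) smooth_along_coord_vec[OF AB d(1)]])
  have f: "msmooth A (?f b)" for b
    using \<xi>(1) d(1) by (intro cutoff_msmooth[OF A \<rho>(1)] msmooth_inner[OF minclusion_chart_restr[OF AB d(1)]])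
      (simp add: smooth_along_iff[OF AB])
  define I where "I y = (if y \<in> points A then 1 else 0 :: real)" for y
  have I: "msmooth A I"
    by (rule msmooth_cong[OF A, THEN iffD1, OF _ msmooth_const[OF A, of 1]]) (simp add: I_def)
  have zero: "T (\<lambda>y. 0) = 0"
    using scale[OF msmooth_const[OF A, of 0] \<xi>(1)] by simp
  \<comment> \<open>Smoothness is carried along in the induction because T is additive only on
    smooth sections.\<close>
  have sum: "smooth_along A B (\<lambda>y. \<Sum>b\<in>C. ?f b y *\<^sub>R ?E b y) \<and>
      T (\<lambda>y. \<Sum>b\<in>C. ?f b y *\<^sub>R ?E b y) = (\<Sum>b\<in>C. ?f b x *\<^sub>R T (?E b))" for C
  proof (induction C rule: infinite_finite_induct)
    case (insert b C)
    have 1: "smooth_along A B (\<lambda>y. ?f b y *\<^sub>R ?E b y)" by (rule smooth_along_scaleR[OF AB f E])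
    have "T (\<lambda>y. ?f b y *\<^sub>R ?E b y) = ?f b x *\<^sub>R T (?E b)" by (rule scale[OF f E])
    then show ?case using insert add[OF 1] smooth_along_add[OF AB 1] by simp
  qed (simp_all add: zero smooth_along_zero[OF AB])
  have eq: "(I y * (\<rho> y * \<rho> y)) *\<^sub>R \<xi> y = I y *\<^sub>R (\<Sum>b\<in>Basis. ?f b y *\<^sub>R ?E b y)" for y
  proof (cases "y \<in> fst ?d")
    case True
    have "(\<Sum>b\<in>Basis. ?f b y *\<^sub>R ?E b y) =
        (\<rho> y * \<rho> y) *\<^sub>R (\<Sum>b\<in>Basis. (mderiv B (snd ?d) y (\<xi> y) \<bullet> b) *\<^sub>R coord_vec B ?d b y)"
      by (simp add: scaleR_sum_right mult.assoc mult.commute)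
    also have "\<dots> = (\<rho> y * \<rho> y) *\<^sub>R \<xi> y" using coord_vec_expand[OF AB'(2) d(1) True, of "\<xi> y"] by simp
    finally show ?thesis by simp
  qed (simp add: \<rho>0)
  have "T \<xi> = T (\<lambda>y. (I y * (\<rho> y * \<rho> y)) *\<^sub>R \<xi> y)"
    using scale[OF msmooth_mult[OF A I msmooth_mult[OF A \<rho>'(1) \<rho>'(1)]] \<xi>(1)] x by (simp add: \<rho>x I_def)
  also have "\<dots> = T (\<lambda>y. I y *\<^sub>R (\<Sum>b\<in>Basis. ?f b y *\<^sub>R ?E b y))" by (simp only: eq)
  also have "\<dots> = (\<Sum>b\<in>Basis. ?f b x *\<^sub>R T (?E b))"
    using scale[OF I conjunct1[OF sum]] sum x by (simp add: I_def)
  also have "\<dots> = 0" using linear_0[OF linear_mderiv_chart[OF AB'(2) d]] by (simp add: \<xi>(2))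
  finally show ?thesis .
qed

text \<open>The difference of the sections vanishes at x. It is formed with the constant function
  -1, since T respects sums and multiples by functions.\<close>

lemma tensorial:
  fixes T :: "('m \<Rightarrow> 'f::euclidean_space) \<Rightarrow> 'r::real_vector"
  assumes M: "smooth_manifold A" and AB: "minclusion A B" and x: "x \<in> points A"
    and add: "\<And>\<xi> \<eta>. smooth_along A B \<xi> \<Longrightarrow> smooth_along A B \<eta> \<Longrightarrow> T (\<lambda>y. \<xi> y + \<eta> y) = T \<xi> + T \<eta>"
    and scale: "\<And>f \<xi>. msmooth A f \<Longrightarrow> smooth_along A B \<xi> \<Longrightarrow> T (\<lambda>y. f y *\<^sub>R \<xi> y) = f x *\<^sub>R T \<xi>"
    and \<xi>: "smooth_along A B \<xi>" "smooth_along A B \<eta>" "\<xi> x = \<eta> x"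
  shows "T \<xi> = T \<eta>"
proof -
  note c = msmooth_const[OF minclusionD(1)[OF AB], of "-1::real"]
  note m = smooth_along_scaleR[OF AB c \<xi>(2)]
  have "T (\<lambda>y. \<xi> y + (- 1) *\<^sub>R \<eta> y) = 0"
    by (rule tensorial_zero[where T = T, OF M AB x add scale smooth_along_add[OF AB \<xi>(1) m]]) (simp_all add: \<xi>(3))
  then show ?thesis using add[OF \<xi>(1) m] scale[OF c \<xi>(2)] by simp
qed

section \<open>Connections along a submanifold\<close>

lemma connection_alongD:
  assumes "connection_along A B D" "vector_field A X" "smooth_along A B \<xi>"
  shows "smooth_along A B (D X \<xi>)"
    "vector_field A Y \<Longrightarrow> x \<in> points A \<Longrightarrow> D (\<lambda>y. X y + Y y) \<xi> x = D X \<xi> x + D Y \<xi> x"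
    "msmooth A f \<Longrightarrow> x \<in> points A \<Longrightarrow> D (\<lambda>y. f y *\<^sub>R X y) \<xi> x = f x *\<^sub>R D X \<xi> x"
    "smooth_along A B \<eta> \<Longrightarrow> x \<in> points A \<Longrightarrow> D X (\<lambda>y. \<xi> y + \<eta> y) x = D X \<xi> x + D X \<eta> x"
    "msmooth A f \<Longrightarrow> x \<in> points A \<Longrightarrow>
      D X (\<lambda>y. f y *\<^sub>R \<xi> y) x = mderiv A f x (X x) *\<^sub>R \<xi> x + f x *\<^sub>R D X \<xi> x"
proof -
  note D = assms(1)[unfolded connection_along_def smooth_fun_iff dir_deriv_eq]
  note D1 = conjunct1[OF D] and D2 = conjunct2[OF D]
  note D3 = conjunct1[OF D2] and D4 = conjunct2[OF D2]
  note D5 = conjunct1[OF D4] and D6 = conjunct2[OF D4]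
  note D7 = conjunct1[OF D6] and D8 = conjunct2[OF D6]
  show "smooth_along A B (D X \<xi>)" using D1 assms(2,3) by simp
  show "vector_field A Y \<Longrightarrow> x \<in> points A \<Longrightarrow> D (\<lambda>y. X y + Y y) \<xi> x = D X \<xi> x + D Y \<xi> x"
    using D3 assms(2,3) by simp
  show "msmooth A f \<Longrightarrow> x \<in> points A \<Longrightarrow> D (\<lambda>y. f y *\<^sub>R X y) \<xi> x = f x *\<^sub>R D X \<xi> x"
    using D5 assms(2,3) by simp
  show "smooth_along A B \<eta> \<Longrightarrow> x \<in> points A \<Longrightarrow> D X (\<lambda>y. \<xi> y + \<eta> y) x = D X \<xi> x + D X \<eta> x"
    using D7 assms(2,3) by simp
  show "msmooth A f \<Longrightarrow> x \<in> points A \<Longrightarrow>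
      D X (\<lambda>y. f y *\<^sub>R \<xi> y) x = mderiv A f x (X x) *\<^sub>R \<xi> x + f x *\<^sub>R D X \<xi> x"
    using D8 assms(2,3) by simp
qed

lemma connection_along_direction:
  assumes M: "smooth_manifold A" and D: "connection_along A B D"
    and X: "vector_field A X" "vector_field A Y" "X x = Y x" and \<xi>: "smooth_along A B \<xi>" and x: "x \<in> points A"
  shows "D X \<xi> x = D Y \<xi> x"
  by (rule tensorial[OF M minclusion_refl[OF smooth_manifold_atlas[OF M]] x, where T = "\<lambda>X. D X \<xi> x"])
    (use X connection_alongD[OF D _ \<xi>] x in \<open>auto simp: vector_field_def\<close>)

text \<open>Sections are total functions, whose values off \<open>points A\<close> are junk; they are removed by the Leibniz
  rule for the indicator function of \<open>points A\<close>, which is smooth.\<close>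

lemma connection_along_cong:
  assumes AB: "minclusion A B" and D: "connection_along A B D" and X: "vector_field A X"
    and \<xi>: "smooth_along A B \<xi>" "\<And>y. y \<in> points A \<Longrightarrow> \<xi> y = \<eta> y" and x: "x \<in> points A"
  shows "D X \<xi> x = D X \<eta> x"
proof -
  note A = minclusionD(1)[OF AB]
  define I where "I y = (if y \<in> points A then 1 else 0 :: real)" for y
  have I: "msmooth A I"
    by (rule msmooth_cong[OF A, THEN iffD1, OF _ msmooth_const[OF A, of 1]]) (simp add: I_def)
  have dI: "mderiv A I x v = 0" for v
    using mderiv_cong[OF A mopen_UNIV[OF A] UNIV_I x, of I "\<lambda>y. 1"] has_mderivD[OF has_mderiv_const[of A "1::real" x]]
    by (simp add: I_def)
  have \<eta>: "smooth_along A B \<eta>" by (rule smooth_along_cong[OF AB, THEN iffD1, OF \<xi>(2,1)])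
  have "(\<lambda>y. I y *\<^sub>R \<xi> y) = (\<lambda>y. I y *\<^sub>R \<eta> y)" by (simp add: fun_eq_iff I_def \<xi>(2))
  then show ?thesis
    using connection_alongD(5)[OF D X \<xi>(1) I x] connection_alongD(5)[OF D X \<eta> I x] x by (simp add: dI I_def)
qed

lemma smooth_along_vector_field:
  assumes AB: "minclusion A B" and Z: "vector_field B Z" shows "smooth_along A B Z"
  unfolding smooth_along_iff[OF AB]
proof
  note B = minclusionD(2)[OF AB]
  fix d assume d: "d \<in> B"
  then have "msmooth (restr B (fst d)) (\<lambda>y. mderiv B (snd d) y (Z y))"
    using Z by (simp add: vector_field_def smooth_along_iff[OF minclusion_refl[OF B]])
  then show "msmooth (restr A (fst d)) (\<lambda>y. mderiv B (snd d) y (Z y))"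
    by (rule minclusion_msmooth[OF AB mopen_chart[OF B d]])
qed

lemma mderiv_metric_add_left:
  assumes AB: "minclusion A B" and g: "riemannian_metric B g" and x: "x \<in> points A"
    and s: "smooth_along A B \<xi>" "smooth_along A B \<eta>" "smooth_along A B \<zeta>"
  shows "mderiv A (\<lambda>y. g y (\<xi> y + \<eta> y) (\<zeta> y)) x v =
    mderiv A (\<lambda>y. g y (\<xi> y) (\<zeta> y)) x v + mderiv A (\<lambda>y. g y (\<eta> y) (\<zeta> y)) x v"
proof -
  note A = minclusionD(1)[OF AB]
  have "mderiv A (\<lambda>y. g y (\<xi> y + \<eta> y) (\<zeta> y)) x = mderiv A (\<lambda>y. g y (\<xi> y) (\<zeta> y) + g y (\<eta> y) (\<zeta> y)) x"
    by (rule mderiv_cong[OF A mopen_UNIV[OF A] UNIV_I x])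
      (use riemannian_metricD(1)[OF g minclusionD(3)[OF AB]] in \<open>simp add: bilinear_ladd\<close>)
  also have "\<dots> = (\<lambda>v. mderiv A (\<lambda>y. g y (\<xi> y) (\<zeta> y)) x v + mderiv A (\<lambda>y. g y (\<eta> y) (\<zeta> y)) x v)"
    by (intro has_mderivD has_mderiv_add msmooth_has_mderiv_UNIV A x msmooth_metric[OF AB g] s)
  finally show ?thesis by simp
qed

lemma mderiv_metric_scaleR_left:
  assumes AB: "minclusion A B" and g: "riemannian_metric B g" and x: "x \<in> points A"
    and s: "msmooth A f" "smooth_along A B \<xi>" "smooth_along A B \<zeta>"
  shows "mderiv A (\<lambda>y. g y (f y *\<^sub>R \<xi> y) (\<zeta> y)) x v =
    mderiv A f x v * g x (\<xi> x) (\<zeta> x) + f x * mderiv A (\<lambda>y. g y (\<xi> y) (\<zeta> y)) x v"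
proof -
  note A = minclusionD(1)[OF AB]
  have "mderiv A (\<lambda>y. g y (f y *\<^sub>R \<xi> y) (\<zeta> y)) x = mderiv A (\<lambda>y. f y * g y (\<xi> y) (\<zeta> y)) x"
    by (rule mderiv_cong[OF A mopen_UNIV[OF A] UNIV_I x])
      (use riemannian_metricD(1)[OF g minclusionD(3)[OF AB]] in \<open>simp add: bilinear_lmul\<close>)
  also have "\<dots> = (\<lambda>v. f x * mderiv A (\<lambda>y. g y (\<xi> y) (\<zeta> y)) x v + mderiv A f x v * g x (\<xi> x) (\<zeta> x))"
    by (intro has_mderivD has_mderiv_mult msmooth_has_mderiv_UNIV A x msmooth_metric[OF AB g] s)
  finally show ?thesis by simp
qed

text \<open>A pullback connection is tied to the ambient one only on restrictions of fields of M.
  The defect \<open>T\<close> of metric compatibility is tensorial in both sections, so each may be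
  replaced by the restriction of a field with the same value at x, and there compatibility on M
  applies.\<close>

lemma pullback_connection_metric:
  assumes M: "smooth_manifold M" and g: "riemannian_metric M g" and L: "submanifold L M"
    and D: "levi_civita M g D" and D': "pullback_connection M L D D'"
    and X: "vector_field L X" and x: "x \<in> points L"
    and \<xi>: "smooth_along L M \<xi>" and \<zeta>: "smooth_along L M \<zeta>"
  shows "mderiv L (\<lambda>y. g y (\<xi> y) (\<zeta> y)) x (X x) = g x (D' X \<xi> x) (\<zeta> x) + g x (\<xi> x) (D' X \<zeta> x)"
proof -
  note LM = submanifold_minclusion[OF M L]
  note LM' = minclusionD[OF LM]
  have Lm: "smooth_manifold L" using L by (simp add: submanifold_def)
  have D'c: "connection_along L M D'" using D' by (simp add: pullback_connection_def)
  note c = connection_alongD[OF D'c X]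
  note gx = riemannian_metricD[OF g LM'(3)[OF x]]
  define T where "T \<xi> \<zeta> = mderiv L (\<lambda>y. g y (\<xi> y) (\<zeta> y)) x (X x) - g x (D' X \<xi> x) (\<zeta> x) - g x (\<xi> x) (D' X \<zeta> x)" for \<xi> \<zeta>
  have sym: "T \<xi> \<zeta> = T \<zeta> \<xi>" for \<xi> \<zeta>
    using mderiv_cong[OF LM'(1) mopen_UNIV[OF LM'(1)] UNIV_I x, of "\<lambda>y. g y (\<xi> y) (\<zeta> y)" "\<lambda>y. g y (\<zeta> y) (\<xi> y)"]
      riemannian_metricD(2)[OF g LM'(3)] x by (simp add: T_def)
  have tens: "T \<xi> \<zeta> = T \<xi>' \<zeta>"
    if \<zeta>: "smooth_along L M \<zeta>" and "smooth_along L M \<xi>" "smooth_along L M \<xi>'" "\<xi> x = \<xi>' x" for \<xi> \<xi>' \<zeta>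
  proof (rule tensorial[OF Lm LM x, where T = "\<lambda>\<xi>. T \<xi> \<zeta>", OF _ _ that(2-4)])
    show "T (\<lambda>y. \<xi> y + \<eta> y) \<zeta> = T \<xi> \<zeta> + T \<eta> \<zeta>" if "smooth_along L M \<xi>" "smooth_along L M \<eta>" for \<xi> \<eta>
      using c(4)[OF that x] mderiv_metric_add_left[OF LM g x that \<zeta>]
      by (simp add: T_def bilinear_ladd[OF gx(1)])
    show "T (\<lambda>y. f y *\<^sub>R \<xi> y) \<zeta> = f x *\<^sub>R T \<xi> \<zeta>" if "msmooth L f" "smooth_along L M \<xi>" for f \<xi>
      using c(5)[OF that(2,1) x] mderiv_metric_scaleR_left[OF LM g x that \<zeta>]
      by (simp add: T_def bilinear_ladd[OF gx(1)] bilinear_lmul[OF gx(1)] algebra_simps)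
  qed
  note ext = smooth_along_extension[OF M minclusion_refl[OF LM'(2)] LM'(3)[OF x]]
  obtain Z where Z: "vector_field M Z" "Z x = \<xi> x" using ext unfolding vector_field_def by blast
  obtain Z' where Z': "vector_field M Z'" "Z' x = \<zeta> x" using ext unfolding vector_field_def by blast
  \<comment> \<open>W has to match the image of X at x only, because the two connections are
    compared point by point.\<close>
  obtain W where W: "vector_field M W" "W x = incl_deriv L M x (X x)" using ext unfolding vector_field_def by blast
  note Zs = smooth_along_vector_field[OF LM Z(1)] and Zs' = smooth_along_vector_field[OF LM Z'(1)]
  have sm: "msmooth M (\<lambda>y. g y (Z y) (Z' y))"
    using msmooth_metric[OF minclusion_refl[OF LM'(2)] g] Z Z' by (simp add: vector_field_def)
  have "mderiv L (\<lambda>y. g y (Z y) (Z' y)) x (X x) = mderiv M (\<lambda>y. g y (Z y) (Z' y)) x (W x)"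
    using mderiv_incl_deriv[OF LM x mopen_UNIV[OF LM'(2)] UNIV_I, of "\<lambda>y. g y (Z y) (Z' y)" "X x"] sm by (simp add: W)
  also have "\<dots> = g x (D W Z x) (Z' x) + g x (Z x) (D W Z' x)"
    using D W Z Z' LM'(3)[OF x] unfolding levi_civita_def dir_deriv_eq by blast
  also have "\<dots> = g x (D' X Z x) (Z' x) + g x (Z x) (D' X Z' x)"
    using D' X W Z Z' x unfolding pullback_connection_def by metis
  finally have "T Z Z' = 0" by (simp add: T_def)
  moreover have "T \<xi> \<zeta> = T Z \<zeta>" by (rule tens[OF \<zeta> \<xi> Zs]) (simp add: Z)
  moreover have "T Z \<zeta> = T Z Z'" unfolding sym[of Z] by (rule tens[OF Zs \<zeta> Zs']) (simp add: Z')
  ultimately show ?thesis by (simp add: T_def)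
qed

subsection \<open>Dual frames and the normal projection\<close>

text \<open>The dual frame inside the span of e is obtained by inverting the Gram operator, which is
  injective because g is positive definite and \<open>e x\<close> is injective.\<close>

lemma dual_frame:
  fixes e :: "'m \<Rightarrow> 'k::euclidean_space \<Rightarrow> 'f::euclidean_space"
  assumes AB: "minclusion A B" and g: "riemannian_metric B g"
    and e: "\<And>t. smooth_along A B (\<lambda>x. e x t)"
      "\<And>x. x \<in> points A \<Longrightarrow> linear (e x)" "\<And>x. x \<in> points A \<Longrightarrow> inj (e x)"
  obtains \<epsilon> :: "'m \<Rightarrow> 'k \<Rightarrow> 'f" where "\<And>s. smooth_along A B (\<lambda>x. \<epsilon> x s)"
    "\<And>x s. x \<in> points A \<Longrightarrow> \<epsilon> x s \<in> range (e x)"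
    "\<And>x s t. x \<in> points A \<Longrightarrow> g x (e x t) (\<epsilon> x s) = t \<bullet> s"
proof -
  note AB' = minclusionD[OF AB]
  \<comment> \<open>The Gram operator, read in the Euclidean structure of the parameter space:
    \<open>G x t \<bullet> s = g x (e x t) (e x s)\<close>.\<close>
  define G where "G x t = (\<Sum>b\<in>Basis. g x (e x t) (e x b) *\<^sub>R b)" for x t
  have exp: "e x t = (\<Sum>b\<in>Basis. (t \<bullet> b) *\<^sub>R e x b)" if "x \<in> points A" for x t
    by (rule linear_sum_Basis[OF e(2)[OF that]])
  have bl: "bilinear (g x)" if "x \<in> points A" for x using riemannian_metricD(1)[OF g AB'(3)[OF that]] .
  have Gin: "G x t \<bullet> s = g x (e x t) (e x s)" if "x \<in> points A" for x t s
  proof -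
    have "g x (e x t) (e x s) = (\<Sum>b\<in>Basis. (s \<bullet> b) * g x (e x t) (e x b))"
      using bilinear_def[of "g x"] bl[OF that] by (subst exp[OF that, of s]) (simp add: linear_sum linear_scale)
    then show ?thesis by (simp add: G_def inner_sum_left inner_commute[of s] mult.commute)
  qed
  have Glin: "linear (G x)" if x: "x \<in> points A" for x
    by (rule linearI; rule vector_eq_rdot[THEN iffD1]; intro allI)
      (simp_all add: Gin[OF x] inner_add_left linear_add[OF e(2)[OF x]] linear_scale[OF e(2)[OF x]]
        bilinear_ladd[OF bl[OF x]] bilinear_lmul[OF bl[OF x]])
  have Ginj: "inj (G x)" if x: "x \<in> points A" for x
    unfolding linear_injective_0[OF Glin[OF x]]
  proof (intro allI impI)
    fix t assume "G x t = 0"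
    then have "g x (e x t) (e x t) = 0" using Gin[OF x, of t t] by simp
    then have "e x t = 0" using riemannian_metricD(3)[OF g AB'(3)[OF x]] by fastforce
    then show "t = 0" using e(3)[OF x] linear_injective_0[OF e(2)[OF x]] by blast
  qed
  have Ginv: "G x (inv (G x) s) = s" if x: "x \<in> points A" for x s
    using linear_injective_imp_surjective[OF Glin[OF x] Ginj[OF x] refl] by (rule surj_f_inv_f)
  have Gsm: "msmooth A (\<lambda>x. inv (G x) s)" for s
    unfolding msmooth_def
  proof
    fix c assume c: "c \<in> A"
    have p: "chart_inv c u \<in> points A" if "u \<in> snd c ` fst c" for u
      using points_chart[OF c chart_inv_in[OF that]] .
    have "msmooth A (\<lambda>x. G x t)" for t
      unfolding G_def by (intro msmooth_sum msmooth_scaleR msmooth_const AB'(1) msmooth_metric[OF AB g] e(1))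
    then have "smooth_on (snd c ` fst c) (\<lambda>u. G (chart_inv c u) t)" for t using c by (simp add: msmooth_def)
    then show "smooth_on (snd c ` fst c) (\<lambda>u. inv (G (chart_inv c u)) s)"
      by (intro smooth_linear_inverse[OF smooth_atlasD(2)[OF AB'(1) c] Glin Ginj] p)
  qed
  \<comment> \<open>As a sum this is smooth termwise; on \<open>points A\<close> it equals
    \<open>e x (inv (G x) s)\<close> and so lies in the span of the frame.\<close>
  define \<epsilon> where "\<epsilon> x s = (\<Sum>b\<in>Basis. (inv (G x) s \<bullet> b) *\<^sub>R e x b)" for x s
  have \<epsilon>: "\<epsilon> x s = e x (inv (G x) s)" if "x \<in> points A" for x s by (simp add: \<epsilon>_def exp[OF that, of "inv (G x) s"])
  have "smooth_along A B (\<lambda>x. \<Sum>b\<in>C. (inv (G x) s \<bullet> b) *\<^sub>R e x b)" for s C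
    by (induction C rule: infinite_finite_induct)
      (simp_all add: smooth_along_zero[OF AB] smooth_along_add[OF AB] smooth_along_scaleR[OF AB] msmooth_inner[OF AB'(1) Gsm] e(1))
  then have 1: "smooth_along A B (\<lambda>x. \<epsilon> x s)" for s by (simp add: \<epsilon>_def)
  have 2: "g x (e x t) (\<epsilon> x s) = t \<bullet> s" if x: "x \<in> points A" for x s t
    using Gin[OF x, of "inv (G x) s" t] riemannian_metricD(2)[OF g AB'(3)[OF x]]
    by (simp add: \<epsilon>[OF x] Ginv[OF x] inner_commute)
  show ?thesis by (rule that[OF 1 _ 2]) (simp_all add: \<epsilon>)
qed

lemma smooth_along_incl_deriv_restr:
  assumes AB: "minclusion A B" and S: "mopen A S" and X: "smooth_along (restr A S) A X"
  shows "smooth_along (restr A S) B (\<lambda>x. incl_deriv A B x (X x))"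
  unfolding smooth_along_restr_iff[OF AB S]
proof
  note AB' = minclusionD[OF AB]
  note AA = minclusion_refl[OF AB'(1)]
  fix d assume d: "d \<in> B"
  have m: "mopen A (S \<inter> fst d)" by (rule mopen_Int[OF AB'(1) S AB'(4)[OF d]])
  have "smooth_along (restr A (S \<inter> fst d)) A X" by (rule smooth_along_subset[OF AA S m _ X]) auto
  then have "msmooth (restr A (S \<inter> fst d)) (\<lambda>y. mderiv A (snd d) y (X y))"
    by (rule msmooth_mderiv[OF minclusion_restr[OF AA m] _ AB'(4)[OF d] _ AB'(5)[OF d]]) auto
  then show "msmooth (restr A (S \<inter> fst d)) (\<lambda>y. mderiv B (snd d) y (incl_deriv A B y (X y)))"
    by (rule msmooth_cong[OF smooth_atlas_restr[OF AB'(1) m], THEN iffD1, rotated])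
      (use mderiv_incl_deriv[OF AB _ mopen_chart[OF AB'(2) d] _ msmooth_chart_coord[OF AB'(2) d]] in auto)
qed

lemma smooth_along_incl_deriv:
  assumes AB: "minclusion A B" and X: "vector_field A X"
  shows "smooth_along A B (\<lambda>x. incl_deriv A B x (X x))"
  using smooth_along_incl_deriv_restr[OF AB mopen_UNIV] minclusionD(1)[OF AB] X
  by (simp add: vector_field_def)

lemma linear_incl_deriv:
  assumes AB: "minclusion A B" and x: "x \<in> points A"
  shows "linear (incl_deriv A B x)"
  unfolding differential_eq using minclusionD[OF AB] minclusion_chart_at[OF AB x] x
  by (intro has_mderiv_linear[OF msmooth_has_mderiv[of A "fst (chart_at B x)"]]) auto

section \<open>Orthogonal splitting along a submanifold\<close>

locale riemannian_submanifold =
  fixes M :: "('m, 'e::euclidean_space) atlas" and g :: "'m \<Rightarrow> 'e \<Rightarrow> 'e \<Rightarrow> real"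
    and L :: "('m, 'l::euclidean_space) atlas"
  assumes M: "smooth_manifold M" and g: "riemannian_metric M g" and L: "submanifold L M"
begin

lemmas LM = submanifold_minclusion[OF M L]
lemmas atlas_L = minclusionD(1)[OF LM] and atlas_M = minclusionD(2)[OF LM] and L_in_M = minclusionD(3)[OF LM]
lemmas LL = minclusion_refl[OF atlas_L]

lemma L_manifold: "smooth_manifold L" using L by (simp add: submanifold_def)

lemma generates_L: "generates L {f. msmooth L f}" by (rule smooth_manifold_generates[OF L_manifold])

lemma bl: "x \<in> points L \<Longrightarrow> bilinear (g x)" using riemannian_metricD(1)[OF g L_in_M] .
lemma gsym: "x \<in> points L \<Longrightarrow> g x v w = g x w v" using riemannian_metricD(2)[OF g L_in_M] .
lemma gpos: "x \<in> points L \<Longrightarrow> v \<noteq> 0 \<Longrightarrow> g x v v > 0" using riemannian_metricD(3)[OF g L_in_M] .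
lemma gnonneg: "x \<in> points L \<Longrightarrow> g x v v \<ge> 0"
  using gpos[of x v] bilinear_lzero[OF bl, of x] by (cases "v = 0") auto
lemma gzero: "x \<in> points L \<Longrightarrow> g x v v = 0 \<Longrightarrow> v = 0" using gpos[of x v] by fastforce

lemmas linear_incl = linear_incl_deriv[OF LM]
lemma inj_incl: "x \<in> points L \<Longrightarrow> inj (incl_deriv L M x)" using L by (simp add: submanifold_def)

lemma normal_spaceD: "v \<in> normal_space M g L x \<Longrightarrow> g x v (incl_deriv L M x u) = 0"
  by (simp add: normal_space_def)

lemma normal_space_add: "x \<in> points L \<Longrightarrow> v \<in> normal_space M g L x \<Longrightarrow> w \<in> normal_space M g L x \<Longrightarrow> v + w \<in> normal_space M g L x"
  by (simp add: normal_space_def bilinear_ladd[OF bl])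
lemma normal_space_scale: "x \<in> points L \<Longrightarrow> v \<in> normal_space M g L x \<Longrightarrow> c *\<^sub>R v \<in> normal_space M g L x"
  by (simp add: normal_space_def bilinear_lmul[OF bl])
lemma normal_space_diff: "x \<in> points L \<Longrightarrow> v \<in> normal_space M g L x \<Longrightarrow> w \<in> normal_space M g L x \<Longrightarrow> v - w \<in> normal_space M g L x"
  by (simp add: normal_space_def bilinear_lsub[OF bl])
lemma normal_space_0: "x \<in> points L \<Longrightarrow> 0 \<in> normal_space M g L x"
  by (simp add: normal_space_def bilinear_lzero[OF bl])

text \<open>Two candidates differ by a vector that is both tangent and normal, hence orthogonal to
  itself.\<close>

lemma normal_part_unique:
  assumes x: "x \<in> points L" and w: "w \<in> normal_space M g L x" "v - w \<in> range (incl_deriv L M x)"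
  shows "normal_part M g L x v = w"
  unfolding normal_part_def
proof (rule the_equality)
  fix w' assume w': "w' \<in> normal_space M g L x \<and> v - w' \<in> range (incl_deriv L M x)"
  obtain a b where ab: "v - w = incl_deriv L M x a" "v - w' = incl_deriv L M x b" using w w' by auto
  have "w' - w = incl_deriv L M x (a - b)" using ab by (simp add: linear_diff[OF linear_incl[OF x]] flip: ab)
  moreover have "w' - w \<in> normal_space M g L x" using normal_space_diff[OF x] w w' by blast
  ultimately have "g x (w' - w) (w' - w) = 0" by (metis normal_spaceD)
  then show "w' = w" using gzero[OF x] by fastforce
qed (use w in simp)

text \<open>Existence and smoothness of the normal part from one local formula: subtract the
  tangential component, read off with a tangent frame and its dual.\<close>

lemma normal_part_local:
  assumes x0: "x0 \<in> points L"
  obtains S e \<epsilon> where "mopen L S" "x0 \<in> S" "\<And>t::'l. smooth_along (restr L S) M (\<lambda>x. e x t)"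
    "\<And>t::'l. smooth_along (restr L S) M (\<lambda>x. \<epsilon> x t)"
    "\<And>x v. x \<in> S \<Longrightarrow> x \<in> points L \<Longrightarrow> normal_part M g L x v = v - (\<Sum>b\<in>Basis. g x v (e x b) *\<^sub>R \<epsilon> x b)"
    "\<And>x v. x \<in> S \<Longrightarrow> x \<in> points L \<Longrightarrow> normal_part M g L x v \<in> normal_space M g L x"
    "\<And>x v. x \<in> S \<Longrightarrow> x \<in> points L \<Longrightarrow> v - normal_part M g L x v \<in> range (incl_deriv L M x)"
proof -
  let ?c = "chart_at L x0"
  note c = chart_at[OF x0]
  let ?S = "fst ?c"
  note S = mopen_chart[OF atlas_L c(1)]
  note SM = minclusion_restr[OF LM S]
  \<comment> \<open>Coordinate fields of L pushed into M: a frame of the tangent spaces of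
    L.\<close>
  define e where "e x t = incl_deriv L M x (coord_vec L ?c t x)" for x t
  have e1: "smooth_along (restr L ?S) M (\<lambda>x. e x t)" for t
    unfolding e_def by (rule smooth_along_incl_deriv_restr[OF LM S smooth_along_coord_vec[OF LL c(1)]])
  have e2: "linear (e x)" if "x \<in> points (restr L ?S)" for x
    unfolding e_def using that linear_compose[OF linear_coord_vec[OF atlas_L c(1)] linear_incl] by (simp add: o_def)
  have e3: "inj (e x)" if "x \<in> points (restr L ?S)" for x
    unfolding inj_def e_def
  proof (intro allI impI)
    fix a b assume "incl_deriv L M x (coord_vec L ?c a x) = incl_deriv L M x (coord_vec L ?c b x)"
    then have "coord_vec L ?c a x = coord_vec L ?c b x" using that inj_incl by (auto dest: injD)
    then show "a = b" using mderiv_coord_vec(1)[OF atlas_L c(1), of x] that by (metis Int_iff points_restr)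
  qed
  obtain \<epsilon> where \<epsilon>: "\<And>s. smooth_along (restr L ?S) M (\<lambda>x. \<epsilon> x s)"
    "\<And>x s. x \<in> points (restr L ?S) \<Longrightarrow> \<epsilon> x s \<in> range (e x)"
    "\<And>x s t. x \<in> points (restr L ?S) \<Longrightarrow> g x (e x t) (\<epsilon> x s) = t \<bullet> s"
    using dual_frame[OF SM g e1 e2 e3] by blast
  define P where "P x v = v - (\<Sum>b\<in>Basis. g x v (e x b) *\<^sub>R \<epsilon> x b)" for x v
  have P1: "P x v \<in> normal_space M g L x" if x: "x \<in> ?S" "x \<in> points L" for x v
    unfolding normal_space_def
  proof (intro CollectI allI)
    fix u
    let ?t = "mderiv L (snd ?c) x u"
    have u: "incl_deriv L M x u = e x ?t" using mderiv_coord_vec(2)[OF atlas_L c(1) x(1)] by (simp add: e_def)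
    have xp: "x \<in> points (restr L ?S)" using x by simp
    have "e x ?t = (\<Sum>b\<in>Basis. (?t \<bullet> b) *\<^sub>R e x b)"
      by (rule linear_sum_Basis[OF e2[OF xp]])
    then have "g x v (e x ?t) = (\<Sum>b\<in>Basis. (?t \<bullet> b) * g x v (e x b))"
      using bl[OF x(2)] by (simp add: bilinear_def linear_sum linear_scale)
    moreover have "g x (\<Sum>b\<in>Basis. g x v (e x b) *\<^sub>R \<epsilon> x b) (e x ?t) = (\<Sum>b\<in>Basis. g x v (e x b) * (?t \<bullet> b))"
    proof -
      have "g x (\<epsilon> x b) (e x ?t) = ?t \<bullet> b" for b using \<epsilon>(3)[OF xp] gsym[OF x(2)] by metis
      moreover have "linear (\<lambda>v. g x v (e x ?t))" using bl[OF x(2)] by (simp add: bilinear_def)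
      ultimately show ?thesis by (simp add: linear_sum[of "\<lambda>v. g x v (e x ?t)"] linear_scale[of "\<lambda>v. g x v (e x ?t)"])
    qed
    ultimately show "g x (P x v) (incl_deriv L M x u) = 0"
      by (simp add: u P_def bilinear_lsub[OF bl[OF x(2)]] mult.commute)
  qed
  have P2: "v - P x v \<in> range (incl_deriv L M x)" if x: "x \<in> ?S" "x \<in> points L" for x v
  proof -
    have "\<epsilon> x b \<in> range (incl_deriv L M x)" for b using \<epsilon>(2)[of x b] x by (auto simp: e_def)
    moreover have "subspace (range (incl_deriv L M x))"
      using linear_subspace_image[OF linear_incl[OF x(2)] subspace_UNIV] .
    ultimately have "(\<Sum>b\<in>Basis. g x v (e x b) *\<^sub>R \<epsilon> x b) \<in> range (incl_deriv L M x)"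
      by (intro subspace_sum subspace_scale)
    then show ?thesis by (simp add: P_def)
  qed
  have P: "normal_part M g L x v = P x v" if x: "x \<in> ?S" "x \<in> points L" for x v
    by (rule normal_part_unique[OF x(2) P1[OF x] P2[OF x]])
  show ?thesis
    by (rule that[OF S c(2) e1 \<epsilon>(1)]) (simp_all add: P P1 P2, simp add: P_def)
qed

lemma normal_part_normal: "x \<in> points L \<Longrightarrow> normal_part M g L x v \<in> normal_space M g L x"
  by (rule normal_part_local[of x]) auto

lemma normal_part_tangent: "x \<in> points L \<Longrightarrow> v - normal_part M g L x v \<in> range (incl_deriv L M x)"
  by (rule normal_part_local[of x]) auto

lemma normal_part_self: "x \<in> points L \<Longrightarrow> v \<in> normal_space M g L x \<Longrightarrow> normal_part M g L x v = v"
  by (rule normal_part_unique) (auto simp: linear_0[OF linear_incl] image_iff intro!: exI[of _ 0])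

lemma normal_part_inner:
  assumes x: "x \<in> points L" and n: "n \<in> normal_space M g L x"
  shows "g x (normal_part M g L x v) n = g x v n"
proof -
  obtain u where "v - normal_part M g L x v = incl_deriv L M x u" using normal_part_tangent[OF x, of v] by auto
  then have "g x (v - normal_part M g L x v) n = 0" using normal_spaceD[OF n] gsym[OF x] by metis
  then show ?thesis by (simp add: bilinear_lsub[OF bl[OF x]])
qed

lemma normal_eqI:
  assumes x: "x \<in> points L" and v: "v \<in> normal_space M g L x" "w \<in> normal_space M g L x"
    and eq: "\<And>n. n \<in> normal_space M g L x \<Longrightarrow> g x v n = g x w n"
  shows "v = w"
proof -
  have "g x (v - w) (v - w) = 0"
    using eq[OF normal_space_diff[OF x v]] by (simp add: bilinear_lsub[OF bl[OF x]])
  then show ?thesis using gzero[OF x] by fastforce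
qed

text \<open>Normal vectors are determined by their products with normal vectors, and in such
  products the projection is invisible.\<close>

lemma linear_normal_part:
  assumes x: "x \<in> points L" shows "linear (normal_part M g L x)"
  by (rule linearI; rule normal_eqI[OF x])
    (simp_all add: normal_part_normal x normal_space_add normal_space_scale normal_part_inner
      bilinear_ladd[OF bl[OF x]] bilinear_lmul[OF bl[OF x]])

lemma normal_part_smooth:
  assumes \<xi>: "smooth_along L M \<xi>"
  shows "smooth_along L M (\<lambda>x. normal_part M g L x (\<xi> x))"
proof (rule smooth_along_local[OF LM])
  fix x0 assume x0: "x0 \<in> points L"
  show "\<exists>S. mopen L S \<and> x0 \<in> S \<and> smooth_along (restr L S) M (\<lambda>x. normal_part M g L x (\<xi> x))"
  proof (rule normal_part_local[OF x0])
    fix S e and \<epsilon> :: "'m \<Rightarrow> 'l \<Rightarrow> 'e"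
    assume S: "mopen L S" "x0 \<in> S" "\<And>t::'l. smooth_along (restr L S) M (\<lambda>x. e x t)"
      "\<And>t::'l. smooth_along (restr L S) M (\<lambda>x. \<epsilon> x t)"
      "\<And>x v. x \<in> S \<Longrightarrow> x \<in> points L \<Longrightarrow> normal_part M g L x v = v - (\<Sum>b\<in>Basis. g x v (e x b) *\<^sub>R \<epsilon> x b)"
    note SM = minclusion_restr[OF LM S(1)]
    note R = minclusionD(1)[OF SM]
    have \<xi>S: "smooth_along (restr L S) M \<xi>" by (rule smooth_along_restr[OF LM S(1) \<xi>])
    have sum: "smooth_along (restr L S) M (\<lambda>x. \<Sum>b\<in>C. g x (\<xi> x) (e x b) *\<^sub>R \<epsilon> x b)" for C
      by (induction C rule: infinite_finite_induct)
        (simp_all add: smooth_along_zero[OF SM] smooth_along_add[OF SM] smooth_along_scaleR[OF SM] msmooth_metric[OF SM g \<xi>S] S)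
    have "smooth_along (restr L S) M (\<lambda>x. \<xi> x + (-1) *\<^sub>R (\<Sum>b\<in>Basis. g x (\<xi> x) (e x b) *\<^sub>R \<epsilon> x b))"
      by (intro smooth_along_add[OF SM] \<xi>S smooth_along_scaleR[OF SM] sum msmooth_const R)
    then have "smooth_along (restr L S) M (\<lambda>x. normal_part M g L x (\<xi> x))"
      by (rule smooth_along_cong[OF SM, THEN iffD1, rotated]) (use S(5) in auto)
    then show ?thesis using S(1,2) by blast
  qed
qed

section \<open>Normal sections\<close>

abbreviation "normal_sec \<equiv> normal_section M g L"

lemma normal_sec_smooth: "normal_sec \<xi> \<Longrightarrow> smooth_along L M \<xi>" by (simp add: normal_section_def)
lemma normal_sec_in: "normal_sec \<xi> \<Longrightarrow> x \<in> points L \<Longrightarrow> \<xi> x \<in> normal_space M g L x" by (simp add: normal_section_def)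

lemma normal_sec_add: "normal_sec \<xi> \<Longrightarrow> normal_sec \<eta> \<Longrightarrow> normal_sec (\<lambda>x. \<xi> x + \<eta> x)"
  using smooth_along_add[OF LM] normal_space_add by (simp add: normal_section_def)

lemma normal_sec_scaleR: "msmooth L f \<Longrightarrow> normal_sec \<xi> \<Longrightarrow> normal_sec (\<lambda>x. f x *\<^sub>R \<xi> x)"
  using smooth_along_scaleR[OF LM] normal_space_scale by (simp add: normal_section_def)

lemma normal_sec_cong: "normal_sec \<xi> \<Longrightarrow> (\<And>x. x \<in> points L \<Longrightarrow> \<xi> x = \<eta> x) \<Longrightarrow> normal_sec \<eta>"
  using smooth_along_cong[OF LM, of \<xi> \<eta>] by (simp add: normal_section_def)

text \<open>Extend as a section along L, then project; the projection fixes the prescribed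
  value.\<close>

lemma normal_sec_extension:
  assumes x: "x \<in> points L" and n: "n \<in> normal_space M g L x"
  obtains \<xi> where "normal_sec \<xi>" "\<xi> x = n"
proof -
  obtain \<xi> where \<xi>: "smooth_along L M \<xi>" "\<xi> x = n" by (rule smooth_along_extension[OF L_manifold LM x])
  show ?thesis
    by (rule that[of "\<lambda>x. normal_part M g L x (\<xi> x)"])
      (simp_all add: normal_section_def normal_part_smooth \<xi> normal_part_normal normal_part_self[OF x n])
qed

lemma vector_field_extension:
  assumes x: "x \<in> points L"
  obtains X where "vector_field L X" "X x = u"
  using smooth_along_extension[OF L_manifold LL x] unfolding vector_field_def by blast

lemma vector_field_add: "vector_field L X \<Longrightarrow> vector_field L Y \<Longrightarrow> vector_field L (\<lambda>x. X x + Y x)"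
  using smooth_along_add[OF LL] by (simp add: vector_field_def)

lemma vector_field_scaleR: "msmooth L f \<Longrightarrow> vector_field L X \<Longrightarrow> vector_field L (\<lambda>x. f x *\<^sub>R X x)"
  using smooth_along_scaleR[OF LL] by (simp add: vector_field_def)

lemma msmooth_metric_L: "smooth_along L M \<xi> \<Longrightarrow> smooth_along L M \<eta> \<Longrightarrow> msmooth L (\<lambda>x. g x (\<xi> x) (\<eta> x))"
  by (rule msmooth_metric[OF LM g])

end

section \<open>The normal connection and its curvature\<close>

locale normal_conn = riemannian_submanifold M g L
  for M :: "('m, 'e::euclidean_space) atlas" and g :: "'m \<Rightarrow> 'e \<Rightarrow> 'e \<Rightarrow> real"
    and L :: "('m, 'l::euclidean_space) atlas" +
  fixes Dn :: "('m \<Rightarrow> 'l) \<Rightarrow> ('m \<Rightarrow> 'e) \<Rightarrow> 'm \<Rightarrow> 'e"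
  assumes Dn: "normal_connection M g L Dn"
begin

text \<open>\<open>Dn\<close> is given through an unnamed pair of connections on M and along L; the
  later arguments use the pair only through these facts.\<close>

lemma Dn_cases:
  obtains D' where "connection_along L M D'"
    "\<And>X \<xi> x. vector_field L X \<Longrightarrow> normal_sec \<xi> \<Longrightarrow> x \<in> points L \<Longrightarrow> Dn X \<xi> x = normal_part M g L x (D' X \<xi> x)"
    "\<And>X \<xi> \<zeta> x. vector_field L X \<Longrightarrow> smooth_along L M \<xi> \<Longrightarrow> smooth_along L M \<zeta> \<Longrightarrow> x \<in> points L \<Longrightarrow>
      mderiv L (\<lambda>y. g y (\<xi> y) (\<zeta> y)) x (X x) = g x (D' X \<xi> x) (\<zeta> x) + g x (\<xi> x) (D' X \<zeta> x)"
proof -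
  obtain D D' where D: "levi_civita M g D" "pullback_connection M L D D'"
    "\<And>X \<xi> x. vector_field L X \<Longrightarrow> normal_sec \<xi> \<Longrightarrow> x \<in> points L \<Longrightarrow> Dn X \<xi> x = normal_part M g L x (D' X \<xi> x)"
    using Dn unfolding normal_connection_def by blast
  show ?thesis
    by (rule that[of D'])
      (use D pullback_connection_metric[OF M g L D(1,2)] in \<open>simp_all add: pullback_connection_def\<close>)
qed

lemma Dn_sec:
  assumes X: "vector_field L X" and \<xi>: "normal_sec \<xi>" shows "normal_sec (Dn X \<xi>)"
proof (rule Dn_cases)
  fix D' assume D': "connection_along L M D'"
    "\<And>X \<xi> x. vector_field L X \<Longrightarrow> normal_sec \<xi> \<Longrightarrow> x \<in> points L \<Longrightarrow> Dn X \<xi> x = normal_part M g L x (D' X \<xi> x)"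
  have "normal_sec (\<lambda>x. normal_part M g L x (D' X \<xi> x))"
    using normal_part_smooth[OF connection_alongD(1)[OF D'(1) X normal_sec_smooth[OF \<xi>]]]
    by (simp add: normal_section_def normal_part_normal)
  then show ?thesis by (rule normal_sec_cong) (simp add: D'(2)[OF X \<xi>])
qed

lemma Dn_in: "vector_field L X \<Longrightarrow> normal_sec \<xi> \<Longrightarrow> x \<in> points L \<Longrightarrow> Dn X \<xi> x \<in> normal_space M g L x"
  using normal_sec_in[OF Dn_sec] .

text \<open>The normal projection does not change products with normal vectors, so compatibility
  passes from the pullback connection to \<open>Dn\<close>.\<close>

lemma Dn_metric:
  assumes X: "vector_field L X" and \<xi>: "normal_sec \<xi>" and \<zeta>: "normal_sec \<zeta>" and x: "x \<in> points L"
  shows "mderiv L (\<lambda>y. g y (\<xi> y) (\<zeta> y)) x (X x) = g x (Dn X \<xi> x) (\<zeta> x) + g x (\<xi> x) (Dn X \<zeta> x)"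
proof (rule Dn_cases)
  fix D' assume D': "\<And>X \<xi> x. vector_field L X \<Longrightarrow> normal_sec \<xi> \<Longrightarrow> x \<in> points L \<Longrightarrow> Dn X \<xi> x = normal_part M g L x (D' X \<xi> x)"
    "\<And>X \<xi> \<zeta> x. vector_field L X \<Longrightarrow> smooth_along L M \<xi> \<Longrightarrow> smooth_along L M \<zeta> \<Longrightarrow> x \<in> points L \<Longrightarrow>
      mderiv L (\<lambda>y. g y (\<xi> y) (\<zeta> y)) x (X x) = g x (D' X \<xi> x) (\<zeta> x) + g x (\<xi> x) (D' X \<zeta> x)"
  show ?thesis
    using D'(2)[OF X normal_sec_smooth[OF \<xi>] normal_sec_smooth[OF \<zeta>] x]
      normal_part_inner[OF x normal_sec_in[OF \<zeta> x], of "D' X \<xi> x"]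
      normal_part_inner[OF x normal_sec_in[OF \<xi> x], of "D' X \<zeta> x"]
    by (simp add: D'(1)[OF X \<xi> x] D'(1)[OF X \<zeta> x] gsym[OF x, of "\<xi> x"])
qed

lemma Dn_direction:
  assumes "vector_field L X" "vector_field L Y" "X x = Y x" "normal_sec \<xi>" "x \<in> points L"
  shows "Dn X \<xi> x = Dn Y \<xi> x"
proof (rule Dn_cases)
  fix D' assume D': "connection_along L M D'"
    "\<And>X \<xi> x. vector_field L X \<Longrightarrow> normal_sec \<xi> \<Longrightarrow> x \<in> points L \<Longrightarrow> Dn X \<xi> x = normal_part M g L x (D' X \<xi> x)"
  show ?thesis
    using connection_along_direction[OF L_manifold D'(1) assms(1-3) normal_sec_smooth[OF assms(4)] assms(5)]
    by (simp add: D'(2) assms)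
qed

lemma Dn_cong:
  assumes X: "vector_field L X" and \<xi>: "normal_sec \<xi>" "\<And>y. y \<in> points L \<Longrightarrow> \<xi> y = \<eta> y" and x: "x \<in> points L"
  shows "Dn X \<xi> x = Dn X \<eta> x"
proof (rule Dn_cases)
  fix D' assume D': "connection_along L M D'"
    "\<And>X \<xi> x. vector_field L X \<Longrightarrow> normal_sec \<xi> \<Longrightarrow> x \<in> points L \<Longrightarrow> Dn X \<xi> x = normal_part M g L x (D' X \<xi> x)"
  show ?thesis
    using connection_along_cong[OF LM D'(1) X normal_sec_smooth[OF \<xi>(1)] \<xi>(2) x]
    by (simp add: D'(2)[OF X \<xi>(1) x] D'(2)[OF X normal_sec_cong[OF \<xi>] x])
qed

lemma Dn_linear:
  assumes X: "vector_field L X" and \<xi>: "normal_sec \<xi>" and x: "x \<in> points L"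
  shows "vector_field L Y \<Longrightarrow> Dn (\<lambda>y. X y + Y y) \<xi> x = Dn X \<xi> x + Dn Y \<xi> x"
    "msmooth L f \<Longrightarrow> Dn (\<lambda>y. f y *\<^sub>R X y) \<xi> x = f x *\<^sub>R Dn X \<xi> x"
    "normal_sec \<eta> \<Longrightarrow> Dn X (\<lambda>y. \<xi> y + \<eta> y) x = Dn X \<xi> x + Dn X \<eta> x"
    "msmooth L f \<Longrightarrow> Dn X (\<lambda>y. f y *\<^sub>R \<xi> y) x = mderiv L f x (X x) *\<^sub>R \<xi> x + f x *\<^sub>R Dn X \<xi> x"
proof -
  obtain D' where D': "connection_along L M D'"
    "\<And>X \<xi> x. vector_field L X \<Longrightarrow> normal_sec \<xi> \<Longrightarrow> x \<in> points L \<Longrightarrow> Dn X \<xi> x = normal_part M g L x (D' X \<xi> x)"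
    by (rule Dn_cases) blast
  note lin = linear_normal_part[OF x]
  note c = connection_alongD[OF D'(1) X normal_sec_smooth[OF \<xi>]]
  show "vector_field L Y \<Longrightarrow> Dn (\<lambda>y. X y + Y y) \<xi> x = Dn X \<xi> x + Dn Y \<xi> x"
    using c(2) x by (simp add: D'(2) X \<xi> vector_field_add linear_add[OF lin])
  show "msmooth L f \<Longrightarrow> Dn (\<lambda>y. f y *\<^sub>R X y) \<xi> x = f x *\<^sub>R Dn X \<xi> x"
    using c(3) x by (simp add: D'(2) X \<xi> vector_field_scaleR linear_scale[OF lin])
  show "normal_sec \<eta> \<Longrightarrow> Dn X (\<lambda>y. \<xi> y + \<eta> y) x = Dn X \<xi> x + Dn X \<eta> x"
    using c(4) x by (simp add: D'(2) X \<xi> normal_sec_add normal_sec_smooth linear_add[OF lin])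
  show "msmooth L f \<Longrightarrow> Dn X (\<lambda>y. f y *\<^sub>R \<xi> y) x = mderiv L f x (X x) *\<^sub>R \<xi> x + f x *\<^sub>R Dn X \<xi> x"
    using c(5) x by (simp add: D'(2) X \<xi> normal_sec_scaleR linear_add[OF lin] linear_scale[OF lin]
        normal_part_self[OF x normal_sec_in[OF \<xi> x]])
qed

section \<open>Curvature of the normal connection and its tensoriality\<close>

lemma bracket_field: "vector_field L X \<Longrightarrow> vector_field L Y \<Longrightarrow> vector_field L (lie_bracket L X Y)"
  by (rule vector_field_lie_bracket[OF atlas_L generates_L])

lemmas bracket_eq = lie_bracket_eq[OF atlas_L generates_L]

lemma curvature_in:
  assumes X: "vector_field L X" and Y: "vector_field L Y" and \<xi>: "normal_sec \<xi>" and x: "x \<in> points L"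
  shows "curvature L Dn X Y \<xi> x \<in> normal_space M g L x"
  unfolding curvature_def
  by (intro normal_space_diff x Dn_in Dn_sec X Y \<xi> bracket_field)

text \<open>The two middle terms are exchanged with X and Y and so drop out of the
  commutator.\<close>

lemma Dn_metric_iterated:
  assumes X: "vector_field L X" and Y: "vector_field L Y" and \<xi>: "normal_sec \<xi>" and \<zeta>: "normal_sec \<zeta>" and x: "x \<in> points L"
  shows "mderiv L (\<lambda>y. mderiv L (\<lambda>y. g y (\<xi> y) (\<zeta> y)) y (Y y)) x (X x) =
    g x (Dn X (Dn Y \<xi>) x) (\<zeta> x) + g x (Dn Y \<xi> x) (Dn X \<zeta> x) + g x (Dn X \<xi> x) (Dn Y \<zeta> x) + g x (\<xi> x) (Dn X (Dn Y \<zeta>) x)"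
proof -
  have "mderiv L (\<lambda>y. mderiv L (\<lambda>y. g y (\<xi> y) (\<zeta> y)) y (Y y)) x =
      mderiv L (\<lambda>y. g y (Dn Y \<xi> y) (\<zeta> y) + g y (\<xi> y) (Dn Y \<zeta> y)) x"
    by (rule mderiv_cong[OF atlas_L mopen_UNIV[OF atlas_L] UNIV_I x]) (rule Dn_metric[OF Y \<xi> \<zeta>])
  also have "\<dots> = (\<lambda>v. mderiv L (\<lambda>y. g y (Dn Y \<xi> y) (\<zeta> y)) x v + mderiv L (\<lambda>y. g y (\<xi> y) (Dn Y \<zeta> y)) x v)"
    by (intro has_mderivD has_mderiv_add msmooth_has_mderiv_UNIV atlas_L x msmooth_metric_L normal_sec_smooth Dn_sec Y \<xi> \<zeta>)
  finally show ?thesis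
    using Dn_metric[OF X Dn_sec[OF Y \<xi>] \<zeta> x] Dn_metric[OF X \<xi> Dn_sec[OF Y \<zeta>] x] by simp
qed

text \<open>Apply [X, Y] to the function <\<xi>, \<zeta>>, once by metric compatibility and once as
  a commutator of second derivatives.\<close>

lemma curvature_skew:
  assumes X: "vector_field L X" and Y: "vector_field L Y" and \<xi>: "normal_sec \<xi>" and \<zeta>: "normal_sec \<zeta>" and x: "x \<in> points L"
  shows "g x (curvature L Dn X Y \<xi> x) (\<zeta> x) = - g x (\<xi> x) (curvature L Dn X Y \<zeta> x)"
proof -
  note b = bracket_field[OF X Y]
  have "mderiv L (\<lambda>y. g y (\<xi> y) (\<zeta> y)) x (lie_bracket L X Y x) =
      mderiv L (\<lambda>y. mderiv L (\<lambda>y. g y (\<xi> y) (\<zeta> y)) y (Y y)) x (X x) -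
      mderiv L (\<lambda>y. mderiv L (\<lambda>y. g y (\<xi> y) (\<zeta> y)) y (X y)) x (Y x)"
    by (rule bracket_eq[OF X Y x msmooth_metric_L[OF normal_sec_smooth[OF \<xi>] normal_sec_smooth[OF \<zeta>]]])
  then show ?thesis
    unfolding Dn_metric[OF b \<xi> \<zeta> x] Dn_metric_iterated[OF X Y \<xi> \<zeta> x] Dn_metric_iterated[OF Y X \<xi> \<zeta> x] curvature_def
    by (simp add: bilinear_lsub[OF bl[OF x]] bilinear_rsub[OF bl[OF x]])
qed

text \<open>Skew symmetry shifts the curvature onto a test section and leaves only the value of
  \<open>\<xi>\<close> at x; tensoriality in this argument thus comes without a Leibniz
  computation.\<close>

lemma curvature_section_cong:
  assumes X: "vector_field L X" and Y: "vector_field L Y" and \<xi>: "normal_sec \<xi>" and \<zeta>: "normal_sec \<zeta>" and x: "x \<in> points L"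
    and eq: "\<xi> x = \<zeta> x"
  shows "curvature L Dn X Y \<xi> x = curvature L Dn X Y \<zeta> x"
proof (rule normal_eqI[OF x curvature_in[OF X Y \<xi> x] curvature_in[OF X Y \<zeta> x]])
  fix n assume "n \<in> normal_space M g L x"
  then obtain \<nu> where \<nu>: "normal_sec \<nu>" "\<nu> x = n" using normal_sec_extension[OF x] by blast
  show "g x (curvature L Dn X Y \<xi> x) n = g x (curvature L Dn X Y \<zeta> x) n"
    using curvature_skew[OF X Y \<xi> \<nu>(1) x] curvature_skew[OF X Y \<zeta> \<nu>(1) x] by (simp add: \<nu> eq)
qed

lemma bracket_add:
  assumes X: "vector_field L X" and X': "vector_field L X'" and Y: "vector_field L Y" and x: "x \<in> points L"
  shows "lie_bracket L (\<lambda>y. X y + X' y) Y x = lie_bracket L X Y x + lie_bracket L X' Y x"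
proof (rule lie_bracket_unique[OF atlas_L generates_L vector_field_add[OF X X'] Y x])
  fix f :: "'m \<Rightarrow> real" assume "f \<in> {f. msmooth L f}"
  then have f: "msmooth L f" by simp
  have lin: "linear (mderiv L f y)" if "y \<in> points L" for y
    using msmooth_has_mderiv_UNIV[OF atlas_L that f] by (rule has_mderiv_linear)
  have "mderiv L (\<lambda>y. mderiv L f y (X y + X' y)) x = mderiv L (\<lambda>y. mderiv L f y (X y) + mderiv L f y (X' y)) x"
    by (rule mderiv_cong[OF atlas_L mopen_UNIV[OF atlas_L] UNIV_I x]) (simp add: linear_add[OF lin])
  also have "\<dots> = (\<lambda>v. mderiv L (\<lambda>y. mderiv L f y (X y)) x v + mderiv L (\<lambda>y. mderiv L f y (X' y)) x v)"
    by (intro has_mderivD has_mderiv_add msmooth_has_mderiv_UNIV atlas_L x vector_field_mderiv X X' f)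
  finally show "mderiv L f x (lie_bracket L X Y x + lie_bracket L X' Y x) =
      mderiv L (\<lambda>y. mderiv L f y (Y y)) x (X x + X' x) - mderiv L (\<lambda>y. mderiv L f y (X y + X' y)) x (Y x)"
    using linear_add[OF has_mderiv_linear[OF msmooth_has_mderiv_UNIV[OF atlas_L x vector_field_mderiv[OF atlas_L Y f]]]]
    by (simp add: linear_add[OF lin[OF x]] bracket_eq[OF X Y x f] bracket_eq[OF X' Y x f])
qed

lemma bracket_scale:
  assumes X: "vector_field L X" and Y: "vector_field L Y" and x: "x \<in> points L" and h: "msmooth L h"
  shows "lie_bracket L (\<lambda>y. h y *\<^sub>R X y) Y x = h x *\<^sub>R lie_bracket L X Y x - mderiv L h x (Y x) *\<^sub>R X x"
proof (rule lie_bracket_unique[OF atlas_L generates_L vector_field_scaleR[OF h X] Y x])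
  fix f :: "'m \<Rightarrow> real" assume "f \<in> {f. msmooth L f}"
  then have f: "msmooth L f" by simp
  have lin: "linear (mderiv L f y)" if "y \<in> points L" for y
    using msmooth_has_mderiv_UNIV[OF atlas_L that f] by (rule has_mderiv_linear)
  have "mderiv L (\<lambda>y. mderiv L f y (h y *\<^sub>R X y)) x = mderiv L (\<lambda>y. h y * mderiv L f y (X y)) x"
    by (rule mderiv_cong[OF atlas_L mopen_UNIV[OF atlas_L] UNIV_I x]) (simp add: linear_scale[OF lin])
  also have "\<dots> = (\<lambda>v. h x * mderiv L (\<lambda>y. mderiv L f y (X y)) x v + mderiv L h x v * mderiv L f x (X x))"
    by (intro has_mderivD has_mderiv_mult msmooth_has_mderiv_UNIV atlas_L x vector_field_mderiv X f h)
  finally show "mderiv L f x (h x *\<^sub>R lie_bracket L X Y x - mderiv L h x (Y x) *\<^sub>R X x) =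
      mderiv L (\<lambda>y. mderiv L f y (Y y)) x (h x *\<^sub>R X x) - mderiv L (\<lambda>y. mderiv L f y (h y *\<^sub>R X y)) x (Y x)"
    using linear_scale[OF has_mderiv_linear[OF msmooth_has_mderiv_UNIV[OF atlas_L x vector_field_mderiv[OF atlas_L Y f]]]]
    by (simp add: linear_diff[OF lin[OF x]] linear_scale[OF lin[OF x]] bracket_eq[OF X Y x f] algebra_simps)
qed

text \<open>The sign is a multiple by the constant -1, the form in which \<open>Dn_linear\<close>
  accepts it in the direction.\<close>

lemma bracket_swap:
  assumes X: "vector_field L X" and Y: "vector_field L Y" and x: "x \<in> points L"
  shows "lie_bracket L Y X x = (-1) *\<^sub>R lie_bracket L X Y x"
proof (rule lie_bracket_unique[OF atlas_L generates_L Y X x])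
  fix f :: "'m \<Rightarrow> real" assume "f \<in> {f. msmooth L f}"
  then have f: "msmooth L f" by simp
  show "mderiv L f x ((-1) *\<^sub>R lie_bracket L X Y x) =
      mderiv L (\<lambda>y. mderiv L f y (X y)) x (Y x) - mderiv L (\<lambda>y. mderiv L f y (Y y)) x (X x)"
    unfolding linear_scale[OF has_mderiv_linear[OF msmooth_has_mderiv_UNIV[OF atlas_L x f]]]
    by (simp add: bracket_eq[OF X Y x f])
qed

lemma curvature_swap:
  assumes X: "vector_field L X" and Y: "vector_field L Y" and \<xi>: "normal_sec \<xi>" and x: "x \<in> points L"
  shows "curvature L Dn Y X \<xi> x = - curvature L Dn X Y \<xi> x"
proof -
  note c = msmooth_const[OF atlas_L, of "-1 :: real"]
  have "Dn (lie_bracket L Y X) \<xi> x = Dn (\<lambda>y. (-1) *\<^sub>R lie_bracket L X Y y) \<xi> x"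
    by (rule Dn_direction[OF bracket_field[OF Y X] vector_field_scaleR[OF c bracket_field[OF X Y]] bracket_swap[OF X Y x] \<xi> x])
  also have "\<dots> = (-1) *\<^sub>R Dn (lie_bracket L X Y) \<xi> x" by (rule Dn_linear(2)[OF bracket_field[OF X Y] \<xi> x c])
  finally show ?thesis by (simp add: curvature_def)
qed

lemma curvature_add:
  assumes X: "vector_field L X" and X': "vector_field L X'" and Y: "vector_field L Y" and \<xi>: "normal_sec \<xi>" and x: "x \<in> points L"
  shows "curvature L Dn (\<lambda>y. X y + X' y) Y \<xi> x = curvature L Dn X Y \<xi> x + curvature L Dn X' Y \<xi> x"
proof -
  note XX = vector_field_add[OF X X']
  have 1: "Dn (\<lambda>y. X y + X' y) (Dn Y \<xi>) x = Dn X (Dn Y \<xi>) x + Dn X' (Dn Y \<xi>) x"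
    by (rule Dn_linear(1)[OF X Dn_sec[OF Y \<xi>] x X'])
  have "Dn Y (Dn (\<lambda>y. X y + X' y) \<xi>) x = Dn Y (\<lambda>y. Dn X \<xi> y + Dn X' \<xi> y) x"
    by (rule Dn_cong[OF Y Dn_sec[OF XX \<xi>] _ x]) (rule Dn_linear(1)[OF X \<xi> _ X'])
  also have "\<dots> = Dn Y (Dn X \<xi>) x + Dn Y (Dn X' \<xi>) x"
    by (rule Dn_linear(3)[OF Y Dn_sec[OF X \<xi>] x Dn_sec[OF X' \<xi>]])
  finally have 2: "Dn Y (Dn (\<lambda>y. X y + X' y) \<xi>) x = Dn Y (Dn X \<xi>) x + Dn Y (Dn X' \<xi>) x" .
  have "Dn (lie_bracket L (\<lambda>y. X y + X' y) Y) \<xi> x = Dn (\<lambda>y. lie_bracket L X Y y + lie_bracket L X' Y y) \<xi> x"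
    by (rule Dn_direction[OF bracket_field[OF XX Y] vector_field_add[OF bracket_field[OF X Y] bracket_field[OF X' Y]]
          bracket_add[OF X X' Y x] \<xi> x])
  also have "\<dots> = Dn (lie_bracket L X Y) \<xi> x + Dn (lie_bracket L X' Y) \<xi> x"
    by (rule Dn_linear(1)[OF bracket_field[OF X Y] \<xi> x bracket_field[OF X' Y]])
  finally show ?thesis unfolding curvature_def 1 2 by simp
qed

text \<open>The derivative of h enters through the Leibniz rule for \<open>Dn Y\<close> and through
  the bracket, and the two contributions cancel.\<close>

lemma curvature_scale:
  assumes X: "vector_field L X" and Y: "vector_field L Y" and \<xi>: "normal_sec \<xi>" and x: "x \<in> points L" and h: "msmooth L h"
  shows "curvature L Dn (\<lambda>y. h y *\<^sub>R X y) Y \<xi> x = h x *\<^sub>R curvature L Dn X Y \<xi> x"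
proof -
  note hX = vector_field_scaleR[OF h X]
  have 1: "Dn (\<lambda>y. h y *\<^sub>R X y) (Dn Y \<xi>) x = h x *\<^sub>R Dn X (Dn Y \<xi>) x"
    by (rule Dn_linear(2)[OF X Dn_sec[OF Y \<xi>] x h])
  have "Dn Y (Dn (\<lambda>y. h y *\<^sub>R X y) \<xi>) x = Dn Y (\<lambda>y. h y *\<^sub>R Dn X \<xi> y) x"
    by (rule Dn_cong[OF Y Dn_sec[OF hX \<xi>] _ x]) (rule Dn_linear(2)[OF X \<xi> _ h])
  also have "\<dots> = mderiv L h x (Y x) *\<^sub>R Dn X \<xi> x + h x *\<^sub>R Dn Y (Dn X \<xi>) x"
    by (rule Dn_linear(4)[OF Y Dn_sec[OF X \<xi>] x h])
  finally have 2: "Dn Y (Dn (\<lambda>y. h y *\<^sub>R X y) \<xi>) x = mderiv L h x (Y x) *\<^sub>R Dn X \<xi> x + h x *\<^sub>R Dn Y (Dn X \<xi>) x" .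
  \<comment> \<open>The minus sign goes into the coefficient, since directions are combined by sums
    and multiples by smooth functions.\<close>
  have k: "msmooth L (\<lambda>y. - mderiv L h y (Y y))"
    using msmooth_diff[OF atlas_L msmooth_const[OF atlas_L, of 0] vector_field_mderiv[OF atlas_L Y h]] by simp
  note b = vector_field_scaleR[OF h bracket_field[OF X Y]] and b' = vector_field_scaleR[OF k X]
  have "Dn (lie_bracket L (\<lambda>y. h y *\<^sub>R X y) Y) \<xi> x =
      Dn (\<lambda>y. h y *\<^sub>R lie_bracket L X Y y + (- mderiv L h y (Y y)) *\<^sub>R X y) \<xi> x"
    by (rule Dn_direction[OF bracket_field[OF hX Y] vector_field_add[OF b b'] _ \<xi> x])
      (simp add: bracket_scale[OF X Y x h])
  also have "\<dots> = h x *\<^sub>R Dn (lie_bracket L X Y) \<xi> x + (- mderiv L h x (Y x)) *\<^sub>R Dn X \<xi> x"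
    unfolding Dn_linear(1)[OF b \<xi> x b'] Dn_linear(2)[OF bracket_field[OF X Y] \<xi> x h] Dn_linear(2)[OF X \<xi> x k] ..
  finally show ?thesis unfolding curvature_def 1 2 by (simp add: scaleR_diff_right)
qed

lemma curvature_direction_cong:
  assumes "vector_field L X" "vector_field L X'" "X x = X' x" and Y: "vector_field L Y" and \<xi>: "normal_sec \<xi>" and x: "x \<in> points L"
  shows "curvature L Dn X Y \<xi> x = curvature L Dn X' Y \<xi> x"
  by (rule tensorial[OF L_manifold LL x, where T = "\<lambda>X. curvature L Dn X Y \<xi> x"])
    (use assms(1-3) curvature_add[OF _ _ Y \<xi> x] curvature_scale[OF _ Y \<xi> x] in \<open>auto simp: vector_field_def\<close>)

text \<open>The extensions do not matter: for the first argument by tensoriality, for the second by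
  exchanging it with the first, for the section by skew symmetry.\<close>

lemma normal_curvature_eq:
  assumes X: "vector_field L X" and Y: "vector_field L Y" and \<xi>: "normal_sec \<xi>" and x: "x \<in> points L"
  shows "normal_curvature M g L Dn x (X x) (Y x) (\<xi> x) = curvature L Dn X Y \<xi> x"
  unfolding normal_curvature_def
proof (rule the_equality)
  show "\<forall>X' Y' \<xi>'. vector_field L X' \<and> vector_field L Y' \<and> normal_sec \<xi>' \<and> X' x = X x \<and> Y' x = Y x \<and> \<xi>' x = \<xi> x \<longrightarrow>
      curvature L Dn X Y \<xi> x = curvature L Dn X' Y' \<xi>' x"
  proof (intro allI impI, elim conjE)
    fix X' Y' \<xi>' assume X': "vector_field L X'" and Y': "vector_field L Y'" and \<xi>': "normal_sec \<xi>'"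
      and eq: "X' x = X x" "Y' x = Y x" "\<xi>' x = \<xi> x"
    have "curvature L Dn X Y \<xi> x = curvature L Dn X' Y \<xi> x"
      by (rule curvature_direction_cong[OF X X' eq(1)[symmetric] Y \<xi> x])
    also have "\<dots> = - curvature L Dn Y X' \<xi> x" by (rule curvature_swap[OF Y X' \<xi> x])
    also have "\<dots> = - curvature L Dn Y' X' \<xi> x"
      using curvature_direction_cong[OF Y Y' eq(2)[symmetric] X' \<xi> x] by simp
    also have "\<dots> = curvature L Dn X' Y' \<xi> x" by (rule curvature_swap[OF Y' X' \<xi> x, symmetric])
    also have "\<dots> = curvature L Dn X' Y' \<xi>' x" by (rule curvature_section_cong[OF X' Y' \<xi> \<xi>' x eq(3)[symmetric]])
    finally show "curvature L Dn X Y \<xi> x = curvature L Dn X' Y' \<xi>' x" .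
  qed
qed (use X Y \<xi> in blast)

lemma bilinear_induced:
  assumes x: "x \<in> points L" shows "bilinear (induced_metric M g L x)"
  using bl[OF x] linear_incl[OF x] unfolding bilinear_def induced_metric_def
  by (auto intro!: linear_compose[of "incl_deriv L M x", unfolded o_def])

lemma induced_eqI:
  assumes x: "x \<in> points L" and eq: "\<And>z. induced_metric M g L x u z = induced_metric M g L x w z"
  shows "u = w"
proof -
  have "g x (incl_deriv L M x (u - w)) (incl_deriv L M x (u - w)) = 0"
    using eq[of "u - w"] by (simp add: induced_metric_def linear_diff[OF linear_incl[OF x]] bilinear_lsub[OF bl[OF x]])
  then have "incl_deriv L M x u = incl_deriv L M x w"
    using gzero[OF x] by (fastforce simp: linear_diff[OF linear_incl[OF x]])
  then show ?thesis using inj_incl[OF x] by (auto dest: injD)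
qed

text \<open>Riesz representation for the induced metric; the functional to be represented is linear
  because the curvature is tensorial in its directions.\<close>

lemma adjoint_curvature_eq:
  assumes x: "x \<in> points L" and a: "a \<in> normal_space M g L x"
  shows "induced_metric M g L x (adjoint_curvature M g L Dn x a b u) z = g x (normal_curvature M g L Dn x u z a) b"
proof -
  let ?I = "induced_metric M g L x"
  let ?\<phi> = "\<lambda>z. g x (normal_curvature M g L Dn x u z a) b"
  obtain \<xi> where \<xi>: "normal_sec \<xi>" "\<xi> x = a" by (rule normal_sec_extension[OF x a])
  obtain X where X: "vector_field L X" "X x = u" by (rule vector_field_extension[OF x])
  \<comment> \<open>Z is moved into the first slot, where additivity and homogeneity are
    known.\<close>
  have R: "normal_curvature M g L Dn x u (Z x) a = - curvature L Dn Z X \<xi> x" if "vector_field L Z" for Z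
    using normal_curvature_eq[OF X(1) that \<xi>(1) x] curvature_swap[OF that X(1) \<xi>(1) x] by (simp add: X \<xi>)
  have lin: "linear ?\<phi>"
  proof (rule linearI)
    fix z z' c
    obtain Z where Z: "vector_field L Z" "Z x = z" by (rule vector_field_extension[OF x])
    obtain Z' where Z': "vector_field L Z'" "Z' x = z'" by (rule vector_field_extension[OF x])
    show "?\<phi> (z + z') = ?\<phi> z + ?\<phi> z'"
      using R[OF Z(1)] R[OF Z'(1)] R[OF vector_field_add[OF Z(1) Z'(1)]]
      by (simp add: Z Z' curvature_add[OF Z(1) Z'(1) X(1) \<xi>(1) x] bilinear_lsub[OF bl[OF x]] bilinear_lneg[OF bl[OF x]])
    note c = msmooth_const[OF atlas_L, of c]
    show "?\<phi> (c *\<^sub>R z) = c *\<^sub>R ?\<phi> z"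
      using R[OF Z(1)] R[OF vector_field_scaleR[OF c Z(1)]]
      by (simp add: Z curvature_scale[OF Z(1) X(1) \<xi>(1) x c] bilinear_lmul[OF bl[OF x]] bilinear_lneg[OF bl[OF x]])
  qed
  note bi = bilinear_induced[OF x]
  \<comment> \<open>The induced metric as an operator for the Euclidean product; injective by
    positivity, hence onto, which yields the representing vector.\<close>
  define G where "G w = (\<Sum>b\<in>Basis. ?I w b *\<^sub>R b)" for w
  have Gin: "G w \<bullet> z = ?I w z" for w z
  proof -
    have "linear (?I w)" using bi by (simp add: bilinear_def)
    from linear_sum_Basis[OF this, of z] show ?thesis by (simp add: G_def inner_sum_left inner_commute[of z] mult.commute)
  qed
  have "linear G"
    by (rule linearI; rule vector_eq_rdot[THEN iffD1]; intro allI)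
      (simp_all add: Gin inner_add_left bilinear_ladd[OF bi] bilinear_lmul[OF bi])
  moreover have "inj G" by (rule injI, rule induced_eqI[OF x]) (metis Gin)
  ultimately have "surj G" by (rule linear_injective_imp_surjective[OF _ _ refl])
  then obtain w where "G w = (\<Sum>b\<in>Basis. ?\<phi> b *\<^sub>R b)" by (metis surjD)
  then have w: "?I w z = ?\<phi> z" for z
    using Gin[of w z] linear_sum_Basis[OF lin, of z] by (simp add: inner_sum_left inner_commute[of z] mult.commute)
  have "adjoint_curvature M g L Dn x a b u = w"
    unfolding adjoint_curvature_def by (rule the_equality) (use w induced_eqI[OF x] in \<open>auto\<close>)
  then show ?thesis by (simp add: w)
qed

end

section \<open>The normal bundle\<close>

context riemannian_submanifold
begin

text \<open>Smoothness is tested in all charts of L over W, as the general lemmas expect; the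
  definition of \<open>normal_bundle\<close> tests the one chart \<open>(W, \<phi>)\<close>.\<close>

definition nframe :: "'m set \<Rightarrow> ('m \<Rightarrow> 'l) \<Rightarrow> ('m \<Rightarrow> 'k::euclidean_space \<Rightarrow> 'e) \<Rightarrow> bool" where
  "nframe W \<phi> e \<longleftrightarrow> (\<exists>U. (U, \<phi>) \<in> L \<and> W \<subseteq> U) \<and> mopen L W \<and>
     (\<forall>x\<in>W. linear (e x) \<and> inj (e x) \<and> range (e x) = normal_space M g L x) \<and>
     (\<forall>t. smooth_along (restr L W) M (\<lambda>x. e x t))"

definition nchart :: "'m set \<Rightarrow> ('m \<Rightarrow> 'l) \<Rightarrow> ('m \<Rightarrow> 'k::euclidean_space \<Rightarrow> 'e) \<Rightarrow> ('m \<times> 'e, 'l \<times> 'k) chart" where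
  "nchart W \<phi> e = (Sigma W (normal_space M g L), \<lambda>(x, v). (\<phi> x, inv (e x) v))"

text \<open>Smoothness of the frame in the single chart of the definition spreads to all charts of L
  through the transition maps.\<close>

lemma normal_bundle_chart:
  fixes c :: "('m \<times> 'e, 'l \<times> 'k::euclidean_space) chart"
  assumes c: "c \<in> normal_bundle M g L"
  obtains W \<phi> and e :: "'m \<Rightarrow> 'k \<Rightarrow> 'e" where "nframe W \<phi> e" "c = nchart W \<phi> e"
proof -
  obtain U \<phi> W and e :: "'m \<Rightarrow> 'k \<Rightarrow> 'e" where 1: "c = nchart W \<phi> e" "(U, \<phi>) \<in> L" "W \<subseteq> U" "open (\<phi> ` W)"
    "\<forall>x\<in>W. linear (e x) \<and> bij_betw (e x) UNIV (normal_space M g L x)"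
    "\<forall>t. smooth_along {(W, \<phi>)} M (\<lambda>x. e x t)"
    using c unfolding normal_bundle_def nchart_def by auto
  have inj: "inj_on \<phi> U" using smooth_atlasD(1)[OF atlas_L 1(2)] by simp
  have W: "{y \<in> U. \<phi> y \<in> \<phi> ` T} = T" if "T \<subseteq> U" for T using inj that by (auto simp: inj_on_def subset_iff)
  have mW: "mopen L W" using mopen_chart_preimage[OF atlas_L 1(2,4)] W[OF 1(3)] by simp
  have "smooth_along (restr L W) M (\<lambda>x. e x t)" for t
    unfolding smooth_along_restr_iff[OF LM mW]
  proof
    fix d assume d: "d \<in> M"
    let ?T = "W \<inter> fst d"
    have TU: "?T \<subseteq> U" using 1 by auto
    have "mopen L ?T" by (rule mopen_Int[OF atlas_L mW minclusionD(4)[OF LM d]])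
    moreover have "U \<inter> ?T = ?T" using TU by blast
    ultimately have oT: "open (\<phi> ` ?T)" using 1(2) unfolding mopen_def by (metis fst_conv snd_conv)
    let ?h = "\<lambda>u. coord_change (chart_at M (chart_inv (W, \<phi>) u)) d (chart_inv (W, \<phi>) u) (e (chart_inv (W, \<phi>) u) t)"
    have sh: "smooth_on (\<phi> ` ?T) ?h" using 1(6) d unfolding smooth_along_def by auto
    have "msmooth (restr L {y \<in> fst (U, \<phi>). snd (U, \<phi>) y \<in> \<phi> ` ?T}) (\<lambda>y. mderiv M (snd d) y (e y t))"
    proof (rule msmooth_in_chart[OF atlas_L 1(2) oT sh])
      fix y assume y: "y \<in> fst (U, \<phi>)" "snd (U, \<phi>) y \<in> \<phi> ` ?T"
      then have "y \<in> ?T" using W[OF TU] by auto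
      moreover have "inj_on \<phi> W" using inj_on_subset[OF inj 1(3)] .
      ultimately have "chart_inv (W, \<phi>) (\<phi> y) = y" using chart_inv_apply[of "(W, \<phi>)" y] by simp
      then show "mderiv M (snd d) y (e y t) = ?h (snd (U, \<phi>) y)" by (simp add: coord_change_eq)
    qed
    then show "msmooth (restr L (W \<inter> fst d)) (\<lambda>y. mderiv M (snd d) y (e y t))" using W[OF TU] by simp
  qed
  then have "nframe W \<phi> e" unfolding nframe_def using 1 mW by (auto simp: bij_betw_def)
  then show ?thesis using that 1 by blast
qed

section \<open>Bundle charts given by normal frames\<close>

lemma nframeD:
  assumes "nframe W \<phi> e"
  shows "mopen L W" "x \<in> W \<Longrightarrow> linear (e x)" "x \<in> W \<Longrightarrow> inj (e x)" "x \<in> W \<Longrightarrow> range (e x) = normal_space M g L x"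
    "smooth_along (restr L W) M (\<lambda>x. e x t)"
  using assms by (auto simp: nframe_def)

lemma nframe_points: "nframe W \<phi> e \<Longrightarrow> x \<in> W \<Longrightarrow> x \<in> points L"
  using points_chart[of _ L x] by (fastforce simp: nframe_def)

lemma nframe_chart:
  assumes "nframe W \<phi> e" obtains U where "(U, \<phi>) \<in> L" "W \<subseteq> U"
  using assms by (auto simp: nframe_def)

lemma nframe_inv:
  assumes "nframe W \<phi> e" "x \<in> W"
  shows "inv (e x) (e x t) = t" "v \<in> normal_space M g L x \<Longrightarrow> e x (inv (e x) v) = v"
  using nframeD(3,4)[OF assms(1,2)] by (auto simp: f_inv_into_f)

lemma nframe_inj: "nframe W \<phi> e \<Longrightarrow> inj_on \<phi> W"
  using nframe_chart smooth_atlasD(1)[OF atlas_L] by (metis fst_conv snd_conv inj_on_subset)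

lemma fst_nchart [simp]: "\<theta> \<in> fst (nchart W \<phi> e) \<longleftrightarrow> fst \<theta> \<in> W \<and> snd \<theta> \<in> normal_space M g L (fst \<theta>)"
  by (cases \<theta>) (simp add: nchart_def)

lemma snd_nchart [simp]: "snd (nchart W \<phi> e) \<theta> = (\<phi> (fst \<theta>), inv (e (fst \<theta>)) (snd \<theta>))"
  by (simp add: nchart_def case_prod_beta)

lemma nchart_inj:
  assumes "nframe W \<phi> e" shows "inj_on (snd (nchart W \<phi> e)) (fst (nchart W \<phi> e))"
proof (rule inj_onI)
  fix a b assume *: "a \<in> fst (nchart W \<phi> e)" "b \<in> fst (nchart W \<phi> e)" "snd (nchart W \<phi> e) a = snd (nchart W \<phi> e) b"
  then have "fst a = fst b" using nframe_inj[OF assms] by (auto dest: inj_onD)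
  moreover from this * have "snd a = snd b" using nframe_inv(2)[OF assms] by (metis fst_nchart snd_nchart snd_conv)
  ultimately show "a = b" by (simp add: prod_eq_iff)
qed

lemma nchart_image:
  assumes "nframe W \<phi> e"
  shows "snd (nchart W \<phi> e) ` (fst (nchart W \<phi> e) \<inter> {\<theta>. fst \<theta> \<in> S}) = \<phi> ` (W \<inter> S) \<times> UNIV"
proof safe
  fix x t assume x: "x \<in> W" "x \<in> S"
  show "(\<phi> x, t) \<in> snd (nchart W \<phi> e) ` (fst (nchart W \<phi> e) \<inter> {\<theta>. fst \<theta> \<in> S})"
    by (rule image_eqI[of _ _ "(x, e x t)"]) (use x nframe_inv[OF assms x(1)] nframeD(4)[OF assms x(1)] in auto)
qed auto

lemma nchart_image_UNIV:
  assumes "nframe W \<phi> e" shows "snd (nchart W \<phi> e) ` fst (nchart W \<phi> e) = \<phi> ` W \<times> UNIV"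
  using nchart_image[OF assms, of UNIV] by simp

lemma nchart_inv:
  assumes "nframe W \<phi> e" "x \<in> W" shows "chart_inv (nchart W \<phi> e) (\<phi> x, t) = (x, e x t)"
proof -
  have "e x t \<in> normal_space M g L x" using nframeD(4)[OF assms] by blast
  then show ?thesis
    using chart_inv_apply[OF nchart_inj[OF assms(1)], of "(x, e x t)"] nframe_inv(1)[OF assms] assms(2) by simp
qed

lemma nframe_open_image: assumes "nframe W \<phi> e" "mopen L S" shows "open (\<phi> ` (W \<inter> S))"
proof -
  obtain U where U: "(U, \<phi>) \<in> L" "W \<subseteq> U" by (rule nframe_chart[OF assms(1)])
  have "open (\<phi> ` (U \<inter> (W \<inter> S)))"
    using mopen_Int[OF atlas_L nframeD(1)[OF assms(1)] assms(2)] U(1) unfolding mopen_def by (metis fst_conv snd_conv)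
  moreover have "U \<inter> (W \<inter> S) = W \<inter> S" using U by blast
  ultimately show ?thesis by simp
qed

lemma nchart_smooth_base:
  assumes e: "nframe W \<phi> e" and S: "mopen L S" and h: "msmooth (restr L (W \<inter> S)) h"
  shows "smooth_on (\<phi> ` (W \<inter> S) \<times> UNIV) (\<lambda>z. h (fst (chart_inv (nchart W \<phi> e) z)))"
proof -
  obtain U where U: "(U, \<phi>) \<in> L" "W \<subseteq> U" by (rule nframe_chart[OF e])
  have m: "mopen L (W \<inter> S)" by (rule mopen_Int[OF atlas_L nframeD(1)[OF e] S])
  have o: "open (\<phi> ` (W \<inter> S))" by (rule nframe_open_image[OF e S])
  have "smooth_on (snd (U, \<phi>) ` (fst (U, \<phi>) \<inter> (W \<inter> S))) (\<lambda>u. h (chart_inv (U, \<phi>) u))"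
    using h U(1) unfolding msmooth_restr_iff[OF atlas_L m] by blast
  moreover have "U \<inter> (W \<inter> S) = W \<inter> S" using U by blast
  ultimately have s: "smooth_on (\<phi> ` (W \<inter> S)) (\<lambda>u. h (chart_inv (U, \<phi>) u))" by simp
  have "smooth_on (\<phi> ` (W \<inter> S) \<times> UNIV) (\<lambda>z. h (chart_inv (U, \<phi>) (fst z)))"
    by (rule smooth_on_compose[OF _ o s smooth_on_fst[OF _ smooth_on_id]]) (auto intro!: open_Times o)
  moreover have "chart_inv (U, \<phi>) (\<phi> x) = x" if "x \<in> W" for x
    using chart_inv_apply_atlas[OF atlas_L U(1), of x] that U(2) by auto
  ultimately show ?thesis
    by (subst smooth_on_cong[of _ _ "\<lambda>z. h (chart_inv (U, \<phi>) (fst z))"]) (auto intro!: open_Times o simp: nchart_inv[OF e])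
qed

text \<open>In a bundle chart the pairing with a section is linear in the fibre coordinate, with
  coefficients that depend smoothly on the base point.\<close>

lemma nchart_smooth_pair:
  fixes e :: "'m \<Rightarrow> 'k::euclidean_space \<Rightarrow> 'e"
  assumes e: "nframe W \<phi> e" and S: "mopen L S" and \<zeta>: "smooth_along (restr L (W \<inter> S)) M \<zeta>"
  shows "smooth_on (\<phi> ` (W \<inter> S) \<times> UNIV) (\<lambda>z. g (fst (chart_inv (nchart W \<phi> e) z)) (snd (chart_inv (nchart W \<phi> e) z))
    (\<zeta> (fst (chart_inv (nchart W \<phi> e) z))))"
proof -
  have m: "mopen L (W \<inter> S)" by (rule mopen_Int[OF atlas_L nframeD(1)[OF e] S])
  have o: "open (\<phi> ` (W \<inter> S) \<times> (UNIV :: 'k set))" by (intro open_Times nframe_open_image[OF e S] open_UNIV)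
  have "smooth_along (restr L (W \<inter> S)) M (\<lambda>x. e x a)" for a
    by (rule smooth_along_subset[OF LM nframeD(1)[OF e] m _ nframeD(5)[OF e]]) auto
  then have h: "msmooth (restr L (W \<inter> S)) (\<lambda>x. g x (e x a) (\<zeta> x))" for a
    by (intro msmooth_metric[OF minclusion_restr[OF LM m] g] \<zeta>)
  have "smooth_on (\<phi> ` (W \<inter> S) \<times> UNIV) (\<lambda>z. \<Sum>a\<in>Basis. (snd z \<bullet> a) *
      g (fst (chart_inv (nchart W \<phi> e) z)) (e (fst (chart_inv (nchart W \<phi> e) z)) a) (\<zeta> (fst (chart_inv (nchart W \<phi> e) z))))"
    by (intro smooth_on_sum[OF o] smooth_on_mult[OF o] smooth_on_inner_left[OF o] smooth_on_snd[OF o] smooth_on_id[OF o]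
        nchart_smooth_base[OF e S h])
  moreover have "(\<Sum>a\<in>Basis. (t \<bullet> a) * g x (e x a) (\<zeta> x)) = g x (e x t) (\<zeta> x)" if x: "x \<in> W" for x t
  proof -
    have "linear (\<lambda>v. g x v (\<zeta> x))" using bl[OF nframe_points[OF e x]] by (simp add: bilinear_def)
    then have "linear (\<lambda>t. g x (e x t) (\<zeta> x))"
      using linear_compose[OF nframeD(2)[OF e x]] by (simp add: o_def)
    from linear_sum_Basis[OF this, of t] show ?thesis by simp
  qed
  ultimately show ?thesis
    by (subst smooth_on_cong[OF o, symmetric]) (auto simp: nchart_inv[OF e])
qed

text \<open>Fibre coordinates become pairings with smooth normal sections; their smoothness is
  always obtained through this reduction.\<close>

lemma nframe_dual:
  fixes e :: "'m \<Rightarrow> 'k::euclidean_space \<Rightarrow> 'e"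
  assumes e: "nframe W \<phi> e"
  obtains \<epsilon> :: "'m \<Rightarrow> 'k \<Rightarrow> 'e" where "\<And>s. smooth_along (restr L W) M (\<lambda>x. \<epsilon> x s)"
    "\<And>x s. x \<in> W \<Longrightarrow> \<epsilon> x s \<in> normal_space M g L x"
    "\<And>x v b. x \<in> W \<Longrightarrow> v \<in> normal_space M g L x \<Longrightarrow> inv (e x) v \<bullet> b = g x v (\<epsilon> x b)"
proof -
  note eD = nframeD[OF e]
  note SM = minclusion_restr[OF LM eD(1)]
  obtain \<epsilon> where \<epsilon>: "\<And>s. smooth_along (restr L W) M (\<lambda>x. \<epsilon> x s)"
    "\<And>x s. x \<in> points (restr L W) \<Longrightarrow> \<epsilon> x s \<in> range (e x)"
    "\<And>x s t. x \<in> points (restr L W) \<Longrightarrow> g x (e x t) (\<epsilon> x s) = t \<bullet> s"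
    by (rule dual_frame[OF SM g eD(5)]) (auto intro: eD)
  show ?thesis
  proof (rule that[OF \<epsilon>(1)])
    fix x s assume x: "x \<in> W"
    then have xp: "x \<in> points (restr L W)" using nframe_points[OF e] by simp
    show "\<epsilon> x s \<in> normal_space M g L x" using \<epsilon>(2)[OF xp] eD(4)[OF x] by auto
    fix v b assume v: "v \<in> normal_space M g L x"
    show "inv (e x) v \<bullet> b = g x v (\<epsilon> x b)"
      using \<epsilon>(3)[OF xp, of "inv (e x) v" b] by (simp add: nframe_inv(2)[OF e x v])
  qed
qed

end

locale normal_bundle_atlas = normal_conn M g L Dn
  for M :: "('m, 'e::euclidean_space) atlas" and g :: "'m \<Rightarrow> 'e \<Rightarrow> 'e \<Rightarrow> real"
    and L :: "('m, 'l::euclidean_space) atlas" and Dn :: "('m \<Rightarrow> 'l) \<Rightarrow> ('m \<Rightarrow> 'e) \<Rightarrow> 'm \<Rightarrow> 'e" +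
  fixes N :: "('m \<times> 'e, 'l \<times> 'k::euclidean_space) atlas"
  assumes N: "N = normal_bundle M g L"
begin

lemma N_chart:
  assumes "c \<in> N" obtains W \<phi> and e :: "'m \<Rightarrow> 'k \<Rightarrow> 'e" where "nframe W \<phi> e" "c = nchart W \<phi> e"
  using normal_bundle_chart[of c] assms N by metis

lemma N_points: "\<theta> \<in> points N \<Longrightarrow> fst \<theta> \<in> points L \<and> snd \<theta> \<in> normal_space M g L (fst \<theta>)"
  unfolding points_def[of N] by (auto elim!: N_chart dest: nframe_points)

text \<open>In a coordinate change the base part depends on the base point alone, and each fibre
  component is a pairing with the frame dual to that of the target chart.\<close>

lemma atlas_N: "smooth_atlas N"
  unfolding smooth_atlas_def
proof (intro conjI ballI)
  fix c assume "c \<in> N"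
  then obtain W \<phi> and e :: "'m \<Rightarrow> 'k \<Rightarrow> 'e" where e: "nframe W \<phi> e" and c: "c = nchart W \<phi> e" by (rule N_chart)
  show "inj_on (snd c) (fst c)" unfolding c by (rule nchart_inj[OF e])
  show "open (snd c ` fst c)"
    using nframe_open_image[OF e mopen_UNIV[OF atlas_L]] unfolding c nchart_image_UNIV[OF e]
    by (intro open_Times) auto
  fix d assume "d \<in> N"
  then obtain W' \<phi>' and e' :: "'m \<Rightarrow> 'k \<Rightarrow> 'e" where e': "nframe W' \<phi>' e'" and d: "d = nchart W' \<phi>' e'" by (rule N_chart)
  note W' = nframeD(1)[OF e']
  have eq: "snd c ` (fst c \<inter> fst d) = \<phi> ` (W \<inter> W') \<times> UNIV"
  proof -
    have "fst c \<inter> fst d = fst c \<inter> {\<theta>. fst \<theta> \<in> W'}" by (auto simp: c d)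
    then show ?thesis unfolding c using nchart_image[OF e, of W'] by simp
  qed
  show o: "open (snd c ` (fst c \<inter> fst d))"
    unfolding eq by (intro open_Times nframe_open_image[OF e W'] open_UNIV)
  obtain \<epsilon> where \<epsilon>: "\<And>s. smooth_along (restr L W') M (\<lambda>x. \<epsilon> x s)"
    "\<And>x v b. x \<in> W' \<Longrightarrow> v \<in> normal_space M g L x \<Longrightarrow> inv (e' x) v \<bullet> b = g x v (\<epsilon> x b)"
    using nframe_dual[OF e'] by metis
  obtain U' where U': "(U', \<phi>') \<in> L" "W' \<subseteq> U'" by (rule nframe_chart[OF e'])
  have m: "mopen L (W \<inter> W')" by (rule mopen_Int[OF atlas_L nframeD(1)[OF e] W'])
  have "msmooth (restr L U') \<phi>'" using msmooth_chart_coord[OF atlas_L U'(1)] by simp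
  then have \<phi>': "msmooth (restr L (W \<inter> W')) \<phi>'"
    by (rule msmooth_subset[OF atlas_L _ m, rotated -1]) (use U' mopen_chart[OF atlas_L U'(1)] in auto)
  have 1: "smooth_on (snd c ` (fst c \<inter> fst d)) (\<lambda>z. \<phi>' (fst (chart_inv c z)))"
    unfolding eq unfolding c by (rule nchart_smooth_base[OF e W' \<phi>'])
  have 2: "smooth_on (snd c ` (fst c \<inter> fst d)) (\<lambda>z. inv (e' (fst (chart_inv c z))) (snd (chart_inv c z)))"
  proof (rule smooth_on_componentwise[OF o])
    fix b :: 'k
    have "smooth_along (restr L (W \<inter> W')) M (\<lambda>x. \<epsilon> x b)"
      by (rule smooth_along_subset[OF LM W' m _ \<epsilon>(1)]) auto
    from nchart_smooth_pair[OF e W' this]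
    have "smooth_on (snd c ` (fst c \<inter> fst d)) (\<lambda>z. g (fst (chart_inv c z)) (snd (chart_inv c z)) (\<epsilon> (fst (chart_inv c z)) b))"
      unfolding eq unfolding c .
    then show "smooth_on (snd c ` (fst c \<inter> fst d)) (\<lambda>z. inv (e' (fst (chart_inv c z))) (snd (chart_inv c z)) \<bullet> b)"
    proof (rule smooth_on_cong[OF o, THEN iffD1, rotated])
      fix z assume "z \<in> snd c ` (fst c \<inter> fst d)"
      then obtain \<theta> where \<theta>: "\<theta> \<in> fst c" "\<theta> \<in> fst d" "z = snd c \<theta>" by auto
      then have "chart_inv c z = \<theta>" using chart_inv_apply[OF nchart_inj[OF e]] c by simp
      then show "g (fst (chart_inv c z)) (snd (chart_inv c z)) (\<epsilon> (fst (chart_inv c z)) b) =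
          inv (e' (fst (chart_inv c z))) (snd (chart_inv c z)) \<bullet> b"
        using \<theta> \<epsilon>(2) by (simp add: d)
    qed
  qed
  show "smooth_on (snd c ` (fst c \<inter> fst d)) (\<lambda>u. snd d (chart_inv c u))"
    using smooth_on_Pair[OF o 1 2] by (simp add: d)
qed

section \<open>Smooth functions on the normal bundle\<close>

lemma mopen_N: assumes "mopen L S" shows "mopen N {\<theta>. fst \<theta> \<in> S}"
  unfolding mopen_def
proof
  fix c assume "c \<in> N"
  then obtain W \<phi> and e :: "'m \<Rightarrow> 'k \<Rightarrow> 'e" where e: "nframe W \<phi> e" and c: "c = nchart W \<phi> e" by (rule N_chart)
  show "open (snd c ` (fst c \<inter> {\<theta>. fst \<theta> \<in> S}))"
    unfolding c nchart_image[OF e] by (intro open_Times nframe_open_image[OF e assms] open_UNIV)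
qed

lemma msmooth_N_base:
  assumes S: "mopen L S" and h: "msmooth (restr L S) h"
  shows "msmooth (restr N {\<theta>. fst \<theta> \<in> S}) (\<lambda>\<theta>. h (fst \<theta>))"
  unfolding msmooth_restr_iff[OF atlas_N mopen_N[OF S]]
proof
  fix c assume "c \<in> N"
  then obtain W \<phi> and e :: "'m \<Rightarrow> 'k \<Rightarrow> 'e" where e: "nframe W \<phi> e" and c: "c = nchart W \<phi> e" by (rule N_chart)
  have "msmooth (restr L (W \<inter> S)) h"
    by (rule msmooth_subset[OF atlas_L S mopen_Int[OF atlas_L nframeD(1)[OF e] S] _ h]) auto
  then show "smooth_on (snd c ` (fst c \<inter> {\<theta>. fst \<theta> \<in> S})) (\<lambda>u. h (fst (chart_inv c u)))"
    unfolding c nchart_image[OF e] by (rule nchart_smooth_base[OF e S])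
qed

lemma msmooth_N_fst: "msmooth L h \<Longrightarrow> msmooth N (\<lambda>\<theta>. h (fst \<theta>))"
  using msmooth_N_base[OF mopen_UNIV[OF atlas_L], of h] by simp

definition pair :: "('m \<Rightarrow> 'e) \<Rightarrow> 'm \<times> 'e \<Rightarrow> real" where
  "pair \<zeta> \<theta> = g (fst \<theta>) (snd \<theta>) (\<zeta> (fst \<theta>))"

lemma msmooth_N_pair:
  assumes \<zeta>: "smooth_along L M \<zeta>" shows "msmooth N (pair \<zeta>)"
  unfolding msmooth_def
proof
  fix c assume "c \<in> N"
  then obtain W \<phi> and e :: "'m \<Rightarrow> 'k \<Rightarrow> 'e" where e: "nframe W \<phi> e" and c: "c = nchart W \<phi> e" by (rule N_chart)
  have "smooth_along (restr L (W \<inter> UNIV)) M \<zeta>" using smooth_along_restr[OF LM nframeD(1)[OF e] \<zeta>] by simp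
  from nchart_smooth_pair[OF e mopen_UNIV[OF atlas_L] this]
  show "smooth_on (snd c ` fst c) (\<lambda>u. pair \<zeta> (chart_inv c u))"
    unfolding c nchart_image_UNIV[OF e] pair_def by simp
qed

lemma msmooth_N_norm: "msmooth N (\<lambda>\<theta>. g (fst \<theta>) (snd \<theta>) (snd \<theta>))"
  unfolding msmooth_def
proof
  fix c assume "c \<in> N"
  then obtain W \<phi> and e :: "'m \<Rightarrow> 'k \<Rightarrow> 'e" where e: "nframe W \<phi> e" and c: "c = nchart W \<phi> e" by (rule N_chart)
  have o: "open (\<phi> ` W \<times> (UNIV :: 'k set))"
    using nframe_open_image[OF e mopen_UNIV[OF atlas_L]] by (auto intro!: open_Times)
  \<comment> \<open>With fibre coordinates t and frame \<open>e\<close>, |\<theta>|^2 is the sum of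
    the t_a <\<theta>, e_a>; expanding one argument is enough since pairings are already
    smooth.\<close>
  have "smooth_on (\<phi> ` W \<times> UNIV) (\<lambda>z. \<Sum>a\<in>Basis. (snd z \<bullet> a) * pair (\<lambda>x. e x a) (chart_inv c z))"
    using nchart_smooth_pair[OF e mopen_UNIV[OF atlas_L], of "\<lambda>x. e x _"] nframeD(5)[OF e]
    by (intro smooth_on_sum[OF o] smooth_on_mult[OF o] smooth_on_inner_left[OF o] smooth_on_snd[OF o] smooth_on_id[OF o])
      (simp add: pair_def c)
  moreover have "(\<Sum>a\<in>Basis. (t \<bullet> a) * pair (\<lambda>x. e x a) (x, e x t)) = g x (e x t) (e x t)" if x: "x \<in> W" for x t
  proof -
    have "linear (g x (e x t))" using bl[OF nframe_points[OF e x]] by (simp add: bilinear_def)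
    then have "linear (\<lambda>s. g x (e x t) (e x s))" using linear_compose[OF nframeD(2)[OF e x]] by (simp add: o_def)
    from linear_sum_Basis[OF this, of t] show ?thesis by (simp add: pair_def)
  qed
  ultimately show "smooth_on (snd c ` fst c) (\<lambda>z. g (fst (chart_inv c z)) (snd (chart_inv c z)) (snd (chart_inv c z)))"
    unfolding c nchart_image_UNIV[OF e]
    by (subst smooth_on_cong[OF o, symmetric]) (auto simp: nchart_inv[OF e])
qed

definition gens :: "('m \<times> 'e \<Rightarrow> real) set" where
  "gens = {\<lambda>\<theta>. f (fst \<theta>) | f. msmooth L f} \<union> {pair \<zeta> | \<zeta>. normal_sec \<zeta>}"

lemma gens_cases:
  assumes "F \<in> gens"
  obtains f where "msmooth L f" "F = (\<lambda>\<theta>. f (fst \<theta>))" | \<zeta> where "normal_sec \<zeta>" "F = pair \<zeta>"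
  using assms by (auto simp: gens_def)

text \<open>Base coordinates come from functions on L, fibre coordinates from pairings with a dual
  frame. Both are cut off on L, so agreement holds over the preimage of V.\<close>

lemma generates_N: "generates N gens"
  unfolding generates_def
proof (intro conjI ballI)
  fix F assume "F \<in> gens" then show "msmooth N F"
    by (cases rule: gens_cases) (auto intro: msmooth_N_fst msmooth_N_pair normal_sec_smooth)
next
  fix d \<theta> and b :: "'l \<times> 'k" assume d: "d \<in> N" "\<theta> \<in> fst d" and b: "b \<in> Basis"
  obtain W \<phi> and e :: "'m \<Rightarrow> 'k \<Rightarrow> 'e" where e: "nframe W \<phi> e" and de: "d = nchart W \<phi> e" using N_chart[OF d(1)] .
  let ?x = "fst \<theta>"
  have x: "?x \<in> W" using d de by simp
  have xL: "?x \<in> points L" using nframe_points[OF e x] .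
  obtain V \<rho> where \<rho>: "cutoff L W V \<rho>" "?x \<in> V"
    using cutoff_exists[OF L_manifold nframeD(1)[OF e] xL x] by blast
  note \<rho>' = cutoffD[OF \<rho>(1)]
  have \<rho>0: "\<rho> y = 0" if "y \<notin> W" for y using \<rho>(1) that by (auto simp: cutoff_def)
  note S = mopen_N[OF \<rho>'(3)]
  from b consider b1 where "b = (b1, 0)" | b2 where "b = (0, b2)" by (auto simp: Basis_prod_def)
  then show "\<exists>F\<in>gens. \<exists>S. mopen N S \<and> \<theta> \<in> S \<and> (\<forall>y\<in>S \<inter> fst d. F y = snd d y \<bullet> b)"
  proof cases
    case 1
    obtain U where U: "(U, \<phi>) \<in> L" "W \<subseteq> U" by (rule nframe_chart[OF e])
    have "msmooth (restr L U) \<phi>" using msmooth_chart_coord[OF atlas_L U(1)] by simp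
    then have "msmooth (restr L W) \<phi>"
      by (rule msmooth_subset[OF atlas_L _ nframeD(1)[OF e], rotated -1]) (use U mopen_chart[OF atlas_L U(1)] in auto)
    then have "msmooth L (\<lambda>y. \<rho> y *\<^sub>R (\<phi> y \<bullet> b1))"
      by (intro cutoff_msmooth[OF atlas_L \<rho>(1)] msmooth_inner smooth_atlas_restr atlas_L nframeD(1)[OF e])
    then have "(\<lambda>\<theta>. \<rho> (fst \<theta>) *\<^sub>R (\<phi> (fst \<theta>) \<bullet> b1)) \<in> gens"
      unfolding gens_def by (intro UnI1 CollectI exI[of _ "\<lambda>y. \<rho> y *\<^sub>R (\<phi> y \<bullet> b1)"]) simp
    then show ?thesis
      using S \<rho>(2) \<rho>'(5) by (intro bexI[of _ "\<lambda>\<theta>. \<rho> (fst \<theta>) *\<^sub>R (\<phi> (fst \<theta>) \<bullet> b1)"] exI[of _ "{\<theta>. fst \<theta> \<in> V}"])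
        (auto simp: de 1)
  next
    case 2
    obtain \<epsilon> where \<epsilon>: "\<And>s. smooth_along (restr L W) M (\<lambda>x. \<epsilon> x s)" "\<And>x s. x \<in> W \<Longrightarrow> \<epsilon> x s \<in> normal_space M g L x"
      "\<And>x v b. x \<in> W \<Longrightarrow> v \<in> normal_space M g L x \<Longrightarrow> inv (e x) v \<bullet> b = g x v (\<epsilon> x b)"
      using nframe_dual[OF e] by metis
    \<comment> \<open>The member of the dual frame that reads off the coordinate b2, made global by
      the cutoff.\<close>
    let ?z = "\<lambda>y. \<rho> y *\<^sub>R \<epsilon> y b2"
    have "?z y \<in> normal_space M g L y" if "y \<in> points L" for y
      by (cases "y \<in> W") (auto simp: \<rho>0 normal_space_scale normal_space_0 \<epsilon> that)
    then have "normal_sec ?z"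
      unfolding normal_section_def using cutoff_smooth_along[OF LM \<rho>(1) \<epsilon>(1)] by blast
    then have "pair ?z \<in> gens" unfolding gens_def by blast
    then show ?thesis
      using S \<rho>(2) \<rho>'(5) by (intro bexI[of _ "pair ?z"] exI[of _ "{\<theta>. fst \<theta> \<in> V}"])
        (auto simp: de 2 pair_def \<epsilon>(3))
  qed
qed

end

section \<open>The connection map and lifts\<close>

locale normal_bundle_conn = normal_bundle_atlas M g L Dn N
  for M :: "('m, 'e::euclidean_space) atlas" and g :: "'m \<Rightarrow> 'e \<Rightarrow> 'e \<Rightarrow> real"
    and L :: "('m, 'l::euclidean_space) atlas" and Dn :: "('m \<Rightarrow> 'l) \<Rightarrow> ('m \<Rightarrow> 'e) \<Rightarrow> 'm \<Rightarrow> 'e"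
    and N :: "('m \<times> 'e, 'l \<times> 'k::euclidean_space) atlas" +
  fixes K :: "'m \<times> 'e \<Rightarrow> 'l \<times> 'k \<Rightarrow> 'e"
  assumes K: "connection_map M g L N Dn K"
begin

text \<open>The velocity that occurs in \<open>connection_map\<close>: a vertical lift of w that
  involves no connection.\<close>

definition vert :: "'m \<times> 'e \<Rightarrow> 'e \<Rightarrow> 'l \<times> 'k" where
  "vert \<theta> w = vector_derivative (\<lambda>t. snd (chart_at N \<theta>) (fst \<theta>, snd \<theta> + t *\<^sub>R w)) (at 0)"

abbreviation "dpi \<equiv> differential N L fst"
abbreviation "sdiff \<xi> \<equiv> differential L N (\<lambda>y. (y, \<xi> y))"

lemma N_base: "\<theta> \<in> points N \<Longrightarrow> fst \<theta> \<in> points L" using N_points by blast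
lemma N_normal: "\<theta> \<in> points N \<Longrightarrow> snd \<theta> \<in> normal_space M g L (fst \<theta>)" using N_points by blast

lemma K_linear: "\<theta> \<in> points N \<Longrightarrow> linear (K \<theta>)"
  and K_in: "\<theta> \<in> points N \<Longrightarrow> K \<theta> A \<in> normal_space M g L (fst \<theta>)"
  and K_vert: "\<theta> \<in> points N \<Longrightarrow> w \<in> normal_space M g L (fst \<theta>) \<Longrightarrow> K \<theta> (vert \<theta> w) = w"
  and K_section: "vector_field L X \<Longrightarrow> normal_sec \<xi> \<Longrightarrow> x \<in> points L \<Longrightarrow> K (x, \<xi> x) (sdiff \<xi> x (X x)) = Dn X \<xi> x"
proof -
  note D = K[unfolded connection_map_def]
  show "\<theta> \<in> points N \<Longrightarrow> linear (K \<theta>)" "\<theta> \<in> points N \<Longrightarrow> K \<theta> A \<in> normal_space M g L (fst \<theta>)"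
    using bspec[OF conjunct1[OF D]] by (simp, blast)
  show "\<theta> \<in> points N \<Longrightarrow> w \<in> normal_space M g L (fst \<theta>) \<Longrightarrow> K \<theta> (vert \<theta> w) = w"
    using bspec[OF conjunct1[OF conjunct2[OF D]], of \<theta>] by (simp add: vert_def case_prod_beta)
  show "vector_field L X \<Longrightarrow> normal_sec \<xi> \<Longrightarrow> x \<in> points L \<Longrightarrow> K (x, \<xi> x) (sdiff \<xi> x (X x)) = Dn X \<xi> x"
    using conjunct2[OF conjunct2[OF D]] by blast
qed

section \<open>Tangent vectors of the normal bundle\<close>

lemma chart_at_N:
  assumes \<theta>: "\<theta> \<in> points N"
  obtains W \<phi> and e :: "'m \<Rightarrow> 'k \<Rightarrow> 'e" where "nframe W \<phi> e" "chart_at N \<theta> = nchart W \<phi> e" "fst \<theta> \<in> W"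
proof -
  note c = chart_at[OF \<theta>]
  obtain W \<phi> and e :: "'m \<Rightarrow> 'k \<Rightarrow> 'e" where e: "nframe W \<phi> e" "chart_at N \<theta> = nchart W \<phi> e" using N_chart[OF c(1)] .
  moreover have "fst \<theta> \<in> W" using c(2) unfolding e by simp
  ultimately show ?thesis using that by blast
qed

lemma nframe_inv_linear:
  assumes e: "nframe W \<phi> e" and x: "x \<in> W" and v: "v \<in> normal_space M g L x" and w: "w \<in> normal_space M g L x"
  shows "inv (e x) (v + t *\<^sub>R w) = inv (e x) v + t *\<^sub>R inv (e x) w"
proof -
  note lin = nframeD(2)[OF e x]
  have "e x (inv (e x) v + t *\<^sub>R inv (e x) w) = v + t *\<^sub>R w"
    by (simp add: linear_add[OF lin] linear_scale[OF lin] nframe_inv(2)[OF e x] v w)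
  then show ?thesis using nframe_inv(1)[OF e x] by metis
qed

lemma vert_eq:
  assumes \<theta>: "\<theta> \<in> points N" and w: "w \<in> normal_space M g L (fst \<theta>)"
    and e: "nframe W \<phi> e" "chart_at N \<theta> = nchart W \<phi> e" "fst \<theta> \<in> W"
  shows "vert \<theta> w = (0, inv (e (fst \<theta>)) w)"
  unfolding vert_def e(2)
  by (rule vector_derivative_at)
    (auto simp: nframe_inv_linear[OF e(1,3) N_normal[OF \<theta>] w] intro!: has_vector_derivative_Pair derivative_eq_intros)

text \<open>The fibre line stays in one bundle chart and is affine there, so the derivative is that
  of a function of one real variable.\<close>

lemma mderiv_vert:
  fixes F :: "'m \<times> 'e \<Rightarrow> real"
  assumes \<theta>: "\<theta> \<in> points N" and w: "w \<in> normal_space M g L (fst \<theta>)" and F: "msmooth N F"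
    and d: "((\<lambda>s. F (fst \<theta>, snd \<theta> + s *\<^sub>R w)) has_real_derivative k) (at 0)"
  shows "mderiv N F \<theta> (vert \<theta> w) = k"
proof -
  obtain W \<phi> and e :: "'m \<Rightarrow> 'k \<Rightarrow> 'e" where e: "nframe W \<phi> e" "chart_at N \<theta> = nchart W \<phi> e" "fst \<theta> \<in> W"
    by (rule chart_at_N[OF \<theta>])
  let ?c = "chart_at N \<theta>"
  note v = vert_eq[OF \<theta> w e]
  have hm: "has_mderiv N F \<theta> (mderiv N F \<theta>)" by (rule msmooth_has_mderiv_UNIV[OF atlas_N \<theta> F])
  then have "((\<lambda>u. F (chart_inv ?c u)) has_derivative mderiv N F \<theta>) (at (snd ?c \<theta> + 0 *\<^sub>R vert \<theta> w))"
    by (simp add: has_mderiv_def)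
  then have "((\<lambda>s. F (chart_inv ?c (snd ?c \<theta> + s *\<^sub>R vert \<theta> w))) has_derivative (\<lambda>s. mderiv N F \<theta> (s *\<^sub>R vert \<theta> w))) (at 0)"
    by (rule has_derivative_compose[where f = "\<lambda>s. snd ?c \<theta> + s *\<^sub>R vert \<theta> w", rotated]) (auto intro!: derivative_eq_intros)
  moreover have "F (chart_inv ?c (snd ?c \<theta> + s *\<^sub>R vert \<theta> w)) = F (fst \<theta>, snd \<theta> + s *\<^sub>R w)" for s
  proof -
    have "snd ?c \<theta> + s *\<^sub>R vert \<theta> w = (\<phi> (fst \<theta>), inv (e (fst \<theta>)) (snd \<theta> + s *\<^sub>R w))"
      by (simp add: v e(2) nframe_inv_linear[OF e(1,3) N_normal[OF \<theta>] w])
    moreover have "snd \<theta> + s *\<^sub>R w \<in> normal_space M g L (fst \<theta>)"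
      by (intro normal_space_add normal_space_scale N_base N_normal \<theta> w)
    ultimately show ?thesis by (simp add: e(2) nchart_inv[OF e(1,3)] nframe_inv(2)[OF e(1,3)])
  qed
  ultimately have "((\<lambda>s. F (fst \<theta>, snd \<theta> + s *\<^sub>R w)) has_real_derivative mderiv N F \<theta> (vert \<theta> w)) (at 0)"
    by (simp add: has_field_derivative_def linear_scale[OF has_mderiv_linear[OF hm]] mult_commute_abs)
  then show ?thesis using d by (rule DERIV_unique)
qed

text \<open>The chain rule for the section as a map into the bundle. Together with
  \<open>mderiv_vert\<close> this reaches all derivatives on the bundle, as velocities of the two
  kinds span.\<close>

lemma mderiv_section:
  fixes F :: "'m \<times> 'e \<Rightarrow> real"
  assumes \<xi>: "normal_sec \<xi>" and \<theta>: "\<theta> \<in> points N" "\<xi> (fst \<theta>) = snd \<theta>" and F: "msmooth N F"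
  shows "mderiv N F \<theta> (sdiff \<xi> (fst \<theta>) u) = mderiv L (\<lambda>y. F (y, \<xi> y)) (fst \<theta>) u"
proof -
  let ?x = "fst \<theta>"
  have xi: "(?x, \<xi> ?x) = \<theta>" using \<theta>(2) by (simp add: prod_eq_iff)
  note x = N_base[OF \<theta>(1)]
  obtain W \<phi> and e :: "'m \<Rightarrow> 'k \<Rightarrow> 'e" where e: "nframe W \<phi> e" "chart_at N \<theta> = nchart W \<phi> e" "?x \<in> W"
    by (rule chart_at_N[OF \<theta>(1)])
  note mW = nframeD(1)[OF e(1)]
  note R = smooth_atlas_restr[OF atlas_L mW]
  obtain \<epsilon> where \<epsilon>: "\<And>s. smooth_along (restr L W) M (\<lambda>x. \<epsilon> x s)"
    "\<And>x v b. x \<in> W \<Longrightarrow> v \<in> normal_space M g L x \<Longrightarrow> inv (e x) v \<bullet> b = g x v (\<epsilon> x b)"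
    using nframe_dual[OF e(1)] by metis
  obtain U where U: "(U, \<phi>) \<in> L" "W \<subseteq> U" by (rule nframe_chart[OF e(1)])
  have "msmooth (restr L U) \<phi>" using msmooth_chart_coord[OF atlas_L U(1)] by simp
  then have 1: "msmooth (restr L W) \<phi>"
    by (rule msmooth_subset[OF atlas_L _ mW, rotated -1]) (use U mopen_chart[OF atlas_L U(1)] in auto)
  \<comment> \<open>Fibre coordinates of the section are pairings with the dual frame.\<close>
  have 2: "msmooth (restr L W) (\<lambda>y. inv (e y) (\<xi> y))"
  proof (rule msmooth_componentwise[OF R])
    fix b
    have "msmooth (restr L W) (\<lambda>y. g y (\<xi> y) (\<epsilon> y b))"
      by (intro msmooth_metric[OF minclusion_restr[OF LM mW] g] \<epsilon> smooth_along_restr[OF LM mW] normal_sec_smooth \<xi>)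
    then show "msmooth (restr L W) (\<lambda>y. inv (e y) (\<xi> y) \<bullet> b)"
      by (rule msmooth_cong[OF R, THEN iffD1, rotated]) (use \<epsilon>(2) normal_sec_in[OF \<xi>] in auto)
  qed
  have 3: "msmooth (restr L W) (\<lambda>y. snd (chart_at N (?x, \<xi> ?x)) (y, \<xi> y))"
    unfolding xi e(2) using 1 2 R by (simp add: msmooth_def smooth_on_Pair smooth_atlasD)
  have "has_mderiv L (\<lambda>y. F (y, \<xi> y)) ?x (\<lambda>v. mderiv N F \<theta> (sdiff \<xi> ?x v))"
    by (rule mderiv_chain[OF atlas_L mW e(3) x atlas_N _ _ 3])
      (use xi \<theta>(1) e normal_sec_in[OF \<xi>] msmooth_has_mderiv_UNIV[OF atlas_N \<theta>(1) F] in auto)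
  from has_mderivD[OF this] show ?thesis by simp
qed

text \<open>The local form serves coordinate functions of L, which are smooth on a chart domain
  only.\<close>

lemma mderiv_dpi_local:
  assumes \<theta>: "\<theta> \<in> points N" and S: "mopen L S" "fst \<theta> \<in> S" and f: "msmooth (restr L S) f"
  shows "has_mderiv N (\<lambda>\<theta>. f (fst \<theta>)) \<theta> (\<lambda>A. mderiv L f (fst \<theta>) (dpi \<theta> A))"
proof -
  note x = N_base[OF \<theta>]
  note d = chart_at[OF x]
  note m = mopen_chart[OF atlas_L d(1)]
  show ?thesis
    by (rule mderiv_chain[OF atlas_N mopen_N[OF m] _ \<theta> atlas_L x _
          msmooth_N_base[OF m msmooth_chart_coord[OF atlas_L d(1)]] msmooth_has_mderiv[OF atlas_L S x f]])
      (use d in auto)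
qed

lemma mderiv_dpi:
  assumes \<theta>: "\<theta> \<in> points N" and f: "msmooth L f"
  shows "mderiv N (\<lambda>\<theta>. f (fst \<theta>)) \<theta> A = mderiv L f (fst \<theta>) (dpi \<theta> A)"
  using has_mderivD[OF mderiv_dpi_local[OF \<theta> mopen_UNIV[OF atlas_L] UNIV_I, of f]] f by simp

lemma dpi_linear: assumes \<theta>: "\<theta> \<in> points N" shows "linear (dpi \<theta>)"
proof -
  note d = chart_at[OF N_base[OF \<theta>]]
  note m = mopen_chart[OF atlas_L d(1)]
  show ?thesis unfolding differential_eq
    by (rule has_mderiv_linear[OF msmooth_has_mderiv[OF atlas_N mopen_N[OF m] _ \<theta>
            msmooth_N_base[OF m msmooth_chart_coord[OF atlas_L d(1)]]]]) (simp add: d)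
qed

lemma dpi_section:
  assumes \<xi>: "normal_sec \<xi>" and \<theta>: "\<theta> \<in> points N" "\<xi> (fst \<theta>) = snd \<theta>"
  shows "dpi \<theta> (sdiff \<xi> (fst \<theta>) u) = u"
proof (rule generates_separates[OF atlas_L generates_L N_base[OF \<theta>(1)]])
  fix f :: "'m \<Rightarrow> real" assume "f \<in> {f. msmooth L f}"
  then have f: "msmooth L f" by simp
  show "mderiv L f (fst \<theta>) (dpi \<theta> (sdiff \<xi> (fst \<theta>) u)) = mderiv L f (fst \<theta>) u"
    using mderiv_section[OF \<xi> \<theta> msmooth_N_fst[OF f]] by (simp add: mderiv_dpi[OF \<theta>(1) f])
qed

lemma dpi_vert:
  assumes \<theta>: "\<theta> \<in> points N" and w: "w \<in> normal_space M g L (fst \<theta>)"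
  shows "dpi \<theta> (vert \<theta> w) = 0"
proof (rule generates_separates[OF atlas_L generates_L N_base[OF \<theta>]])
  fix f :: "'m \<Rightarrow> real" assume "f \<in> {f. msmooth L f}"
  then have f: "msmooth L f" by simp
  have "mderiv L f (fst \<theta>) (dpi \<theta> (vert \<theta> w)) = 0"
    using mderiv_vert[OF \<theta> w msmooth_N_fst[OF f], of 0] by (simp add: mderiv_dpi[OF \<theta> f])
  then show "mderiv L f (fst \<theta>) (dpi \<theta> (vert \<theta> w)) = mderiv L f (fst \<theta>) 0"
    using linear_0[OF has_mderiv_linear[OF msmooth_has_mderiv_UNIV[OF atlas_L N_base[OF \<theta>] f]]] by simp
qed

text \<open>In a bundle chart the base component of A is the coordinate image of
  \<open>dpi \<theta> A\<close>; if it vanishes, A points along the fibre.\<close>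

lemma vert_exists:
  assumes \<theta>: "\<theta> \<in> points N" and A: "dpi \<theta> A = 0"
  obtains w where "w \<in> normal_space M g L (fst \<theta>)" "A = vert \<theta> w"
proof -
  obtain W \<phi> and e :: "'m \<Rightarrow> 'k \<Rightarrow> 'e" where e: "nframe W \<phi> e" "chart_at N \<theta> = nchart W \<phi> e" "fst \<theta> \<in> W"
    by (rule chart_at_N[OF \<theta>])
  note mW = nframeD(1)[OF e(1)]
  obtain U where U: "(U, \<phi>) \<in> L" "W \<subseteq> U" by (rule nframe_chart[OF e(1)])
  let ?c = "chart_at N \<theta>"
  note c = chart_at[OF \<theta>]
  \<comment> \<open>A is given by its components in the preferred chart, so the derivative of that
    chart leaves it unchanged.\<close>
  have self: "mderiv N (snd ?c) \<theta> A = A" using coord_change_self[OF atlas_N c] by (simp add: coord_change_eq)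
  have "msmooth (restr L U) \<phi>" using msmooth_chart_coord[OF atlas_L U(1)] by simp
  then have 1: "has_mderiv N (\<lambda>\<theta>. \<phi> (fst \<theta>)) \<theta> (\<lambda>A. mderiv L \<phi> (fst \<theta>) (dpi \<theta> A))"
    by (intro mderiv_dpi_local[OF \<theta>]) (use U e(3) mopen_chart[OF atlas_L U(1)] in auto)
  have "has_mderiv N (\<lambda>\<theta>'. fst (snd ?c \<theta>')) \<theta> (\<lambda>A. fst (mderiv N (snd ?c) \<theta> A))"
    by (rule has_mderiv_compose[OF atlas_N \<theta> has_mderiv_chart[OF atlas_N c]])
      (rule has_derivative_fst[OF has_derivative_ident])
  then have 2: "has_mderiv N (\<lambda>\<theta>. \<phi> (fst \<theta>)) \<theta> (\<lambda>A. fst (mderiv N (snd ?c) \<theta> A))" by (simp add: e(2))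
  have "fst A = mderiv L \<phi> (fst \<theta>) (dpi \<theta> A)"
    using fun_cong[OF trans[OF has_mderivD[OF 2, symmetric] has_mderivD[OF 1]], of A] by (simp add: self)
  also have "\<dots> = 0"
  proof -
    have "linear (mderiv L \<phi> (fst \<theta>))" using linear_mderiv_chart[OF atlas_L U(1), of "fst \<theta>"] U(2) e(3) by auto
    then show ?thesis unfolding A by (rule linear_0)
  qed
  finally have "fst A = 0" .
  have w: "e (fst \<theta>) (snd A) \<in> normal_space M g L (fst \<theta>)" using nframeD(4)[OF e(1,3)] by blast
  have "A = vert \<theta> (e (fst \<theta>) (snd A))"
    using \<open>fst A = 0\<close> by (simp add: vert_eq[OF \<theta> w e] nframe_inv(1)[OF e(1,3)] prod_eq_iff)
  then show ?thesis using w that by blast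
qed

text \<open>Subtracting the velocity of a section through \<theta> leaves a vertical vector. The
  section and w involve a choice; the expression for \<open>K \<theta> A\<close> follows from the
  two rules that prescribe K.\<close>

lemma decompose:
  assumes \<theta>: "\<theta> \<in> points N" and X: "vector_field L X" "X (fst \<theta>) = dpi \<theta> A"
  obtains \<xi> w where "normal_sec \<xi>" "\<xi> (fst \<theta>) = snd \<theta>" "w \<in> normal_space M g L (fst \<theta>)"
    "A = sdiff \<xi> (fst \<theta>) (X (fst \<theta>)) + vert \<theta> w" "K \<theta> A = Dn X \<xi> (fst \<theta>) + w"
proof -
  obtain \<xi> where \<xi>: "normal_sec \<xi>" "\<xi> (fst \<theta>) = snd \<theta>"
    by (rule normal_sec_extension[OF N_base[OF \<theta>] N_normal[OF \<theta>]])
  let ?B = "sdiff \<xi> (fst \<theta>) (X (fst \<theta>))"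
  have "dpi \<theta> (A - ?B) = 0"
    using dpi_section[OF \<xi>(1) \<theta> \<xi>(2)] by (simp add: linear_diff[OF dpi_linear[OF \<theta>]] X)
  then obtain w where w: "w \<in> normal_space M g L (fst \<theta>)" "A - ?B = vert \<theta> w" by (rule vert_exists[OF \<theta>])
  have A: "A = ?B + vert \<theta> w" using w(2) by (metis add.commute diff_add_cancel)
  have "(fst \<theta>, \<xi> (fst \<theta>)) = \<theta>" using \<xi>(2) by (simp add: prod_eq_iff)
  then have "K \<theta> A = Dn X \<xi> (fst \<theta>) + w"
    using K_section[OF X(1) \<xi>(1) N_base[OF \<theta>]] K_vert[OF \<theta> w(1)] by (subst A) (simp add: linear_add[OF K_linear[OF \<theta>]])
  then show ?thesis using that \<xi> w(1) A by blast
qed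

text \<open>Along the section, compatibility of \<open>Dn\<close> with the metric applies; along the
  fibre the contribution is <w, \<zeta>>. The vectors \<open>Dn X \<xi>\<close> and w add up to
  \<open>K \<theta> A\<close>, so the choices disappear.\<close>

lemma mderiv_pair:
  assumes \<theta>: "\<theta> \<in> points N" and \<zeta>: "normal_sec \<zeta>" and X: "vector_field L X" "X (fst \<theta>) = dpi \<theta> A"
  shows "mderiv N (pair \<zeta>) \<theta> A = g (fst \<theta>) (K \<theta> A) (\<zeta> (fst \<theta>)) + g (fst \<theta>) (snd \<theta>) (Dn X \<zeta> (fst \<theta>))"
proof -
  let ?x = "fst \<theta>"
  note x = N_base[OF \<theta>]
  obtain \<xi> w where d: "normal_sec \<xi>" "\<xi> ?x = snd \<theta>" "w \<in> normal_space M g L ?x"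
    "A = sdiff \<xi> ?x (X ?x) + vert \<theta> w" "K \<theta> A = Dn X \<xi> ?x + w"
    by (rule decompose[OF \<theta> X])
  note sm = msmooth_N_pair[OF normal_sec_smooth[OF \<zeta>]]
  have lin: "linear (mderiv N (pair \<zeta>) \<theta>)" by (rule has_mderiv_linear[OF msmooth_has_mderiv_UNIV[OF atlas_N \<theta> sm]])
  have "((\<lambda>s. g ?x (snd \<theta>) (\<zeta> ?x) + s * g ?x w (\<zeta> ?x)) has_real_derivative g ?x w (\<zeta> ?x)) (at 0)"
    by (auto intro!: derivative_eq_intros)
  then have 1: "mderiv N (pair \<zeta>) \<theta> (vert \<theta> w) = g ?x w (\<zeta> ?x)"
    by (intro mderiv_vert[OF \<theta> d(3) sm]) (simp add: pair_def bilinear_ladd[OF bl[OF x]] bilinear_lmul[OF bl[OF x]])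
  have 2: "mderiv N (pair \<zeta>) \<theta> (sdiff \<xi> ?x (X ?x)) = g ?x (Dn X \<xi> ?x) (\<zeta> ?x) + g ?x (snd \<theta>) (Dn X \<zeta> ?x)"
    using mderiv_section[OF d(1) \<theta> d(2) sm] Dn_metric[OF X(1) d(1) \<zeta> x] by (simp add: pair_def d(2))
  show ?thesis
    unfolding d(5) by (subst d(4)) (simp add: linear_add[OF lin] 1 2 bilinear_ladd[OF bl[OF x]])
qed

text \<open>The splitting used for pairings, with the section paired with itself. Only
  \<open>K \<theta> A\<close> is left, so |\<theta>|^2 does not change in horizontal
  directions.\<close>

lemma mderiv_norm:
  assumes \<theta>: "\<theta> \<in> points N"
  shows "mderiv N (\<lambda>\<theta>. g (fst \<theta>) (snd \<theta>) (snd \<theta>)) \<theta> A = 2 * g (fst \<theta>) (K \<theta> A) (snd \<theta>)"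
proof -
  let ?x = "fst \<theta>"
  let ?E = "\<lambda>\<theta>. g (fst \<theta>) (snd \<theta>) (snd \<theta>)"
  note x = N_base[OF \<theta>]
  obtain X where X: "vector_field L X" "X ?x = dpi \<theta> A" by (rule vector_field_extension[OF x])
  obtain \<xi> w where d: "normal_sec \<xi>" "\<xi> ?x = snd \<theta>" "w \<in> normal_space M g L ?x"
    "A = sdiff \<xi> ?x (X ?x) + vert \<theta> w" "K \<theta> A = Dn X \<xi> ?x + w"
    by (rule decompose[OF \<theta> X])
  have lin: "linear (mderiv N ?E \<theta>)"
    by (rule has_mderiv_linear[OF msmooth_has_mderiv_UNIV[OF atlas_N \<theta> msmooth_N_norm]])
  have "((\<lambda>s. g ?x (snd \<theta>) (snd \<theta>) + 2 * s * g ?x w (snd \<theta>) + s * s * g ?x w w) has_real_derivative 2 * g ?x w (snd \<theta>)) (at 0)"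
    by (auto intro!: derivative_eq_intros)
  then have 1: "mderiv N ?E \<theta> (vert \<theta> w) = 2 * g ?x w (snd \<theta>)"
    by (intro mderiv_vert[OF \<theta> d(3) msmooth_N_norm])
      (simp add: bilinear_ladd[OF bl[OF x]] bilinear_lmul[OF bl[OF x]] bilinear_radd[OF bl[OF x]] bilinear_rmul[OF bl[OF x]]
        gsym[OF x, of "snd \<theta>" w] algebra_simps)
  have 2: "mderiv N ?E \<theta> (sdiff \<xi> ?x (X ?x)) = 2 * g ?x (Dn X \<xi> ?x) (snd \<theta>)"
    using mderiv_section[OF d(1) \<theta> d(2) msmooth_N_norm] Dn_metric[OF X(1) d(1) d(1) x]
    by (simp add: d(2) gsym[OF x, of "snd \<theta>"])
  show ?thesis
    unfolding d(5) by (subst d(4)) (simp add: linear_add[OF lin] 1 2 bilinear_ladd[OF bl[OF x]])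
qed

text \<open>Derivatives of the generating functions involve A only through
  \<open>dpi \<theta> A\<close> and \<open>K \<theta> A\<close>.\<close>

lemma tangent_eqI:
  assumes \<theta>: "\<theta> \<in> points N" and eq: "dpi \<theta> A = dpi \<theta> B" "K \<theta> A = K \<theta> B"
  shows "A = B"
proof (rule generates_separates[OF atlas_N generates_N \<theta>])
  fix F assume "F \<in> gens"
  then show "mderiv N F \<theta> A = mderiv N F \<theta> B"
  proof (cases rule: gens_cases)
    case (2 \<zeta>)
    obtain X where "vector_field L X" "X (fst \<theta>) = dpi \<theta> A" by (rule vector_field_extension[OF N_base[OF \<theta>]])
    then show ?thesis using mderiv_pair[OF \<theta> 2(1), of X] eq by (simp add: 2(2))
  qed (simp add: mderiv_dpi[OF \<theta>] eq)
qed

lemma tangent_exists: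
  assumes \<theta>: "\<theta> \<in> points N" and w: "w \<in> normal_space M g L (fst \<theta>)"
  obtains A where "dpi \<theta> A = u" "K \<theta> A = w"
proof -
  note x = N_base[OF \<theta>]
  obtain X where X: "vector_field L X" "X (fst \<theta>) = u" by (rule vector_field_extension[OF x])
  obtain \<xi> where \<xi>: "normal_sec \<xi>" "\<xi> (fst \<theta>) = snd \<theta>" by (rule normal_sec_extension[OF x N_normal[OF \<theta>]])
  have t: "(fst \<theta>, \<xi> (fst \<theta>)) = \<theta>" using \<xi>(2) by (simp add: prod_eq_iff)
  \<comment> \<open>Corrects for the value that K takes on the velocity of the section.\<close>
  let ?w = "w - Dn X \<xi> (fst \<theta>)"
  have wn: "?w \<in> normal_space M g L (fst \<theta>)" by (intro normal_space_diff x w Dn_in X \<xi>)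
  show ?thesis
  proof (rule that)
    show "dpi \<theta> (sdiff \<xi> (fst \<theta>) u + vert \<theta> ?w) = u"
      by (simp add: linear_add[OF dpi_linear[OF \<theta>]] dpi_section[OF \<xi>(1) \<theta> \<xi>(2)] dpi_vert[OF \<theta> wn])
    show "K \<theta> (sdiff \<xi> (fst \<theta>) u + vert \<theta> ?w) = w"
      using K_section[OF X(1) \<xi>(1) x] by (simp add: linear_add[OF K_linear[OF \<theta>]] K_vert[OF \<theta> wn] t X(2))
  qed
qed

section \<open>Horizontal and vertical lifts as vector fields\<close>

lemma hlift_props:
  assumes \<theta>: "\<theta> \<in> points N" shows "dpi \<theta> (hlift L N K \<theta> u) = u" "K \<theta> (hlift L N K \<theta> u) = 0"
proof -
  obtain A where A: "dpi \<theta> A = u" "K \<theta> A = 0" by (rule tangent_exists[OF \<theta> normal_space_0[OF N_base[OF \<theta>]]])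
  have "hlift L N K \<theta> u = A" unfolding hlift_def
    by (rule the_equality) (use A tangent_eqI[OF \<theta>] in auto)
  then show "dpi \<theta> (hlift L N K \<theta> u) = u" "K \<theta> (hlift L N K \<theta> u) = 0" using A by auto
qed

lemma vlift_props:
  assumes \<theta>: "\<theta> \<in> points N" and w: "w \<in> normal_space M g L (fst \<theta>)"
  shows "dpi \<theta> (vlift L N K \<theta> w) = 0" "K \<theta> (vlift L N K \<theta> w) = w"
proof -
  obtain A where A: "dpi \<theta> A = 0" "K \<theta> A = w" by (rule tangent_exists[OF \<theta> w])
  have "vlift L N K \<theta> w = A" unfolding vlift_def
    by (rule the_equality) (use A tangent_eqI[OF \<theta>] in auto)
  then show "dpi \<theta> (vlift L N K \<theta> w) = 0" "K \<theta> (vlift L N K \<theta> w) = w" using A by auto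
qed

definition hfield :: "('m \<Rightarrow> 'l) \<Rightarrow> 'm \<times> 'e \<Rightarrow> 'l \<times> 'k" where
  "hfield X = (\<lambda>\<theta>. hlift L N K \<theta> (X (fst \<theta>)))"

definition vfield :: "('m \<Rightarrow> 'e) \<Rightarrow> 'm \<times> 'e \<Rightarrow> 'l \<times> 'k" where
  "vfield \<xi> = (\<lambda>\<theta>. vlift L N K \<theta> (\<xi> (fst \<theta>)))"

lemma hfield_props: "\<theta> \<in> points N \<Longrightarrow> dpi \<theta> (hfield X \<theta>) = X (fst \<theta>)" "\<theta> \<in> points N \<Longrightarrow> K \<theta> (hfield X \<theta>) = 0"
  by (simp_all add: hfield_def hlift_props)

lemma vfield_props:
  "\<theta> \<in> points N \<Longrightarrow> normal_sec \<xi> \<Longrightarrow> dpi \<theta> (vfield \<xi> \<theta>) = 0"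
  "\<theta> \<in> points N \<Longrightarrow> normal_sec \<xi> \<Longrightarrow> K \<theta> (vfield \<xi> \<theta>) = \<xi> (fst \<theta>)"
  by (simp_all add: vfield_def vlift_props normal_sec_in N_base)

lemma zero_field: "vector_field L (\<lambda>x. 0)" unfolding vector_field_def by (rule smooth_along_zero[OF LL])

lemma Dn_zero: "normal_sec \<xi> \<Longrightarrow> x \<in> points L \<Longrightarrow> Dn (\<lambda>x. 0) \<xi> x = 0"
  using Dn_linear(2)[OF zero_field, of \<xi> x "\<lambda>x. 0"] msmooth_const[OF atlas_L, of "0::real"] by simp

lemma mderiv_L_zero: "msmooth L f \<Longrightarrow> x \<in> points L \<Longrightarrow> mderiv L f x 0 = 0"
  using linear_0[OF has_mderiv_linear[OF msmooth_has_mderiv_UNIV[OF atlas_L]]] by blast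

lemma mderiv_hfield:
  assumes \<theta>: "\<theta> \<in> points N" and X: "vector_field L X"
  shows "msmooth L f \<Longrightarrow> mderiv N (\<lambda>\<theta>. f (fst \<theta>)) \<theta> (hfield X \<theta>) = mderiv L f (fst \<theta>) (X (fst \<theta>))"
    "normal_sec \<zeta> \<Longrightarrow> mderiv N (pair \<zeta>) \<theta> (hfield X \<theta>) = pair (Dn X \<zeta>) \<theta>"
proof -
  show "msmooth L f \<Longrightarrow> mderiv N (\<lambda>\<theta>. f (fst \<theta>)) \<theta> (hfield X \<theta>) = mderiv L f (fst \<theta>) (X (fst \<theta>))"
    by (simp add: mderiv_dpi[OF \<theta>] hfield_props[OF \<theta>])
  show "normal_sec \<zeta> \<Longrightarrow> mderiv N (pair \<zeta>) \<theta> (hfield X \<theta>) = pair (Dn X \<zeta>) \<theta>"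
    using mderiv_pair[OF \<theta>, of \<zeta> X "hfield X \<theta>"] X
    by (simp add: hfield_props[OF \<theta>] pair_def bilinear_lzero[OF bl[OF N_base[OF \<theta>]]])
qed

lemma mderiv_vfield:
  assumes \<theta>: "\<theta> \<in> points N" and \<xi>: "normal_sec \<xi>"
  shows "msmooth L f \<Longrightarrow> mderiv N (\<lambda>\<theta>. f (fst \<theta>)) \<theta> (vfield \<xi> \<theta>) = 0"
    "normal_sec \<zeta> \<Longrightarrow> mderiv N (pair \<zeta>) \<theta> (vfield \<xi> \<theta>) = g (fst \<theta>) (\<xi> (fst \<theta>)) (\<zeta> (fst \<theta>))"
proof -
  show "msmooth L f \<Longrightarrow> mderiv N (\<lambda>\<theta>. f (fst \<theta>)) \<theta> (vfield \<xi> \<theta>) = 0"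
    by (simp add: mderiv_dpi[OF \<theta>] vfield_props[OF \<theta> \<xi>] mderiv_L_zero N_base[OF \<theta>])
  show "normal_sec \<zeta> \<Longrightarrow> mderiv N (pair \<zeta>) \<theta> (vfield \<xi> \<theta>) = g (fst \<theta>) (\<xi> (fst \<theta>)) (\<zeta> (fst \<theta>))"
    using mderiv_pair[OF \<theta>, of \<zeta> "\<lambda>x. 0" "vfield \<xi> \<theta>"] zero_field
    by (simp add: vfield_props[OF \<theta> \<xi>] Dn_zero N_base[OF \<theta>] bilinear_rzero[OF bl[OF N_base[OF \<theta>]]])
qed

text \<open>Differentiation along the lift sends f to Xf and the pairing with \<zeta> to the pairing
  with \<open>Dn X \<zeta>\<close>, both smooth again.\<close>

lemma hfield_vector_field:
  assumes X: "vector_field L X" shows "vector_field N (hfield X)"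
proof (rule generates_vector_field[OF atlas_N generates_N])
  fix F assume "F \<in> gens"
  then show "msmooth N (\<lambda>\<theta>. mderiv N F \<theta> (hfield X \<theta>))"
  proof (cases rule: gens_cases)
    case (1 f)
    show ?thesis
      by (rule msmooth_cong[OF atlas_N, THEN iffD2, OF _ msmooth_N_fst[OF vector_field_mderiv[OF atlas_L X 1(1)]]])
        (simp add: 1 mderiv_hfield(1)[OF _ X])
  next
    case (2 \<zeta>)
    show ?thesis
      by (rule msmooth_cong[OF atlas_N, THEN iffD2, OF _ msmooth_N_pair[OF normal_sec_smooth[OF Dn_sec[OF X 2(1)]]]])
        (simp add: 2 mderiv_hfield(2)[OF _ X])
  qed
qed

lemma vfield_vector_field:
  assumes \<xi>: "normal_sec \<xi>" shows "vector_field N (vfield \<xi>)"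
proof (rule generates_vector_field[OF atlas_N generates_N])
  fix F assume "F \<in> gens"
  then show "msmooth N (\<lambda>\<theta>. mderiv N F \<theta> (vfield \<xi> \<theta>))"
  proof (cases rule: gens_cases)
    case (1 f)
    show ?thesis
      by (rule msmooth_cong[OF atlas_N, THEN iffD2, OF _ msmooth_const[OF atlas_N, of 0]])
        (simp add: 1 mderiv_vfield(1)[OF _ \<xi>])
  next
    case (2 \<zeta>)
    show ?thesis
      by (rule msmooth_cong[OF atlas_N, THEN iffD2,
            OF _ msmooth_N_fst[OF msmooth_metric_L[OF normal_sec_smooth[OF \<xi>] normal_sec_smooth[OF 2(1)]]]])
        (simp add: 2 mderiv_vfield(2)[OF _ \<xi>])
  qed
qed

section \<open>Lie brackets of lifts\<close>

lemma mderiv_N_cong: "\<theta> \<in> points N \<Longrightarrow> (\<And>\<theta>. \<theta> \<in> points N \<Longrightarrow> F \<theta> = G \<theta>) \<Longrightarrow> mderiv N F \<theta> = mderiv N G \<theta>"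
  by (rule mderiv_cong[OF atlas_N mopen_UNIV[OF atlas_N] UNIV_I])

lemma mderiv_N_zero: "mderiv N (\<lambda>\<theta>. 0::real) \<theta> A = 0"
  using has_mderivD[OF has_mderiv_const[of N "0::real" \<theta>]] by simp

text \<open>On pairings the commutator is the pairing of \<theta> with the sum of R(X, Y)\<zeta> and
  the derivative of \<zeta> along [X, Y]. The latter belongs to the projection of the bracket; skew
  symmetry moves R from \<zeta> to \<theta> and produces the minus sign.\<close>

lemma bracket_h_h:
  assumes X: "vector_field L X" and Y: "vector_field L Y" and \<theta>: "\<theta> \<in> points N"
  shows "dpi \<theta> (lie_bracket N (hfield X) (hfield Y) \<theta>) = lie_bracket L X Y (fst \<theta>)"
    "K \<theta> (lie_bracket N (hfield X) (hfield Y) \<theta>) = - normal_curvature M g L Dn (fst \<theta>) (X (fst \<theta>)) (Y (fst \<theta>)) (snd \<theta>)"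
proof -
  let ?x = "fst \<theta>"
  note x = N_base[OF \<theta>]
  obtain \<xi> where \<xi>: "normal_sec \<xi>" "\<xi> ?x = snd \<theta>" by (rule normal_sec_extension[OF x N_normal[OF \<theta>]])
  let ?R = "curvature L Dn X Y \<xi> ?x"
  have R: "normal_curvature M g L Dn ?x (X ?x) (Y ?x) (snd \<theta>) = ?R"
    using normal_curvature_eq[OF X Y \<xi>(1) x] by (simp add: \<xi>(2))
  have Rn: "- ?R \<in> normal_space M g L ?x" using normal_space_scale[OF x curvature_in[OF X Y \<xi>(1) x], of "-1"] by simp
  obtain A where A: "dpi \<theta> A = lie_bracket L X Y ?x" "K \<theta> A = - ?R" by (rule tangent_exists[OF \<theta> Rn])
  have "lie_bracket N (hfield X) (hfield Y) \<theta> = A"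
  proof (rule lie_bracket_unique[OF atlas_N generates_N hfield_vector_field[OF X] hfield_vector_field[OF Y] \<theta>])
    fix F assume "F \<in> gens"
    then show "mderiv N F \<theta> A = mderiv N (\<lambda>\<theta>. mderiv N F \<theta> (hfield Y \<theta>)) \<theta> (hfield X \<theta>) -
        mderiv N (\<lambda>\<theta>. mderiv N F \<theta> (hfield X \<theta>)) \<theta> (hfield Y \<theta>)"
    proof (cases rule: gens_cases)
      case (1 f)
      have *: "mderiv N (\<lambda>\<theta>. mderiv N F \<theta> (hfield X \<theta>)) \<theta> = mderiv N (\<lambda>\<theta>. mderiv L f (fst \<theta>) (X (fst \<theta>))) \<theta>"
        if "vector_field L X" for X
        by (rule mderiv_N_cong[OF \<theta>]) (simp add: 1 mderiv_hfield(1)[OF _ that])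
      show ?thesis unfolding *[OF X] *[OF Y]
        by (simp add: mderiv_hfield(1)[OF \<theta> X vector_field_mderiv[OF atlas_L Y 1(1)]]
            mderiv_hfield(1)[OF \<theta> Y vector_field_mderiv[OF atlas_L X 1(1)]] 1 mderiv_dpi[OF \<theta> 1(1)] A bracket_eq[OF X Y x 1(1)])
    next
      case (2 \<zeta>)
      have *: "mderiv N (\<lambda>\<theta>. mderiv N F \<theta> (hfield X \<theta>)) \<theta> = mderiv N (pair (Dn X \<zeta>)) \<theta>"
        if "vector_field L X" for X
        by (rule mderiv_N_cong[OF \<theta>]) (simp add: 2 mderiv_hfield(2)[OF _ that])
      have "mderiv N F \<theta> A = g ?x (- ?R) (\<zeta> ?x) + g ?x (snd \<theta>) (Dn (lie_bracket L X Y) \<zeta> ?x)"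
        using mderiv_pair[OF \<theta> 2(1) bracket_field[OF X Y]] A by (simp add: 2)
      also have "g ?x (- ?R) (\<zeta> ?x) = g ?x (snd \<theta>) (curvature L Dn X Y \<zeta> ?x)"
        using curvature_skew[OF X Y \<xi>(1) 2(1) x] by (simp add: bilinear_lneg[OF bl[OF x]] \<xi>(2))
      finally show ?thesis unfolding *[OF X] *[OF Y]
        by (simp add: mderiv_hfield(2)[OF \<theta> X Dn_sec[OF Y 2(1)]] mderiv_hfield(2)[OF \<theta> Y Dn_sec[OF X 2(1)]]
            pair_def curvature_def bilinear_rsub[OF bl[OF x]])
    qed
  qed
  then show "dpi \<theta> (lie_bracket N (hfield X) (hfield Y) \<theta>) = lie_bracket L X Y ?x"
    "K \<theta> (lie_bracket N (hfield X) (hfield Y) \<theta>) = - normal_curvature M g L Dn ?x (X ?x) (Y ?x) (snd \<theta>)"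
    using A R by simp_all
qed

text \<open>On pairings this is compatibility: X<\<eta>, \<zeta>> minus <\<eta>,
  \<open>Dn X \<zeta>\<close>> equals <\<open>Dn X \<eta>\<close>, \<zeta>>. On functions of the
  base both sides vanish.\<close>

lemma bracket_h_v:
  assumes X: "vector_field L X" and \<eta>: "normal_sec \<eta>" and \<theta>: "\<theta> \<in> points N"
  shows "lie_bracket N (hfield X) (vfield \<eta>) \<theta> = vfield (Dn X \<eta>) \<theta>"
proof (rule lie_bracket_unique[OF atlas_N generates_N hfield_vector_field[OF X] vfield_vector_field[OF \<eta>] \<theta>])
  let ?x = "fst \<theta>"
  note x = N_base[OF \<theta>]
  note D = Dn_sec[OF X \<eta>]
  fix F assume "F \<in> gens"
  then show "mderiv N F \<theta> (vfield (Dn X \<eta>) \<theta>) = mderiv N (\<lambda>\<theta>. mderiv N F \<theta> (vfield \<eta> \<theta>)) \<theta> (hfield X \<theta>) -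
      mderiv N (\<lambda>\<theta>. mderiv N F \<theta> (hfield X \<theta>)) \<theta> (vfield \<eta> \<theta>)"
  proof (cases rule: gens_cases)
    case (1 f)
    have 2: "mderiv N (\<lambda>\<theta>. mderiv N F \<theta> (hfield X \<theta>)) \<theta> = mderiv N (\<lambda>\<theta>. mderiv L f (fst \<theta>) (X (fst \<theta>))) \<theta>"
      by (rule mderiv_N_cong[OF \<theta>]) (simp add: 1 mderiv_hfield(1)[OF _ X])
    have 3: "mderiv N (\<lambda>\<theta>. mderiv N F \<theta> (vfield \<eta> \<theta>)) \<theta> = mderiv N (\<lambda>\<theta>. 0) \<theta>"
      by (rule mderiv_N_cong[OF \<theta>]) (simp add: 1 mderiv_vfield(1)[OF _ \<eta>])
    show ?thesis unfolding 2 3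
      by (simp add: 1 mderiv_vfield(1)[OF \<theta> D] mderiv_N_zero mderiv_vfield(1)[OF \<theta> \<eta> vector_field_mderiv[OF atlas_L X 1(1)]])
  next
    case (2 \<zeta>)
    have 3: "mderiv N (\<lambda>\<theta>. mderiv N F \<theta> (hfield X \<theta>)) \<theta> = mderiv N (pair (Dn X \<zeta>)) \<theta>"
      by (rule mderiv_N_cong[OF \<theta>]) (simp add: 2 mderiv_hfield(2)[OF _ X])
    have 4: "mderiv N (\<lambda>\<theta>. mderiv N F \<theta> (vfield \<eta> \<theta>)) \<theta> = mderiv N (\<lambda>\<theta>. g (fst \<theta>) (\<eta> (fst \<theta>)) (\<zeta> (fst \<theta>))) \<theta>"
      by (rule mderiv_N_cong[OF \<theta>]) (simp add: 2 mderiv_vfield(2)[OF _ \<eta>])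
    show ?thesis unfolding 3 4
      using mderiv_hfield(1)[OF \<theta> X msmooth_metric_L[OF normal_sec_smooth[OF \<eta>] normal_sec_smooth[OF 2(1)]]]
        mderiv_vfield(2)[OF \<theta> \<eta> Dn_sec[OF X 2(1)]] mderiv_vfield(2)[OF \<theta> D 2(1)] Dn_metric[OF X \<eta> 2(1) x]
      by (simp add: 2)
  qed
qed

lemma bracket_v_h:
  assumes X: "vector_field L X" and \<eta>: "normal_sec \<eta>" and \<theta>: "\<theta> \<in> points N"
  shows "lie_bracket N (vfield \<eta>) (hfield X) \<theta> = - vfield (Dn X \<eta>) \<theta>"
proof (rule lie_bracket_unique[OF atlas_N generates_N vfield_vector_field[OF \<eta>] hfield_vector_field[OF X] \<theta>])
  fix F assume "F \<in> gens"
  then have F: "msmooth N F" using generates_N by (simp add: generates_def)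
  show "mderiv N F \<theta> (- vfield (Dn X \<eta>) \<theta>) = mderiv N (\<lambda>\<theta>. mderiv N F \<theta> (hfield X \<theta>)) \<theta> (vfield \<eta> \<theta>) -
      mderiv N (\<lambda>\<theta>. mderiv N F \<theta> (vfield \<eta> \<theta>)) \<theta> (hfield X \<theta>)"
    using lie_bracket_eq[OF atlas_N generates_N hfield_vector_field[OF X] vfield_vector_field[OF \<eta>] \<theta> F]
      linear_neg[OF has_mderiv_linear[OF msmooth_has_mderiv_UNIV[OF atlas_N \<theta> F]]]
    by (simp add: bracket_h_v[OF X \<eta> \<theta>])
qed

text \<open>A vertical derivative of a generating function is constant on fibres, so a second one
  vanishes.\<close>

lemma bracket_v_v:
  assumes \<xi>: "normal_sec \<xi>" and \<eta>: "normal_sec \<eta>" and \<theta>: "\<theta> \<in> points N"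
  shows "lie_bracket N (vfield \<xi>) (vfield \<eta>) \<theta> = 0"
proof (rule lie_bracket_unique[OF atlas_N generates_N vfield_vector_field[OF \<xi>] vfield_vector_field[OF \<eta>] \<theta>])
  fix F assume FG: "F \<in> gens"
  then have "msmooth N F" using generates_N by (simp add: generates_def)
  then have z: "mderiv N F \<theta> 0 = 0"
    using linear_0[OF has_mderiv_linear[OF msmooth_has_mderiv_UNIV[OF atlas_N \<theta>]]] by blast
  have "mderiv N (\<lambda>\<theta>. mderiv N F \<theta> (vfield \<eta> \<theta>)) \<theta> (vfield \<xi> \<theta>) = 0" if \<xi>: "normal_sec \<xi>" and \<eta>: "normal_sec \<eta>" for \<xi> \<eta>
    using FG
  proof (cases rule: gens_cases)
    case (1 f)
    have "mderiv N (\<lambda>\<theta>. mderiv N F \<theta> (vfield \<eta> \<theta>)) \<theta> = mderiv N (\<lambda>\<theta>. 0) \<theta>"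
      by (rule mderiv_N_cong[OF \<theta>]) (simp add: 1 mderiv_vfield(1)[OF _ \<eta>])
    then show ?thesis by (simp add: mderiv_N_zero)
  next
    case (2 \<zeta>)
    have "mderiv N (\<lambda>\<theta>. mderiv N F \<theta> (vfield \<eta> \<theta>)) \<theta> = mderiv N (\<lambda>\<theta>. g (fst \<theta>) (\<eta> (fst \<theta>)) (\<zeta> (fst \<theta>))) \<theta>"
      by (rule mderiv_N_cong[OF \<theta>]) (simp add: 2 mderiv_vfield(2)[OF _ \<eta>])
    then show ?thesis
      using mderiv_vfield(1)[OF \<theta> \<xi> msmooth_metric_L[OF normal_sec_smooth[OF \<eta>] normal_sec_smooth[OF 2(1)]]] by simp
  qed
  then show "mderiv N F \<theta> 0 = mderiv N (\<lambda>\<theta>. mderiv N F \<theta> (vfield \<eta> \<theta>)) \<theta> (vfield \<xi> \<theta>) -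
      mderiv N (\<lambda>\<theta>. mderiv N F \<theta> (vfield \<xi> \<theta>)) \<theta> (vfield \<eta> \<theta>)"
    by (simp add: z \<xi> \<eta>)
qed

end

section \<open>The Levi-Civita connection of the (p,q)-metric\<close>

lemma levi_civitaD:
  assumes "levi_civita A h D" "vector_field A X" "vector_field A Y" "x \<in> points A"
  shows "D X Y x - D Y X x = lie_bracket A X Y x"
    "vector_field A Z \<Longrightarrow> mderiv A (\<lambda>y. h y (Y y) (Z y)) x (X x) = h x (D X Y x) (Z x) + h x (Y x) (D X Z x)"
proof -
  note D = assms(1)[unfolded levi_civita_def dir_deriv_eq]
  show "D X Y x - D Y X x = lie_bracket A X Y x"
    using conjunct1[OF conjunct2[OF D]] assms(2-4) by simp
  show "vector_field A Z \<Longrightarrow> mderiv A (\<lambda>y. h y (Y y) (Z y)) x (X x) = h x (D X Y x) (Z x) + h x (Y x) (D X Z x)"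
    using conjunct2[OF conjunct2[OF D]] assms(2-4) by simp
qed

text \<open>Metric compatibility in cyclic order, with vanishing torsion turning differences of
  covariant derivatives into brackets. Symmetry and bilinearity of h are asked at x only, where for
  \<open>pq_metric\<close> they are pure algebra.\<close>

lemma koszul:
  assumes D: "levi_civita A h D" and X: "vector_field A X" and Y: "vector_field A Y" and Z: "vector_field A Z"
    and x: "x \<in> points A" and h: "bilinear (h x)" "\<And>v w. h x v w = h x w v"
  shows "2 * h x (D X Y x) (Z x) =
    mderiv A (\<lambda>y. h y (Y y) (Z y)) x (X x) + mderiv A (\<lambda>y. h y (Z y) (X y)) x (Y x)
    - mderiv A (\<lambda>y. h y (X y) (Y y)) x (Z x)
    + h x (lie_bracket A X Y x) (Z x) - h x (lie_bracket A X Z x) (Y x) - h x (lie_bracket A Y Z x) (X x)"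
  unfolding levi_civitaD(2)[OF D X Y x Z] levi_civitaD(2)[OF D Y Z x X] levi_civitaD(2)[OF D Z X x Y]
    levi_civitaD(1)[OF D X Y x, symmetric] levi_civitaD(1)[OF D X Z x, symmetric] levi_civitaD(1)[OF D Y Z x, symmetric]
    bilinear_lsub[OF h(1)]
  using h(2)[of "Y x" "D X Z x"] h(2)[of "Z x" "D Y X x"] h(2)[of "X x" "D Z Y x"] by simp

context normal_bundle_conn
begin

lemma omega_pos: "\<theta> \<in> points N \<Longrightarrow> omega g \<theta> > 0"
  using gnonneg[OF N_base, of \<theta> "snd \<theta>"] by (simp add: omega_def add_pos_nonneg)

context
  fixes p q :: real and h :: "'m \<times> 'e \<Rightarrow> 'l \<times> 'k \<Rightarrow> 'l \<times> 'k \<Rightarrow> real"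
  assumes q: "q \<ge> 0"
  defines "h \<equiv> pq_metric M g L N K p q"
begin

section \<open>Algebra of the metric\<close>

abbreviation "I \<equiv> induced_metric M g L"

lemma h_eq: "h \<theta> A B = I (fst \<theta>) (dpi \<theta> A) (dpi \<theta> B) + omega g \<theta> powr p *
    (g (fst \<theta>) (K \<theta> A) (K \<theta> B) + q * g (fst \<theta>) (K \<theta> A) (snd \<theta>) * g (fst \<theta>) (K \<theta> B) (snd \<theta>))"
  by (simp add: h_def pq_metric_def)

lemma I_sym: "x \<in> points L \<Longrightarrow> I x u w = I x w u" by (simp add: induced_metric_def gsym)

lemma h_sym: "\<theta> \<in> points N \<Longrightarrow> h \<theta> A B = h \<theta> B A"
  using I_sym[OF N_base, of \<theta>] gsym[OF N_base, of \<theta> "K \<theta> A" "K \<theta> B"] by (simp add: h_eq)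

lemma h_bilinear: assumes \<theta>: "\<theta> \<in> points N" shows "bilinear (h \<theta>)"
proof -
  note x = N_base[OF \<theta>]
  have 1: "linear (\<lambda>A. h \<theta> A B)" for B
    by (rule linearI) (simp_all add: h_eq linear_add[OF dpi_linear[OF \<theta>]] linear_add[OF K_linear[OF \<theta>]]
      linear_scale[OF dpi_linear[OF \<theta>]] linear_scale[OF K_linear[OF \<theta>]] bilinear_ladd[OF bl[OF x]] bilinear_lmul[OF bl[OF x]]
      bilinear_ladd[OF bilinear_induced[OF x]] bilinear_lmul[OF bilinear_induced[OF x]] algebra_simps)
  have 2: "h \<theta> A = (\<lambda>B. h \<theta> B A)" for A by (rule ext) (rule h_sym[OF \<theta>])
  have "linear (h \<theta> A)" for A unfolding 2[of A] by (rule 1)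
  with 1 show ?thesis unfolding bilinear_def by blast
qed

lemma h_hfield: "\<theta> \<in> points N \<Longrightarrow> h \<theta> A (hfield Z \<theta>) = I (fst \<theta>) (dpi \<theta> A) (Z (fst \<theta>))"
  by (simp add: h_eq hfield_props bilinear_rzero[OF bl[OF N_base]] bilinear_lzero[OF bl[OF N_base]])

lemma h_vfield: "\<theta> \<in> points N \<Longrightarrow> normal_sec \<zeta> \<Longrightarrow> h \<theta> A (vfield \<zeta> \<theta>) = omega g \<theta> powr p *
    (g (fst \<theta>) (K \<theta> A) (\<zeta> (fst \<theta>)) + q * g (fst \<theta>) (K \<theta> A) (snd \<theta>) * g (fst \<theta>) (\<zeta> (fst \<theta>)) (snd \<theta>))"
  by (simp add: h_eq vfield_props bilinear_rzero[OF bilinear_induced[OF N_base]])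

text \<open>Nondegeneracy of h. Horizontal tests separate the projections because the induced metric
  is definite; for the vertical parts their difference is tested against itself.\<close>

lemma h_eqI:
  assumes \<theta>: "\<theta> \<in> points N"
    and hor: "\<And>Z. vector_field L Z \<Longrightarrow> h \<theta> A (hfield Z \<theta>) = h \<theta> B (hfield Z \<theta>)"
    and ver: "\<And>\<zeta>. normal_sec \<zeta> \<Longrightarrow> h \<theta> A (vfield \<zeta> \<theta>) = h \<theta> B (vfield \<zeta> \<theta>)"
  shows "A = B"
proof (rule tangent_eqI[OF \<theta>])
  let ?x = "fst \<theta>"
  note x = N_base[OF \<theta>]
  show "dpi \<theta> A = dpi \<theta> B"
  proof (rule induced_eqI[OF x])
    fix z
    obtain Z where "vector_field L Z" "Z ?x = z" by (rule vector_field_extension[OF x])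
    then show "I ?x (dpi \<theta> A) z = I ?x (dpi \<theta> B) z" using hor[of Z] by (simp add: h_hfield[OF \<theta>])
  qed
  let ?n = "K \<theta> A - K \<theta> B"
  have n: "?n \<in> normal_space M g L ?x" by (intro normal_space_diff x K_in \<theta>)
  obtain \<zeta> where \<zeta>: "normal_sec \<zeta>" "\<zeta> ?x = ?n" by (rule normal_sec_extension[OF x n])
  have "g ?x (K \<theta> A) ?n + q * g ?x (K \<theta> A) (snd \<theta>) * g ?x ?n (snd \<theta>) =
      g ?x (K \<theta> B) ?n + q * g ?x (K \<theta> B) (snd \<theta>) * g ?x ?n (snd \<theta>)"
    using ver[OF \<zeta>(1)] omega_pos[OF \<theta>] by (simp add: h_vfield[OF \<theta> \<zeta>(1)] \<zeta>(2))
  \<comment> \<open>Both summands are nonnegative, the second because q \<ge> 0, so both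
    vanish.\<close>
  then have "g ?x ?n ?n + q * (g ?x ?n (snd \<theta>))\<^sup>2 = 0"
    by (simp add: bilinear_lsub[OF bl[OF x]] power2_eq_square algebra_simps)
  moreover have "q * (g ?x ?n (snd \<theta>))\<^sup>2 \<ge> 0" using q by simp
  ultimately have "g ?x ?n ?n = 0" using gnonneg[OF x, of ?n] by linarith
  then show "K \<theta> A = K \<theta> B" using gzero[OF x, of ?n] by simp
qed

section \<open>Derivatives of the metric on lifts\<close>

lemma msmooth_I:
  assumes "vector_field L X" "vector_field L Y" shows "msmooth L (\<lambda>x. I x (X x) (Y x))"
  unfolding induced_metric_def by (intro msmooth_metric_L smooth_along_incl_deriv[OF LM] assms)

lemma mderiv_h_hh:
  assumes \<theta>: "\<theta> \<in> points N" and X: "vector_field L X" and Y: "vector_field L Y"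
  shows "mderiv N (\<lambda>\<theta>. h \<theta> (hfield X \<theta>) (hfield Y \<theta>)) \<theta> A = mderiv L (\<lambda>x. I x (X x) (Y x)) (fst \<theta>) (dpi \<theta> A)"
proof -
  have "mderiv N (\<lambda>\<theta>. h \<theta> (hfield X \<theta>) (hfield Y \<theta>)) \<theta> = mderiv N (\<lambda>\<theta>. I (fst \<theta>) (X (fst \<theta>)) (Y (fst \<theta>))) \<theta>"
    by (rule mderiv_N_cong[OF \<theta>]) (simp add: h_hfield hfield_props)
  then show ?thesis using mderiv_dpi[OF \<theta> msmooth_I[OF X Y]] by simp
qed

lemma mderiv_h_vh:
  assumes \<theta>: "\<theta> \<in> points N" and \<eta>: "normal_sec \<eta>"
  shows "mderiv N (\<lambda>\<theta>. h \<theta> (vfield \<eta> \<theta>) (hfield X \<theta>)) \<theta> A = 0" "mderiv N (\<lambda>\<theta>. h \<theta> (hfield X \<theta>) (vfield \<eta> \<theta>)) \<theta> A = 0"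
proof -
  have 0: "h \<theta> (vfield \<eta> \<theta>) (hfield X \<theta>) = 0" if "\<theta> \<in> points N" for \<theta>
    using that by (simp add: h_hfield vfield_props \<eta> bilinear_lzero[OF bilinear_induced[OF N_base]])
  have "mderiv N (\<lambda>\<theta>. h \<theta> (vfield \<eta> \<theta>) (hfield X \<theta>)) \<theta> = mderiv N (\<lambda>\<theta>. 0) \<theta>"
    "mderiv N (\<lambda>\<theta>. h \<theta> (hfield X \<theta>) (vfield \<eta> \<theta>)) \<theta> = mderiv N (\<lambda>\<theta>. 0) \<theta>"
    by (rule mderiv_N_cong[OF \<theta>]; simp add: 0 h_sym[of _ "hfield X _"])+
  then show "mderiv N (\<lambda>\<theta>. h \<theta> (vfield \<eta> \<theta>) (hfield X \<theta>)) \<theta> A = 0" "mderiv N (\<lambda>\<theta>. h \<theta> (hfield X \<theta>) (vfield \<eta> \<theta>)) \<theta> A = 0"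
    by (simp_all add: mderiv_N_zero)
qed

text \<open>With y = |\<theta>|^2 the weight is (1 + y)^(-p), whose derivative is -p \<omega> times
  the weight, and y has derivative 2<KA, \<theta>>; hence the coefficient -2p\<omega>.\<close>

lemma mderiv_h_vv:
  assumes \<theta>: "\<theta> \<in> points N" and \<xi>: "normal_sec \<xi>" and \<eta>: "normal_sec \<eta>"
  shows "mderiv N (\<lambda>\<theta>. h \<theta> (vfield \<xi> \<theta>) (vfield \<eta> \<theta>)) \<theta> A = omega g \<theta> powr p *
    (mderiv N (\<lambda>\<theta>. g (fst \<theta>) (\<xi> (fst \<theta>)) (\<eta> (fst \<theta>))) \<theta> A +
     q * (pair \<xi> \<theta> * mderiv N (pair \<eta>) \<theta> A + mderiv N (pair \<xi>) \<theta> A * pair \<eta> \<theta>)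
     - 2 * p * omega g \<theta> * g (fst \<theta>) (K \<theta> A) (snd \<theta>) * (g (fst \<theta>) (\<xi> (fst \<theta>)) (\<eta> (fst \<theta>)) + q * pair \<xi> \<theta> * pair \<eta> \<theta>))"
proof -
  let ?E = "\<lambda>\<theta>. g (fst \<theta>) (snd \<theta>) (snd \<theta>)" and ?w = "omega g \<theta>"
  let ?G = "\<lambda>\<theta>. g (fst \<theta>) (\<xi> (fst \<theta>)) (\<eta> (fst \<theta>)) + q * (pair \<xi> \<theta> * pair \<eta> \<theta>)"
  note x = N_base[OF \<theta>]
  note hm = msmooth_has_mderiv_UNIV[OF atlas_N \<theta>]
  note m1 = hm[OF msmooth_N_fst[OF msmooth_metric_L[OF normal_sec_smooth[OF \<xi>] normal_sec_smooth[OF \<eta>]]]]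
  note m2 = hm[OF msmooth_N_pair[OF normal_sec_smooth[OF \<xi>]]] and m3 = hm[OF msmooth_N_pair[OF normal_sec_smooth[OF \<eta>]]]
  have E: "?E \<theta> \<ge> 0" by (rule gnonneg[OF x])
  have "((\<lambda>y. (1 / (1 + y)) powr p) has_real_derivative - p * ?w * ?w powr p) (at (?E \<theta>))"
  proof -
    have w: "1 / (1 + ?E \<theta>) = ?w" "?w > 0" using omega_pos[OF \<theta>] by (simp_all add: omega_def)
    have "((\<lambda>y. 1 / (1 + y)) has_real_derivative - (?w * ?w)) (at (?E \<theta>))"
      using E by (auto intro!: derivative_eq_intros simp: omega_def)
    moreover have "((\<lambda>u. u powr p) has_real_derivative p * ?w powr (p - 1)) (at (1 / (1 + ?E \<theta>)))"
      unfolding w(1) by (rule has_real_derivative_powr[OF w(2)])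
    ultimately have "((\<lambda>y. (1 / (1 + y)) powr p) has_real_derivative p * ?w powr (p - 1) * - (?w * ?w)) (at (?E \<theta>))"
      by (rule DERIV_chain2[rotated])
    moreover have "p * ?w powr (p - 1) * - (?w * ?w) = - p * ?w * ?w powr p"
      using w(2) by (simp add: powr_diff field_simps)
    ultimately show ?thesis by (simp only:)
  qed
  then have "((\<lambda>y. (1 / (1 + y)) powr p) has_derivative (\<lambda>s. (- p * ?w * ?w powr p) * s)) (at (?E \<theta>))"
    unfolding has_field_derivative_def .
  from has_mderiv_compose[OF atlas_N \<theta> hm[OF msmooth_N_norm] this]
  have P: "has_mderiv N (\<lambda>\<theta>. omega g \<theta> powr p) \<theta> (\<lambda>A. (- p * ?w * ?w powr p) * mderiv N ?E \<theta> A)"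
    by (simp add: omega_def)
  \<comment> \<open>The summand with factor 0 is the derivative of the constant q, in the form that
    the product rule produces.\<close>
  have G: "has_mderiv N ?G \<theta> (\<lambda>A. mderiv N (\<lambda>\<theta>. g (fst \<theta>) (\<xi> (fst \<theta>)) (\<eta> (fst \<theta>))) \<theta> A +
      (q * (pair \<xi> \<theta> * mderiv N (pair \<eta>) \<theta> A + mderiv N (pair \<xi>) \<theta> A * pair \<eta> \<theta>) + 0 * (pair \<xi> \<theta> * pair \<eta> \<theta>)))"
    by (intro has_mderiv_add m1 has_mderiv_mult[OF atlas_N \<theta> has_mderiv_const] has_mderiv_mult[OF atlas_N \<theta> m2 m3])
  have "mderiv N (\<lambda>\<theta>. h \<theta> (vfield \<xi> \<theta>) (vfield \<eta> \<theta>)) \<theta> = mderiv N (\<lambda>\<theta>. omega g \<theta> powr p * ?G \<theta>) \<theta>"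
    by (rule mderiv_N_cong[OF \<theta>]) (simp add: h_vfield[OF _ \<eta>] vfield_props(2)[OF _ \<xi>] pair_def gsym[OF N_base, of _ "snd _"])
  then show ?thesis
    using has_mderivD[OF has_mderiv_mult[OF atlas_N \<theta> P G]] by (simp add: mderiv_norm[OF \<theta>] algebra_simps)
qed

text \<open>K vanishes on horizontal vectors, so the weight acts as a constant; what remains is
  compatibility of \<open>Dn\<close> and the rule for pairings.\<close>

lemma mderiv_h_vv_hor:
  assumes \<theta>: "\<theta> \<in> points N" and \<xi>: "normal_sec \<xi>" and \<eta>: "normal_sec \<eta>" and X: "vector_field L X"
  shows "mderiv N (\<lambda>\<theta>. h \<theta> (vfield \<xi> \<theta>) (vfield \<eta> \<theta>)) \<theta> (hfield X \<theta>) =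
    h \<theta> (vfield (Dn X \<xi>) \<theta>) (vfield \<eta> \<theta>) + h \<theta> (vfield \<xi> \<theta>) (vfield (Dn X \<eta>) \<theta>)"
proof -
  note x = N_base[OF \<theta>]
  note sm = msmooth_metric_L[OF normal_sec_smooth[OF \<xi>] normal_sec_smooth[OF \<eta>]]
  show ?thesis
    unfolding mderiv_h_vv[OF \<theta> \<xi> \<eta>] mderiv_hfield(1)[OF \<theta> X sm] mderiv_hfield(2)[OF \<theta> X \<xi>] mderiv_hfield(2)[OF \<theta> X \<eta>]
      hfield_props(2)[OF \<theta>] Dn_metric[OF X \<xi> \<eta> x] h_vfield[OF \<theta> \<eta>] h_vfield[OF \<theta> Dn_sec[OF X \<eta>]]
      vfield_props(2)[OF \<theta> \<xi>] vfield_props(2)[OF \<theta> Dn_sec[OF X \<xi>]]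
    by (simp add: bilinear_lzero[OF bl[OF x]] pair_def gsym[OF x, of "snd \<theta>"] algebra_simps)
qed

lemma mderiv_h_vv_ver:
  assumes \<theta>: "\<theta> \<in> points N" and \<xi>: "normal_sec \<xi>" and \<eta>: "normal_sec \<eta>" and \<zeta>: "normal_sec \<zeta>"
  defines "x \<equiv> fst \<theta>" and "v \<equiv> snd \<theta>"
  shows "mderiv N (\<lambda>\<theta>. h \<theta> (vfield \<xi> \<theta>) (vfield \<eta> \<theta>)) \<theta> (vfield \<zeta> \<theta>) = omega g \<theta> powr p *
    (q * (g x (\<xi> x) v * g x (\<zeta> x) (\<eta> x) + g x (\<zeta> x) (\<xi> x) * g x (\<eta> x) v)
     - 2 * p * omega g \<theta> * g x (\<zeta> x) v * (g x (\<xi> x) (\<eta> x) + q * g x (\<xi> x) v * g x (\<eta> x) v))"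
proof -
  note x = N_base[OF \<theta>]
  note sm = msmooth_metric_L[OF normal_sec_smooth[OF \<xi>] normal_sec_smooth[OF \<eta>]]
  show ?thesis
    unfolding mderiv_h_vv[OF \<theta> \<xi> \<eta>] mderiv_vfield(1)[OF \<theta> \<zeta> sm] mderiv_vfield(2)[OF \<theta> \<zeta> \<xi>] mderiv_vfield(2)[OF \<theta> \<zeta> \<eta>]
      vfield_props(2)[OF \<theta> \<zeta>] x_def v_def
    by (simp add: pair_def gsym[OF x, of "snd \<theta>"])
qed

context
  fixes D_L D_N
  assumes D_L: "levi_civita L I D_L" and D_N: "levi_civita N h D_N"
begin

section \<open>The four covariant derivatives\<close>

lemmas koszul_N = koszul[OF D_N _ _ _ _ h_bilinear h_sym]

text \<open>R(X, Y) is skew, so R(X, Y)\<theta> is orthogonal to \<theta>. This removes the q-term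
  in \<open>nabla_h_v\<close>.\<close>

lemma curvature_self:
  assumes X: "vector_field L X" and Y: "vector_field L Y" and \<theta>: "\<theta> \<in> points N"
  shows "g (fst \<theta>) (normal_curvature M g L Dn (fst \<theta>) (X (fst \<theta>)) (Y (fst \<theta>)) (snd \<theta>)) (snd \<theta>) = 0"
    "normal_curvature M g L Dn (fst \<theta>) (X (fst \<theta>)) (Y (fst \<theta>)) (snd \<theta>) \<in> normal_space M g L (fst \<theta>)"
proof -
  note x = N_base[OF \<theta>]
  obtain \<xi> where \<xi>: "normal_sec \<xi>" "\<xi> (fst \<theta>) = snd \<theta>" by (rule normal_sec_extension[OF x N_normal[OF \<theta>]])
  show "g (fst \<theta>) (normal_curvature M g L Dn (fst \<theta>) (X (fst \<theta>)) (Y (fst \<theta>)) (snd \<theta>)) (snd \<theta>) = 0"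
    using normal_curvature_eq[OF X Y \<xi>(1) x] curvature_skew[OF X Y \<xi>(1) \<xi>(1) x] gsym[OF x] by (simp add: \<xi>(2))
  show "normal_curvature M g L Dn (fst \<theta>) (X (fst \<theta>)) (Y (fst \<theta>)) (snd \<theta>) \<in> normal_space M g L (fst \<theta>)"
    using normal_curvature_eq[OF X Y \<xi>(1) x] curvature_in[OF X Y \<xi>(1) x] by (simp add: \<xi>(2))
qed

lemma nabla_h_h:
  assumes X: "vector_field L X" and Y: "vector_field L Y" and \<theta>: "\<theta> \<in> points N"
  shows "D_N (hfield X) (hfield Y) \<theta> = hlift L N K \<theta> (D_L X Y (fst \<theta>)) -
    (1/2) *\<^sub>R vlift L N K \<theta> (normal_curvature M g L Dn (fst \<theta>) (X (fst \<theta>)) (Y (fst \<theta>)) (snd \<theta>))"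
    (is "?D = ?T")
proof (rule h_eqI[OF \<theta>])
  let ?x = "fst \<theta>"
  note x = N_base[OF \<theta>]
  note R = curvature_self[OF X Y \<theta>]
  note hX = hfield_vector_field[OF X] and hY = hfield_vector_field[OF Y]
  have T: "dpi \<theta> ?T = D_L X Y ?x" "K \<theta> ?T = - (1/2) *\<^sub>R normal_curvature M g L Dn ?x (X ?x) (Y ?x) (snd \<theta>)"
    by (simp_all add: linear_diff[OF dpi_linear[OF \<theta>]] linear_diff[OF K_linear[OF \<theta>]] linear_scale[OF dpi_linear[OF \<theta>]]
        linear_scale[OF K_linear[OF \<theta>]] hlift_props[OF \<theta>] vlift_props[OF \<theta> R(2)])
  show "h \<theta> ?D (hfield Z \<theta>) = h \<theta> ?T (hfield Z \<theta>)" if Z: "vector_field L Z" for Z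
  proof -
    \<comment> \<open>Term by term, the Koszul formula for horizontal lifts is the one on L at the
      base point.\<close>
    have "2 * h \<theta> ?D (hfield Z \<theta>) = 2 * I ?x (D_L X Y ?x) (Z ?x)"
      unfolding koszul_N[OF hX hY hfield_vector_field[OF Z] \<theta> \<theta> \<theta>]
      unfolding koszul[OF D_L X Y Z x bilinear_induced[OF x] I_sym[OF x]]
        mderiv_h_hh[OF \<theta> Y Z] mderiv_h_hh[OF \<theta> Z X] mderiv_h_hh[OF \<theta> X Y] hfield_props[OF \<theta>]
        h_hfield[OF \<theta>] bracket_h_h(1)[OF X Y \<theta>] bracket_h_h(1)[OF X Z \<theta>] bracket_h_h(1)[OF Y Z \<theta>] ..
    then show ?thesis unfolding h_hfield[OF \<theta>] T by simp
  qed
  show "h \<theta> ?D (vfield \<zeta> \<theta>) = h \<theta> ?T (vfield \<zeta> \<theta>)" if \<zeta>: "normal_sec \<zeta>" for \<zeta>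
  proof -
    have z: "mderiv L (\<lambda>x. I x (X x) (Y x)) ?x 0 = 0" by (rule mderiv_L_zero[OF msmooth_I[OF X Y] x])
    \<comment> \<open>Metric derivatives vanish by orthogonality or because the vertical direction
      projects to 0, and brackets with a vertical lift are vertical; only [X^h, Y^h]
      remains.\<close>
    have "2 * h \<theta> ?D (vfield \<zeta> \<theta>) = h \<theta> (lie_bracket N (hfield X) (hfield Y) \<theta>) (vfield \<zeta> \<theta>)"
      unfolding koszul_N[OF hX hY vfield_vector_field[OF \<zeta>] \<theta> \<theta> \<theta>]
        mderiv_h_vh[OF \<theta> \<zeta>] mderiv_h_hh[OF \<theta> X Y] vfield_props(1)[OF \<theta> \<zeta>] z
        bracket_h_v[OF X \<zeta> \<theta>] bracket_h_v[OF Y \<zeta> \<theta>] h_hfield[OF \<theta>]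
        vfield_props(1)[OF \<theta> Dn_sec[OF X \<zeta>]] vfield_props(1)[OF \<theta> Dn_sec[OF Y \<zeta>]] bilinear_lzero[OF bilinear_induced[OF x]]
      by simp
    then show ?thesis unfolding h_vfield[OF \<theta> \<zeta>] T bracket_h_h(2)[OF X Y \<theta>]
      by (auto simp: bilinear_lneg[OF bl[OF x]] bilinear_lmul[OF bl[OF x]])
  qed
qed

lemma nabla_h_v:
  assumes X: "vector_field L X" and \<eta>: "normal_sec \<eta>" and \<theta>: "\<theta> \<in> points N"
  shows "D_N (hfield X) (vfield \<eta>) \<theta> =
    (1/2 * omega g \<theta> powr p) *\<^sub>R hlift L N K \<theta> (adjoint_curvature M g L Dn (fst \<theta>) (snd \<theta>) (\<eta> (fst \<theta>)) (X (fst \<theta>))) +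
    vlift L N K \<theta> (Dn X \<eta> (fst \<theta>))"
    (is "?D = ?T")
proof (rule h_eqI[OF \<theta>])
  let ?x = "fst \<theta>"
  note x = N_base[OF \<theta>]
  note hX = hfield_vector_field[OF X] and v\<eta> = vfield_vector_field[OF \<eta>]
  note D\<eta> = Dn_sec[OF X \<eta>]
  have T: "dpi \<theta> ?T = (1/2 * omega g \<theta> powr p) *\<^sub>R adjoint_curvature M g L Dn ?x (snd \<theta>) (\<eta> ?x) (X ?x)" "K \<theta> ?T = Dn X \<eta> ?x"
    by (simp_all add: linear_add[OF dpi_linear[OF \<theta>]] linear_add[OF K_linear[OF \<theta>]] linear_scale[OF dpi_linear[OF \<theta>]]
        linear_scale[OF K_linear[OF \<theta>]] hlift_props[OF \<theta>] vlift_props[OF \<theta> normal_sec_in[OF D\<eta> x]])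
  show "h \<theta> ?D (hfield Z \<theta>) = h \<theta> ?T (hfield Z \<theta>)" if Z: "vector_field L Z" for Z
  proof -
    have z: "mderiv L (\<lambda>x. I x (Z x) (X x)) ?x 0 = 0" by (rule mderiv_L_zero[OF msmooth_I[OF Z X] x])
    have n: "dpi \<theta> (- vfield (Dn Z \<eta>) \<theta>) = 0"
      by (simp add: linear_neg[OF dpi_linear[OF \<theta>]] vfield_props(1)[OF \<theta> Dn_sec[OF Z \<eta>]])
    \<comment> \<open>Only the bracket [X^h, Z^h] survives, paired with a vertical lift that sees
      minus the curvature.\<close>
    have "2 * h \<theta> ?D (hfield Z \<theta>) = - h \<theta> (lie_bracket N (hfield X) (hfield Z) \<theta>) (vfield \<eta> \<theta>)"
      unfolding koszul_N[OF hX v\<eta> hfield_vector_field[OF Z] \<theta> \<theta> \<theta>]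
      unfolding mderiv_h_vh[OF \<theta> \<eta>] mderiv_h_hh[OF \<theta> Z X] vfield_props(1)[OF \<theta> \<eta>] z
        bracket_h_v[OF X \<eta> \<theta>] bracket_v_h[OF Z \<eta> \<theta>] h_hfield[OF \<theta>] n
        vfield_props(1)[OF \<theta> D\<eta>] bilinear_lzero[OF bilinear_induced[OF x]]
      by simp
    \<comment> \<open>The weight comes from the vertical product with \<eta>; the q-term drops
      because the curvature term is orthogonal to \<theta>.\<close>
    also have "\<dots> = omega g \<theta> powr p * g ?x (normal_curvature M g L Dn ?x (X ?x) (Z ?x) (snd \<theta>)) (\<eta> ?x)"
      unfolding h_vfield[OF \<theta> \<eta>] bracket_h_h(2)[OF X Z \<theta>]
      by (simp add: bilinear_lneg[OF bl[OF x]] curvature_self[OF X Z \<theta>])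
    finally show ?thesis
      unfolding h_hfield[OF \<theta>] T bilinear_lmul[OF bilinear_induced[OF x]] adjoint_curvature_eq[OF x N_normal[OF \<theta>]] by simp
  qed
  show "h \<theta> ?D (vfield \<zeta> \<theta>) = h \<theta> ?T (vfield \<zeta> \<theta>)" if \<zeta>: "normal_sec \<zeta>" for \<zeta>
  proof -
    \<comment> \<open>The metric derivative meets the brackets: the terms with
      \<open>Dn X \<zeta>\<close> cancel, those with \<open>Dn X \<eta>\<close> double.\<close>
    have "2 * h \<theta> ?D (vfield \<zeta> \<theta>) = 2 * h \<theta> (vfield (Dn X \<eta>) \<theta>) (vfield \<zeta> \<theta>)"
      unfolding koszul_N[OF hX v\<eta> vfield_vector_field[OF \<zeta>] \<theta> \<theta> \<theta>]
        mderiv_h_vh[OF \<theta> \<eta>] mderiv_h_vh[OF \<theta> \<zeta>] mderiv_h_vv_hor[OF \<theta> \<eta> \<zeta> X]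
        bracket_h_v[OF X \<eta> \<theta>] bracket_h_v[OF X \<zeta> \<theta>] bracket_v_v[OF \<eta> \<zeta> \<theta>] bilinear_lzero[OF h_bilinear[OF \<theta>]]
      using h_sym[OF \<theta>, of "vfield (Dn X \<zeta>) \<theta>" "vfield \<eta> \<theta>"] by simp
    then show ?thesis unfolding h_vfield[OF \<theta> \<zeta>] T vfield_props(2)[OF \<theta> D\<eta>] by simp
  qed
qed

text \<open>From \<open>nabla_h_v\<close> by vanishing torsion: the bracket of the two lifts is
  exactly the vertical part.\<close>

lemma nabla_v_h:
  assumes Y: "vector_field L Y" and \<eta>: "normal_sec \<eta>" and \<theta>: "\<theta> \<in> points N"
  shows "D_N (vfield \<eta>) (hfield Y) \<theta> =
    (1/2 * omega g \<theta> powr p) *\<^sub>R hlift L N K \<theta> (adjoint_curvature M g L Dn (fst \<theta>) (snd \<theta>) (\<eta> (fst \<theta>)) (Y (fst \<theta>)))"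
proof -
  have "vfield (Dn Y \<eta>) \<theta> = vlift L N K \<theta> (Dn Y \<eta> (fst \<theta>))" by (simp add: vfield_def)
  then show ?thesis
    using levi_civitaD(1)[OF D_N hfield_vector_field[OF Y] vfield_vector_field[OF \<eta>] \<theta>] nabla_h_v[OF Y \<eta> \<theta>]
    by (simp add: bracket_h_v[OF Y \<eta> \<theta>] algebra_simps)
qed

text \<open>Vertical lifts commute, so against vertical lifts only derivatives of the metric along
  the fibre contribute.\<close>

lemma nabla_v_v:
  assumes \<xi>: "normal_sec \<xi>" and \<eta>: "normal_sec \<eta>" and \<theta>: "\<theta> \<in> points N"
  defines "x \<equiv> fst \<theta>" and "v \<equiv> snd \<theta>" and "\<omega> \<equiv> omega g \<theta>"
  shows "D_N (vfield \<xi>) (vfield \<eta>) \<theta> =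
    - (p * \<omega>) *\<^sub>R (g x (\<xi> x) v *\<^sub>R vfield \<eta> \<theta> + g x (\<eta> x) v *\<^sub>R vfield \<xi> \<theta>)
    + (p * q * \<omega> / (1 + q * g x v v) * g x (\<xi> x) v * g x (\<eta> x) v + (q + p * \<omega>) / (1 + q * g x v v) * g x (\<xi> x) (\<eta> x)) *\<^sub>R
      vlift L N K \<theta> v"
    (is "?D = ?T")
proof (rule h_eqI[OF \<theta>])
  note x = N_base[OF \<theta>, folded x_def]
  note v\<xi> = vfield_vector_field[OF \<xi>] and v\<eta> = vfield_vector_field[OF \<eta>]
  note v = N_normal[OF \<theta>, folded x_def v_def]
  \<comment> \<open>The coefficient of \<Theta>. In the vertical comparison it is used only through
    its product with 1 + q<v, v>, which is positive and clears the denominators.\<close>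
  define C where "C = p * q * \<omega> / (1 + q * g x v v) * g x (\<xi> x) v * g x (\<eta> x) v + (q + p * \<omega>) / (1 + q * g x v v) * g x (\<xi> x) (\<eta> x)"
  have "1 + q * g x v v > 0" using q gnonneg[OF x, of v] by (simp add: add_pos_nonneg)
  moreover have "(a / d * s * t + b / d * m) * d = a * s * t + b * m" if "d > 0" for a b d s t m :: real
    using that by (simp add: field_simps)
  ultimately have c: "C * (1 + q * g x v v) = p * q * \<omega> * g x (\<xi> x) v * g x (\<eta> x) v + (q + p * \<omega>) * g x (\<xi> x) (\<eta> x)"
    unfolding C_def by blast
  have T: "dpi \<theta> ?T = 0" "K \<theta> ?T = - (p * \<omega>) *\<^sub>R (g x (\<xi> x) v *\<^sub>R \<eta> x + g x (\<eta> x) v *\<^sub>R \<xi> x) + C *\<^sub>R v"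
    using vlift_props[OF \<theta>, of v] v
    by (simp_all add: linear_add[OF dpi_linear[OF \<theta>]] linear_add[OF K_linear[OF \<theta>]] linear_scale[OF dpi_linear[OF \<theta>]]
        linear_scale[OF K_linear[OF \<theta>]] linear_diff[OF dpi_linear[OF \<theta>]] linear_diff[OF K_linear[OF \<theta>]]
        vfield_props[OF \<theta> \<xi>] vfield_props[OF \<theta> \<eta>] x_def v_def C_def)
  show "h \<theta> ?D (hfield Z \<theta>) = h \<theta> ?T (hfield Z \<theta>)" if Z: "vector_field L Z" for Z
  proof -
    have n: "h \<theta> (- A) B = - h \<theta> A B" for A B by (rule bilinear_lneg[OF h_bilinear[OF \<theta>]])
    \<comment> \<open>The horizontal derivative of the metric is undone by the two brackets with
      \<open>hfield Z\<close>.\<close>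
    have "2 * h \<theta> ?D (hfield Z \<theta>) = 0"
      unfolding koszul_N[OF v\<xi> v\<eta> hfield_vector_field[OF Z] \<theta> \<theta> \<theta>]
        mderiv_h_vh[OF \<theta> \<eta>] mderiv_h_vh[OF \<theta> \<xi>] mderiv_h_vv_hor[OF \<theta> \<xi> \<eta> Z]
        bracket_v_v[OF \<xi> \<eta> \<theta>] bracket_v_h[OF Z \<xi> \<theta>] bracket_v_h[OF Z \<eta> \<theta>] bilinear_lzero[OF h_bilinear[OF \<theta>]] n
      using h_sym[OF \<theta>, of "vfield (Dn Z \<eta>) \<theta>" "vfield \<xi> \<theta>"] by simp
    then show ?thesis unfolding h_hfield[OF \<theta>] T(1) using bilinear_lzero[OF bilinear_induced[OF x]] by (simp add: x_def)
  qed
  show "h \<theta> ?D (vfield \<zeta> \<theta>) = h \<theta> ?T (vfield \<zeta> \<theta>)" if \<zeta>: "normal_sec \<zeta>" for \<zeta>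
  proof -
    \<comment> \<open>With the products named, the Koszul terms are polynomials in real variables
      and what remains is algebra.\<close>
    define a s t z m n l r where "a = \<omega> powr p" and "s = g x (\<xi> x) v" and "t = g x (\<eta> x) v" and "z = g x (\<zeta> x) v"
      and "m = g x (\<xi> x) (\<eta> x)" and "n = g x (\<eta> x) (\<zeta> x)" and "l = g x (\<xi> x) (\<zeta> x)" and "r = g x v v"
    note defs = a_def s_def t_def z_def m_def n_def l_def r_def
    have sym: "g x (\<eta> x) (\<xi> x) = m" "g x (\<zeta> x) (\<eta> x) = n" "g x (\<zeta> x) (\<xi> x) = l" "g x v (\<zeta> x) = z"
      by (simp_all add: defs gsym[OF x, of "\<eta> x" "\<xi> x"] gsym[OF x, of "\<zeta> x" "\<eta> x"] gsym[OF x, of "\<zeta> x" "\<xi> x"] gsym[OF x, of v "\<zeta> x"])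
    have "2 * h \<theta> ?D (vfield \<zeta> \<theta>) =
        a * (q * (t * l + m * z) - 2 * p * \<omega> * s * (n + q * t * z)) +
        a * (q * (z * m + n * s) - 2 * p * \<omega> * t * (l + q * z * s)) -
        a * (q * (s * n + l * t) - 2 * p * \<omega> * z * (m + q * s * t))"
      unfolding koszul_N[OF v\<xi> v\<eta> vfield_vector_field[OF \<zeta>] \<theta> \<theta> \<theta>]
        mderiv_h_vv_ver[OF \<theta> \<eta> \<zeta> \<xi>] mderiv_h_vv_ver[OF \<theta> \<zeta> \<xi> \<eta>] mderiv_h_vv_ver[OF \<theta> \<xi> \<eta> \<zeta>]
        bracket_v_v[OF \<xi> \<eta> \<theta>] bracket_v_v[OF \<xi> \<zeta> \<theta>] bracket_v_v[OF \<eta> \<zeta> \<theta>] bilinear_lzero[OF h_bilinear[OF \<theta>]]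
      unfolding x_def[symmetric] v_def[symmetric] \<omega>_def[symmetric] sym defs[symmetric] by simp
    then have 1: "h \<theta> ?D (vfield \<zeta> \<theta>) = a * (q * z * m - p * \<omega> * (s * n + t * l + q * s * t * z - z * m))"
      by (simp add: algebra_simps)
    have "h \<theta> ?T (vfield \<zeta> \<theta>) = a * (- (p * \<omega>) * (s * n + t * l) + C * z + q * (- (p * \<omega>) * (s * t + t * s) + C * r) * z)"
      unfolding h_vfield[OF \<theta> \<zeta>] T(2)
      unfolding x_def[symmetric] v_def[symmetric] \<omega>_def[symmetric]
      by (simp only: bilinear_ladd[OF bl[OF x]] bilinear_lmul[OF bl[OF x]] sym defs[symmetric] real_scaleR_def)
    \<comment> \<open>C enters once through the fibre metric and once, as q C r, through the q-term;
      together they form C(1 + q r).\<close>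
    also have "\<dots> = a * (- (p * \<omega>) * (s * n + t * l) + z * (C * (1 + q * g x v v)) - 2 * q * p * \<omega> * s * t * z)"
      by (simp only: r_def[symmetric]) (simp add: algebra_simps)
    also have "\<dots> = a * (q * z * m - p * \<omega> * (s * n + t * l + q * s * t * z - z * m))"
      unfolding c unfolding defs[symmetric] by (simp add: algebra_simps)
    finally show ?thesis using 1 by simp
  qed
qed

end

end

end

theorem lemma5:
  fixes M :: "('m, 'e::euclidean_space) atlas"
    and g :: "'m \<Rightarrow> 'e \<Rightarrow> 'e \<Rightarrow> real"
    and L :: "('m, 'l::euclidean_space) atlas"
    and N :: "('m \<times> 'e, 'l \<times> 'k::euclidean_space) atlas"
    and D_L :: "('m \<Rightarrow> 'l) \<Rightarrow> ('m \<Rightarrow> 'l) \<Rightarrow> 'm \<Rightarrow> 'l"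
    and D_n :: "('m \<Rightarrow> 'l) \<Rightarrow> ('m \<Rightarrow> 'e) \<Rightarrow> 'm \<Rightarrow> 'e"
    and K :: "'m \<times> 'e \<Rightarrow> 'l \<times> 'k \<Rightarrow> 'e"
    and D_N :: "('m \<times> 'e \<Rightarrow> 'l \<times> 'k) \<Rightarrow> ('m \<times> 'e \<Rightarrow> 'l \<times> 'k) \<Rightarrow> 'm \<times> 'e \<Rightarrow> 'l \<times> 'k"
    and p q :: real
  assumes "smooth_manifold M" and "riemannian_metric M g"
    and "submanifold L M"
    and "DIM('l) < DIM('e)" and "DIM('k) = DIM('e) - DIM('l)"
    and "N = normal_bundle M g L"
    and "levi_civita L (induced_metric M g L) D_L"
    and "normal_connection M g L D_n"
    and "connection_map M g L N D_n K"
    and "q \<ge> 0"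
    and "levi_civita N (pq_metric M g L N K p q) D_N"
    and "vector_field L X" and "vector_field L Y"
    and "normal_section M g L \<xi>" and "normal_section M g L \<eta>"
    and "\<theta> \<in> points N"
  shows "let x = fst \<theta>; v = snd \<theta>;
             hor = hlift L N K;
             ver = vlift L N K;
             Xh = (\<lambda>\<theta>'. hor \<theta>' (X (fst \<theta>')));
             Yh = (\<lambda>\<theta>'. hor \<theta>' (Y (fst \<theta>')));
             \<xi>v = (\<lambda>\<theta>'. ver \<theta>' (\<xi> (fst \<theta>')));
             \<eta>v = (\<lambda>\<theta>'. ver \<theta>' (\<eta> (fst \<theta>')));
             \<Theta> = (\<lambda>\<theta>'. ver \<theta>' (snd \<theta>'));
             R = normal_curvature M g L D_n x;
             R_hat = adjoint_curvature M g L D_n x;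
             \<omega> = omega g \<theta>;
             \<nu> = p * q * \<omega> / (1 + q * g x v v);
             \<mu> = (q + p * \<omega>) / (1 + q * g x v v)
         in D_N Xh Yh \<theta> = hor \<theta> (D_L X Y x) - (1/2) *\<^sub>R ver \<theta> (R (X x) (Y x) v)
          \<and> D_N Xh \<eta>v \<theta> =
              (1/2 * \<omega> powr p) *\<^sub>R hor \<theta> (R_hat v (\<eta> x) (X x)) + ver \<theta> (D_n X \<eta> x)
          \<and> D_N \<eta>v Yh \<theta> = (1/2 * \<omega> powr p) *\<^sub>R hor \<theta> (R_hat v (\<eta> x) (Y x))
          \<and> D_N \<xi>v \<eta>v \<theta> =
              - (p * \<omega>) *\<^sub>R (g x (\<xi> x) v *\<^sub>R \<eta>v \<theta> + g x (\<eta> x) v *\<^sub>R \<xi>v \<theta>)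
              + (\<nu> * g x (\<xi> x) v * g x (\<eta> x) v + \<mu> * g x (\<xi> x) (\<eta> x)) *\<^sub>R \<Theta> \<theta>"
proof -
  interpret normal_bundle_conn M g L D_n N K
    by unfold_locales (use assms in auto)
  have h: "hfield Z = (\<lambda>\<theta>'. hlift L N K \<theta>' (Z (fst \<theta>')))" for Z by (simp add: hfield_def)
  have v: "vfield \<zeta> = (\<lambda>\<theta>'. vlift L N K \<theta>' (\<zeta> (fst \<theta>')))" for \<zeta> by (simp add: vfield_def)
  note X = \<open>vector_field L X\<close> and Y = \<open>vector_field L Y\<close>
    and \<xi> = \<open>normal_section M g L \<xi>\<close> and \<eta> = \<open>normal_section M g L \<eta>\<close> and \<theta> = \<open>\<theta> \<in> points N\<close>
  note D = \<open>q \<ge> 0\<close> \<open>levi_civita L (induced_metric M g L) D_L\<close> \<open>levi_civita N (pq_metric M g L N K p q) D_N\<close>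
  show ?thesis
    \<comment> \<open>\<open>\<Theta>\<close> is evaluated at \<open>\<theta>\<close> only, where it
      is the vertical lift of \<open>snd \<theta>\<close> as in \<open>nabla_v_v\<close>.\<close>
    unfolding Let_def
    using nabla_h_h[OF D X Y \<theta>] nabla_h_v[OF D X \<eta> \<theta>] nabla_v_h[OF D Y \<eta> \<theta>] nabla_v_v[OF D \<xi> \<eta> \<theta>]
    unfolding h v by (intro conjI)
qed

end
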